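(* Let $(M,g)$ be a time-oriented Lorentzian manifold and let $t:M\to\mathbb{R}$ be an sm Cauchy temporal function on $(M,g)$. Then every level set of $t$, equipped with the induced Riemannian metric, is complete.
   Context: Lorentzian metrics have signature $(-,+,\dots,+)$. A function $t:M\to\mathbb{R}$ is a temporal function if it is $C^1$ and its $g$-gradient $\mathrm{grad}\, t$ is past-directed timelike at every point. It is Cauchy if $t\circ c$ is surjective onto $\mathbb{R}$ for every inextendible causal curve $c$ (equivalently, every level set is a Cauchy surface). For a temporal function $t$, the flip metric $g_+^t$ is the Riemannian metric that equals $g$ on $(\mathrm{grad}\, t)^{\perp}$, equals $-g$ on $\mathbb{R}\cdot\mathrm{grad}\, t$, and makes these two subspaces orthogonal. For a Riemannian metric $G$ on $M$, a subset $A\subset M$, $k\in\mathbb{N}$ and a smooth vector field $u$ on $M$, put $$\|u\|_{C^k(A,G)}:=\sum_{i=0}^k\sup\{\|\nabla^{(i)}(V_1,\dots,V_i)u(x)\|_G : x\in A,\ V_j\in T_xM,\ G(V_j,V_j)=1\},$$ where $\nabla$ is the Levi-Civita connection of $g$ and $\nabla^{(i)}u$ is the $i$-th iterated covariant derivative of $u$ (with $\nabla^{(0)}u=u$). A smooth function $t$ is an s function (semi-steep) if there is a continuous function $h$ on the range of $t$ with values in $(-\infty,0)$ such that $g(\mathrm{grad}\, t,\mathrm{grad}\, t)<h(a)$ on $t^{-1}(a)$ for every $a$. A smooth temporal function $t$ is an m function (semimild) if there is a continuous function $C$ on the range of $t$ with values in $(0,\infty)$ such that $\|\mathrm{grad}\,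 t\|_{C^1(t^{-1}(a),\,g_+^t)}\le C(a)$ for every $a$. An sm Cauchy temporal function is a Cauchy temporal function that is both an s function and an m function. *)

theory Defs
  imports "HOL-Analysis.Analysis"
begin

section \<open>Smooth maps between Euclidean spaces\<close>

fun Ck_on :: "nat \<Rightarrow> 'b::euclidean_space set \<Rightarrow> ('b \<Rightarrow> 'c::real_normed_vector) \<Rightarrow> bool" where
  "Ck_on 0 S f \<longleftrightarrow> continuous_on S f"
| "Ck_on (Suc k) S f \<longleftrightarrow> (\<forall>x\<in>S. f differentiable (at x)) \<and>
     (\<forall>v. Ck_on k S (\<lambda>x. frechet_derivative f (at x) v))"

definition smooth_on :: "'b::euclidean_space set \<Rightarrow> ('b \<Rightarrow> 'c::real_normed_vector) \<Rightarrow> bool" where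
  "smooth_on S f \<longleftrightarrow> (\<forall>k. Ck_on k S f)"


section \<open>Manifolds\<close>

text \<open>
  The manifold is the whole type \<open>'a\<close>, a second countable Hausdorff space, with an atlas of
  charts into the Euclidean model space \<open>'b\<close>. A chart is a pair of its domain and its map; the
  values of the map outside the domain are irrelevant.
\<close>

type_synonym ('a, 'b) chart = "'a set \<times> ('a \<Rightarrow> 'b)"

definition cdom :: "('a, 'b) chart \<Rightarrow> 'a set" where
  "cdom c = fst c"

definition cmap :: "('a, 'b) chart \<Rightarrow> 'a \<Rightarrow> 'b" where
  "cmap c = snd c"

definition cinv :: "('a, 'b) chart \<Rightarrow> 'b \<Rightarrow> 'a" where
  "cinv c = inv_into (fst c) (snd c)"

definition smooth_atlas ::
  "('a::{t2_space,second_countable_topology}, 'b::euclidean_space) chart set \<Rightarrow> bool" where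
  "smooth_atlas A \<longleftrightarrow>
     (\<Union>c\<in>A. cdom c) = UNIV \<and>
     (\<forall>c\<in>A. open (cdom c) \<and> open (cmap c ` cdom c) \<and>
        homeomorphism (cdom c) (cmap c ` cdom c) (cmap c) (cinv c)) \<and>
     (\<forall>c\<in>A. \<forall>d\<in>A. smooth_on (cmap c ` (cdom c \<inter> cdom d)) (cmap d \<circ> cinv c))"

text \<open>
  A tangent vector at \<open>x\<close> is given by a coordinate vector \<open>v :: 'b\<close> with respect to a chart \<open>c\<close>
  around \<open>x\<close>; the pairs \<open>(c, v)\<close> and \<open>(d, transition c d x v)\<close> stand for the same vector.
  Accordingly a tensor field is a family of coordinate expressions indexed by the charts which
  transforms as it should. Every notion below that is computed in a chart is invariant under
  these transformations.
\<close>

definition transition :: "('a, 'b::euclidean_space) chart \<Rightarrow> ('a, 'b) chart \<Rightarrow> 'a \<Rightarrow> 'b \<Rightarrow> 'b" where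
  "transition c d x = frechet_derivative (cmap d \<circ> cinv c) (at (cmap c x))"

type_synonym ('a, 'b) vfield = "('a, 'b) chart \<Rightarrow> 'a \<Rightarrow> 'b"
type_synonym ('a, 'b) metric = "('a, 'b) chart \<Rightarrow> 'a \<Rightarrow> 'b \<Rightarrow> 'b \<Rightarrow> real"

definition continuous_vfield ::
  "('a::topological_space, 'b::euclidean_space) chart set \<Rightarrow> ('a, 'b) vfield \<Rightarrow> bool" where
  "continuous_vfield A X \<longleftrightarrow>
     (\<forall>c\<in>A. continuous_on (cdom c) (X c)) \<and>
     (\<forall>c\<in>A. \<forall>d\<in>A. \<forall>x\<in>cdom c \<inter> cdom d. X d x = transition c d x (X c x))"

definition Ck_fun :: "nat \<Rightarrow> ('a, 'b::euclidean_space) chart set \<Rightarrow> ('a \<Rightarrow> real) \<Rightarrow> bool" where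
  "Ck_fun k A f \<longleftrightarrow> (\<forall>c\<in>A. Ck_on k (cmap c ` cdom c) (f \<circ> cinv c))"

definition smooth_fun :: "('a, 'b::euclidean_space) chart set \<Rightarrow> ('a \<Rightarrow> real) \<Rightarrow> bool" where
  "smooth_fun A f \<longleftrightarrow> (\<forall>c\<in>A. smooth_on (cmap c ` cdom c) (f \<circ> cinv c))"

definition differential :: "('a \<Rightarrow> real) \<Rightarrow> ('a, 'b::euclidean_space) chart \<Rightarrow> 'a \<Rightarrow> 'b \<Rightarrow> real" where
  "differential f c x = frechet_derivative (f \<circ> cinv c) (at (cmap c x))"


section \<open>Time-oriented Lorentzian manifolds\<close>

text \<open>Symmetric bilinear forms of signature \<open>(-,+,...,+)\<close>: there is an orthonormal basis
  (indexed here by the standard basis of \<open>'b\<close>) with exactly one negative vector.\<close>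

definition lorentz_form :: "('b::euclidean_space \<Rightarrow> 'b \<Rightarrow> real) \<Rightarrow> bool" where
  "lorentz_form q \<longleftrightarrow> bilinear q \<and> (\<forall>u v. q u v = q v u) \<and>
     (\<exists>e :: 'b \<Rightarrow> 'b. \<exists>b0\<in>Basis :: 'b set. \<forall>i\<in>Basis. \<forall>j\<in>Basis.
        q (e i) (e j) = (if i \<noteq> j then 0 else if i = b0 then - 1 else 1))"

definition lorentz_metric ::
  "('a::topological_space, 'b::euclidean_space) chart set \<Rightarrow> ('a, 'b) metric \<Rightarrow> bool" where
  "lorentz_metric A g \<longleftrightarrow>
     (\<forall>c\<in>A. \<forall>x\<in>cdom c. lorentz_form (g c x)) \<and>
     (\<forall>c\<in>A. \<forall>u v. smooth_on (cmap c ` cdom c) (\<lambda>y. g c (cinv c y) u v)) \<and>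
     (\<forall>c\<in>A. \<forall>d\<in>A. \<forall>x\<in>cdom c \<inter> cdom d. \<forall>u v.
        g c x u v = g d x (transition c d x u) (transition c d x v))"

definition timelike :: "('b::euclidean_space \<Rightarrow> 'b \<Rightarrow> real) \<Rightarrow> 'b \<Rightarrow> bool" where
  "timelike q v \<longleftrightarrow> q v v < 0"

definition causal :: "('b::euclidean_space \<Rightarrow> 'b \<Rightarrow> real) \<Rightarrow> 'b \<Rightarrow> bool" where
  "causal q v \<longleftrightarrow> v \<noteq> 0 \<and> q v v \<le> 0"

text \<open>The time orientation is given by a continuous timelike vector field \<open>T\<close>: a causal vector
  \<open>v\<close> is future-directed if \<open>g(v,T) < 0\<close> and past-directed if \<open>g(v,T) > 0\<close>.\<close>

definition time_oriented_lorentz_manifold ::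
  "('a::{t2_space,second_countable_topology}, 'b::euclidean_space) chart set
    \<Rightarrow> ('a, 'b) metric \<Rightarrow> ('a, 'b) vfield \<Rightarrow> bool" where
  "time_oriented_lorentz_manifold A g T \<longleftrightarrow>
     smooth_atlas A \<and> lorentz_metric A g \<and> continuous_vfield A T \<and>
     (\<forall>c\<in>A. \<forall>x\<in>cdom c. timelike (g c x) (T c x))"

definition future_directed ::
  "('a, 'b::euclidean_space) metric \<Rightarrow> ('a, 'b) vfield \<Rightarrow> ('a, 'b) chart \<Rightarrow> 'a \<Rightarrow> 'b \<Rightarrow> bool" where
  "future_directed g T c x v \<longleftrightarrow> g c x v (T c x) < 0"

definition past_directed ::
  "('a, 'b::euclidean_space) metric \<Rightarrow> ('a, 'b) vfield \<Rightarrow> ('a, 'b) chart \<Rightarrow> 'a \<Rightarrow> 'b \<Rightarrow> bool" where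
  "past_directed g T c x v \<longleftrightarrow> g c x v (T c x) > 0"


section \<open>Piecewise \<open>C\<^sup>1\<close> curves\<close>

text \<open>On a compact interval \<open>{a..b}\<close>, with one-sided derivatives at the end points.\<close>

definition C1_curve_on ::
  "('a::topological_space, 'b::euclidean_space) chart set \<Rightarrow> (real \<Rightarrow> 'a) \<Rightarrow> real \<Rightarrow> real \<Rightarrow> bool" where
  "C1_curve_on A \<gamma> a b \<longleftrightarrow> continuous_on {a..b} \<gamma> \<and>
     (\<forall>c\<in>A. \<exists>D.
        (\<forall>s\<in>{a..b}. \<gamma> s \<in> cdom c \<longrightarrow>
           ((cmap c \<circ> \<gamma>) has_vector_derivative D s) (at s within {a..b})) \<and>
        continuous_on {s\<in>{a..b}. \<gamma> s \<in> cdom c} D)"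

text \<open>Compact subintervals of \<open>I\<close> without a break point from \<open>B\<close> in the interior\<close>

definition piece :: "real set \<Rightarrow> real set \<Rightarrow> real \<Rightarrow> real \<Rightarrow> bool" where
  "piece I B a b \<longleftrightarrow> a < b \<and> {a..b} \<subseteq> I \<and> B \<inter> {a<..<b} = {}"

definition piecewise_C1_curve ::
  "('a::topological_space, 'b::euclidean_space) chart set
    \<Rightarrow> real set \<Rightarrow> real set \<Rightarrow> (real \<Rightarrow> 'a) \<Rightarrow> bool" where
  "piecewise_C1_curve A I B \<gamma> \<longleftrightarrow>
     is_interval I \<and> (\<exists>a\<in>I. \<exists>b\<in>I. a < b) \<and> continuous_on I \<gamma> \<and>
     (\<forall>a b. {a..b} \<subseteq> I \<longrightarrow> finite (B \<inter> {a..b})) \<and>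
     (\<forall>a b. piece I B a b \<longrightarrow> C1_curve_on A \<gamma> a b)"

definition velocity :: "(real \<Rightarrow> 'a) \<Rightarrow> real set \<Rightarrow> ('a, 'b::euclidean_space) chart \<Rightarrow> real \<Rightarrow> 'b" where
  "velocity \<gamma> J c s = vector_derivative (cmap c \<circ> \<gamma>) (at s within J)"

text \<open>At a break point both one-sided velocities are required to lie in the same causal cone.\<close>

definition causal_curve ::
  "('a::topological_space, 'b::euclidean_space) chart set \<Rightarrow> ('a, 'b) metric \<Rightarrow> ('a, 'b) vfield
    \<Rightarrow> real set \<Rightarrow> (real \<Rightarrow> 'a) \<Rightarrow> bool" where
  "causal_curve A g T I \<gamma> \<longleftrightarrow> (\<exists>B. piecewise_C1_curve A I B \<gamma> \<and>
     (\<forall>a b. piece I B a b \<longrightarrow> (\<forall>s\<in>{a..b}. \<forall>c\<in>A. \<gamma> s \<in> cdom c \<longrightarrow>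
        causal (g c (\<gamma> s)) (velocity \<gamma> {a..b} c s))) \<and>
     ((\<forall>a b. piece I B a b \<longrightarrow> (\<forall>s\<in>{a..b}. \<forall>c\<in>A. \<gamma> s \<in> cdom c \<longrightarrow>
        future_directed g T c (\<gamma> s) (velocity \<gamma> {a..b} c s))) \<or>
      (\<forall>a b. piece I B a b \<longrightarrow> (\<forall>s\<in>{a..b}. \<forall>c\<in>A. \<gamma> s \<in> cdom c \<longrightarrow>
        past_directed g T c (\<gamma> s) (velocity \<gamma> {a..b} c s)))))"

definition right_endpoint :: "real set \<Rightarrow> (real \<Rightarrow> 'a::topological_space) \<Rightarrow> 'a \<Rightarrow> bool" where
  "right_endpoint I \<gamma> p \<longleftrightarrow>
     (\<forall>U. open U \<and> p \<in> U \<longrightarrow> (\<exists>s0\<in>I. \<forall>s\<in>I. s0 \<le> s \<longrightarrow> \<gamma> s \<in> U))"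

definition left_endpoint :: "real set \<Rightarrow> (real \<Rightarrow> 'a::topological_space) \<Rightarrow> 'a \<Rightarrow> bool" where
  "left_endpoint I \<gamma> p \<longleftrightarrow>
     (\<forall>U. open U \<and> p \<in> U \<longrightarrow> (\<exists>s0\<in>I. \<forall>s\<in>I. s \<le> s0 \<longrightarrow> \<gamma> s \<in> U))"

text \<open>If \<open>I\<close> contains its supremum or infimum then the value there is an end point, so an
  inextendible curve is automatically defined on an open interval.\<close>

definition inextendible :: "real set \<Rightarrow> (real \<Rightarrow> 'a::topological_space) \<Rightarrow> bool" where
  "inextendible I \<gamma> \<longleftrightarrow> (\<nexists>p. right_endpoint I \<gamma> p) \<and> (\<nexists>p. left_endpoint I \<gamma> p)"


section \<open>Temporal functions\<close>

definition grad :: "('a, 'b::euclidean_space) metric \<Rightarrow> ('a \<Rightarrow> real) \<Rightarrow> ('a, 'b) vfield" where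
  "grad g t c x = (THE N. \<forall>v. g c x N v = differential t c x v)"

definition temporal ::
  "('a, 'b::euclidean_space) chart set \<Rightarrow> ('a, 'b) metric \<Rightarrow> ('a, 'b) vfield \<Rightarrow> ('a \<Rightarrow> real) \<Rightarrow> bool" where
  "temporal A g T t \<longleftrightarrow> Ck_fun 1 A t \<and>
     (\<forall>c\<in>A. \<forall>x\<in>cdom c. timelike (g c x) (grad g t c x) \<and> past_directed g T c x (grad g t c x))"

definition cauchy_temporal ::
  "('a::topological_space, 'b::euclidean_space) chart set \<Rightarrow> ('a, 'b) metric \<Rightarrow> ('a, 'b) vfield
    \<Rightarrow> ('a \<Rightarrow> real) \<Rightarrow> bool" where
  "cauchy_temporal A g T t \<longleftrightarrow> temporal A g T t \<and>
     (\<forall>I \<gamma>. causal_curve A g T I \<gamma> \<and> inextendible I \<gamma> \<longrightarrow> (t \<circ> \<gamma>) ` I = UNIV)"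

definition level_set :: "('a \<Rightarrow> real) \<Rightarrow> real \<Rightarrow> 'a set" where
  "level_set t a = {x. t x = a}"

definition is_flip_form ::
  "('b::euclidean_space \<Rightarrow> 'b \<Rightarrow> real) \<Rightarrow> 'b \<Rightarrow> ('b \<Rightarrow> 'b \<Rightarrow> real) \<Rightarrow> bool" where
  "is_flip_form q N G \<longleftrightarrow> bilinear G \<and>
     (\<forall>v w. q N v = 0 \<and> q N w = 0 \<longrightarrow> G v w = q v w) \<and>
     (\<forall>v\<in>span {N}. \<forall>w\<in>span {N}. G v w = - q v w) \<and>
     (\<forall>v\<in>span {N}. \<forall>w. q N w = 0 \<longrightarrow> G v w = 0 \<and> G w v = 0)"

definition flip_metric :: "('a, 'b::euclidean_space) metric \<Rightarrow> ('a \<Rightarrow> real) \<Rightarrow> ('a, 'b) metric" where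
  "flip_metric g t c x = (THE G. is_flip_form (g c x) (grad g t c x) G)"


section \<open>Levi-Civita connection and \<open>C\<^sup>k\<close> norms\<close>

text \<open>In a chart a linear connection has the form
  \<open>\<nabla>\<^sub>v X = DX(v) + \<Gamma>(v, X)\<close> with \<open>\<Gamma>\<close> bilinear at every point. It is
  torsion-free iff \<open>\<Gamma>\<close> is symmetric, and it is metric iff the product rule below holds for all
  constant coordinate fields \<open>u, v\<close>. Such a \<open>\<Gamma>\<close> exists and is unique at each point.\<close>

definition levi_civita :: "('a, 'b::euclidean_space) metric \<Rightarrow> ('a, 'b) chart \<Rightarrow> 'a \<Rightarrow> 'b \<Rightarrow> 'b \<Rightarrow> 'b" where
  "levi_civita g c x = (THE \<Gamma>. bilinear \<Gamma> \<and> (\<forall>u v. \<Gamma> u v = \<Gamma> v u) \<and>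
     (\<forall>w u v. frechet_derivative (\<lambda>y. g c (cinv c y) u v) (at (cmap c x)) w
        = g c x (\<Gamma> w u) v + g c x u (\<Gamma> w v)))"

text \<open>\<open>iterated_cov g X c [V\<^sub>1,...,V\<^sub>i] x\<close> is the coordinate expression in \<open>c\<close> of
  \<open>\<nabla>\<^sup>(\<^sup>i\<^sup>)(V\<^sub>1,...,V\<^sub>i) X\<close> at \<open>x\<close>, that is, of
  \<open>\<nabla>\<^bsub>V\<^sub>1\<^esub>(\<nabla>\<^sup>(\<^sup>i\<^sup>-\<^sup>1\<^sup>)(V\<^sub>2,...,V\<^sub>i) X)
   - (\<Sum>j. \<nabla>\<^sup>(\<^sup>i\<^sup>-\<^sup>1\<^sup>)(V\<^sub>2,...,\<nabla>\<^bsub>V\<^sub>1\<^esub>V\<^sub>j,...,V\<^sub>i) X)\<close>,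
  where the \<open>V\<^sub>j\<close> are extended as constant coordinate fields.\<close>

function iterated_cov ::
  "('a, 'b::euclidean_space) metric \<Rightarrow> ('a, 'b) vfield \<Rightarrow> ('a, 'b) chart \<Rightarrow> 'b list \<Rightarrow> 'a \<Rightarrow> 'b" where
  "iterated_cov g X c [] x = X c x"
| "iterated_cov g X c (v # vs) x =
     frechet_derivative (\<lambda>y. iterated_cov g X c vs (cinv c y)) (at (cmap c x)) v
     + levi_civita g c x v (iterated_cov g X c vs x)
     - (\<Sum>j<length vs. iterated_cov g X c (vs[j := levi_civita g c x v (vs ! j)]) x)"
  by pat_completeness auto
termination
  by (relation "Wellfounded.measure (\<lambda>(g, X, c, vs, x). length vs)") auto

text \<open>The suprema are taken in the extended nonnegative reals, so that they may be infinite.\<close>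

definition Ck_norm ::
  "nat \<Rightarrow> ('a, 'b::euclidean_space) chart set \<Rightarrow> ('a, 'b) metric \<Rightarrow> 'a set \<Rightarrow> ('a, 'b) metric
    \<Rightarrow> ('a, 'b) vfield \<Rightarrow> ennreal" where
  "Ck_norm k A g S G X = (\<Sum>i\<le>k.
     SUP (c, x, vs) \<in> {(c, x, vs). c \<in> A \<and> x \<in> S \<inter> cdom c \<and> length vs = i \<and>
                                   (\<forall>v\<in>set vs. G c x v v = 1)}.
       ennreal (sqrt (G c x (iterated_cov g X c vs x) (iterated_cov g X c vs x))))"

definition s_function ::
  "('a, 'b::euclidean_space) chart set \<Rightarrow> ('a, 'b) metric \<Rightarrow> ('a \<Rightarrow> real) \<Rightarrow> bool" where
  "s_function A g t \<longleftrightarrow> smooth_fun A t \<and>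
     (\<exists>h. continuous_on (range t) h \<and> (\<forall>a\<in>range t. h a < 0) \<and>
        (\<forall>a\<in>range t. \<forall>c\<in>A. \<forall>x\<in>level_set t a \<inter> cdom c.
           g c x (grad g t c x) (grad g t c x) < h a))"

definition m_function ::
  "('a, 'b::euclidean_space) chart set \<Rightarrow> ('a, 'b) metric \<Rightarrow> ('a, 'b) vfield \<Rightarrow> ('a \<Rightarrow> real) \<Rightarrow> bool" where
  "m_function A g T t \<longleftrightarrow> smooth_fun A t \<and> temporal A g T t \<and>
     (\<exists>C. continuous_on (range t) C \<and> (\<forall>a\<in>range t. C a > 0) \<and>
        (\<forall>a\<in>range t. Ck_norm 1 A g (level_set t a) (flip_metric g t) (grad g t) \<le> ennreal (C a)))"

definition sm_cauchy_temporal ::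
  "('a::topological_space, 'b::euclidean_space) chart set \<Rightarrow> ('a, 'b) metric \<Rightarrow> ('a, 'b) vfield
    \<Rightarrow> ('a \<Rightarrow> real) \<Rightarrow> bool" where
  "sm_cauchy_temporal A g T t \<longleftrightarrow>
     cauchy_temporal A g T t \<and> s_function A g t \<and> m_function A g T t"


section \<open>Completeness of the induced metric\<close>

text \<open>
  For an embedded submanifold \<open>S\<close> (such as a level set of a smooth temporal function) the
  piecewise \<open>C\<^sup>1\<close> curves of \<open>S\<close> are the piecewise \<open>C\<^sup>1\<close> curves of the ambient manifold
  that stay in \<open>S\<close>. Their velocities are tangent to \<open>S\<close>, and there the induced metric is \<open>g\<close>.
  So if the restriction of \<open>g\<close> to \<open>S\<close> is Riemannian, then \<open>riem_dist A g S\<close> is the Riemannian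
  distance of the induced metric, with value \<open>\<infinity>\<close> between different components of \<open>S\<close>.
\<close>

text \<open>The speed does not depend on the chosen chart except possibly at break points and end
  points, finitely many parameters that do not matter for the length.\<close>

definition speed ::
  "('a, 'b::euclidean_space) chart set \<Rightarrow> ('a, 'b) metric \<Rightarrow> (real \<Rightarrow> 'a) \<Rightarrow> real \<Rightarrow> real" where
  "speed A g \<gamma> s = (let c = (SOME c. c \<in> A \<and> \<gamma> s \<in> cdom c); v = velocity \<gamma> UNIV c s
     in sqrt (g c (\<gamma> s) v v))"

definition riem_dist ::
  "('a::topological_space, 'b::euclidean_space) chart set \<Rightarrow> ('a, 'b) metric \<Rightarrow> 'a set
    \<Rightarrow> 'a \<Rightarrow> 'a \<Rightarrow> ennreal" where
  "riem_dist A g S p q =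
     (INF \<gamma>\<in>{\<gamma>. (\<exists>B. piecewise_C1_curve A {0..1} B \<gamma>) \<and> \<gamma> ` {0..1} \<subseteq> S \<and> \<gamma> 0 = p \<and> \<gamma> 1 = q}.
        ennreal (integral {0..1} (speed A g \<gamma>)))"

definition induced_complete ::
  "('a::topological_space, 'b::euclidean_space) chart set \<Rightarrow> ('a, 'b) metric \<Rightarrow> 'a set \<Rightarrow> bool" where
  "induced_complete A g S \<longleftrightarrow>
     (\<forall>X :: nat \<Rightarrow> 'a. (\<forall>n. X n \<in> S) \<and>
        (\<forall>e::real. e > 0 \<longrightarrow> (\<exists>N. \<forall>m\<ge>N. \<forall>n\<ge>N. riem_dist A g S (X m) (X n) < ennreal e)) \<longrightarrow>
        (\<exists>p\<in>S. (\<lambda>n. riem_dist A g S (X n) p) \<longlonglongrightarrow> 0))"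

end

theory Submission
  imports Defs
begin

text \<open>
  Let \<open>X = grad t / g(grad t, grad t)\<close>, so that \<open>dt(X) = 1\<close>. Its integral curves are timelike, hence,
  \<open>t\<close> being Cauchy, defined for all times, and they give a global flow \<open>F\<close> with \<open>t (F \<tau> x) = t x + \<tau>\<close>.
  For \<open>W\<close> tangent to the level sets, \<open>(L\<^sub>X g)(W,W) = 2 g(\<nabla>\<^sub>W grad t, W) / g(grad t, grad t)\<close>, which
  the m and s conditions bound by a constant times \<open>g(W,W)\<close> on a slab \<open>t \<in> {a..a+1}\<close>; so the flow
  distorts the metrics of the level sets in the slab by a bounded factor. If a Cauchy sequence of
  \<open>{t = a}\<close> is joined by curves \<open>\<sigma>\<close> of small total length, then \<open>s \<mapsto> F (\<phi> s) (\<sigma> s)\<close> with \<open>\<phi>'\<close> a large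
  multiple of the speed of \<open>\<sigma>\<close> (plus a little) is a future-directed causal curve on which \<open>t \<le> a + 1\<close>.
  It cannot be inextendible, so it has a future end point, and flowing back shows that the
  sequence converges.
\<close>

section \<open>Calculus of \<open>C\<^sup>k\<close> maps\<close>

text \<open>The slab has unit width because the compact interval \<open>{a..a+1}\<close> must be
  fixed before any curve is lifted: only there do the continuous bounds \<open>h\<close> and
  \<open>C\<close> become constants, and the total lift time is then kept below 1. Three bounds are
  used. The lower bound of \<open>- g(grad t, grad t)\<close> and the first-order part of the m norm
  control the Lie derivative; the zeroth-order part bounds \<open>- g(grad t, grad t)\<close> from
  above, and this sets the price of climbing, since \<open>g(X,X) = 1 / g(grad t, grad t)\<close>
  and a steep \<open>t\<close> makes \<open>X\<close> short. The little extra in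
  \<open>\<phi>'\<close> keeps the lift climbing where \<open>\<sigma>\<close> stands still, as a
  causal velocity must not vanish. The Cauchy condition is used on the integral curves of
  \<open>X\<close> and again on the lift. The lift is preceded by a flow line from the past, along
  which \<open>t\<close> tends to minus infinity, so that only a future end point can occur. The
  causal argument gives convergence in the manifold topology; convergence of the distances in the
  level set is a separate local statement, proved with short curves near the limit.\<close>

lemma Ck_on_has_derivative:
  "Ck_on (Suc k) S f \<Longrightarrow> x \<in> S \<Longrightarrow> (f has_derivative frechet_derivative f (at x)) (at x)"
  by (simp add: frechet_derivative_works[symmetric])

text \<open>Derivatives are taken in the whole space, so equality on \<open>S\<close> determines
  them only because \<open>S\<close> is open; most closure properties below assume
  \<open>open S\<close> for the same reason.\<close>

lemma Ck_on_cong: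
  assumes "open S" "\<And>x. x \<in> S \<Longrightarrow> f x = h x"
  shows "Ck_on k S f \<longleftrightarrow> Ck_on k S h"
proof -
  have imp: "Ck_on k S h" if "Ck_on k S f" "\<And>x. x \<in> S \<Longrightarrow> f x = h x" for f h :: "'a \<Rightarrow> 'b"
    using that
  proof (induction k arbitrary: f h)
    case 0
    then show ?case using continuous_on_cong by fastforce
  next
    case (Suc k)
    have d: "(h has_derivative frechet_derivative f (at x)) (at x)" if "x \<in> S" for x
      by (rule has_derivative_transform_within_open[OF Ck_on_has_derivative[OF Suc.prems(1) that] \<open>open S\<close> that])
        (use Suc.prems(2) in auto)
    then have eq: "frechet_derivative f (at x) = frechet_derivative h (at x)" if "x \<in> S" for x
      using frechet_derivative_at that by blast
    have "Ck_on k S (\<lambda>x. frechet_derivative h (at x) v)" for v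
      by (rule Suc.IH[of "\<lambda>x. frechet_derivative f (at x) v"]) (use Suc.prems(1) eq in auto)
    moreover have "h differentiable (at x)" if "x \<in> S" for x
      using d[OF that] differentiableI by blast
    ultimately show ?case by simp
  qed
  show ?thesis using imp[of f h] imp[of h f] assms(2) by metis
qed

lemma Ck_on_eq:
  "Ck_on k S f \<Longrightarrow> open S \<Longrightarrow> (\<And>x. x \<in> S \<Longrightarrow> f x = h x) \<Longrightarrow> Ck_on k S h"
  using Ck_on_cong by blast

lemma Ck_on_subset: "Ck_on k S f \<Longrightarrow> S' \<subseteq> S \<Longrightarrow> Ck_on k S' f"
  by (induction k arbitrary: f) (auto intro: continuous_on_subset)

lemma Ck_on_Suc_mono: "Ck_on (Suc k) S f \<Longrightarrow> Ck_on k S f"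
proof (induction k arbitrary: f)
  case 0
  then show ?case
    by (auto intro!: continuous_at_imp_continuous_on differentiable_imp_continuous_within)
next
  case (Suc k)
  then show ?case by (metis Ck_on.simps(2))
qed

lemma Ck_on_imp_continuous: "Ck_on k S f \<Longrightarrow> continuous_on S f"
  by (induction k) (auto dest: Ck_on_Suc_mono simp del: Ck_on.simps(2))

text \<open>\<open>Ck_on\<close> uses derivatives \<open>at x\<close>, not within \<open>S\<close>;
  apart from the continuity of the last derivative, itself local, it is a condition on each point
  separately.\<close>

lemma Ck_on_local:
  assumes "\<And>x. x \<in> S \<Longrightarrow> \<exists>U. open U \<and> x \<in> U \<and> Ck_on k U f"
  shows "Ck_on k S f"
  using assms
proof (induction k arbitrary: f)
  case 0
  then show ?case
    by (auto intro!: continuous_at_imp_continuous_on) (metis at_within_open continuous_on_eq_continuous_within)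
next
  case (Suc k)
  then show ?case by (metis Ck_on.simps(2))
qed

lemma Ck_on_const [simp]: "Ck_on k S (\<lambda>x. c)"
  by (induction k arbitrary: c) auto

lemma Ck_on_bounded_linear:
  assumes "bounded_linear L" "open S" "Ck_on k S f"
  shows "Ck_on k S (\<lambda>x. L (f x))"
  using assms(3)
proof (induction k arbitrary: f)
  case 0
  then show ?case
    using assms(1) by (auto intro: bounded_linear.continuous_on)
next
  case (Suc k)
  have d: "((\<lambda>x. L (f x)) has_derivative (\<lambda>v. L (frechet_derivative f (at x) v))) (at x)"
    if "x \<in> S" for x
    by (rule bounded_linear.has_derivative[OF assms(1)]) (rule Ck_on_has_derivative[OF Suc.prems that])
  have "Ck_on k S (\<lambda>x. L (frechet_derivative f (at x) v))" for v
    using Suc.IH Suc.prems by simp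
  then have "Ck_on k S (\<lambda>x. frechet_derivative (\<lambda>x. L (f x)) (at x) v)" for v
    by (rule Ck_on_eq[OF _ assms(2)]) (simp add: frechet_derivative_at[OF d, symmetric])
  then show ?case using differentiableI[OF d] by simp
qed

lemma Ck_on_id [simp]: "Ck_on k S (\<lambda>x. x)"
  by (cases k) auto

lemma Ck_on_add:
  assumes "open S" "Ck_on k S f" "Ck_on k S h"
  shows "Ck_on k S (\<lambda>x. f x + h x)"
  using assms(2,3)
proof (induction k arbitrary: f h)
  case 0
  then show ?case by (auto intro: continuous_on_add)
next
  case (Suc k)
  have d: "((\<lambda>x. f x + h x) has_derivative
      (\<lambda>v. frechet_derivative f (at x) v + frechet_derivative h (at x) v)) (at x)"
    if "x \<in> S" for x
    by (intro has_derivative_add Ck_on_has_derivative[OF Suc.prems(1) that] Ck_on_has_derivative[OF Suc.prems(2) that])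
  have "Ck_on k S (\<lambda>x. frechet_derivative f (at x) v + frechet_derivative h (at x) v)" for v
    using Suc.IH Suc.prems by simp
  then have "Ck_on k S (\<lambda>x. frechet_derivative (\<lambda>x. f x + h x) (at x) v)" for v
    by (rule Ck_on_eq[OF _ assms(1)]) (simp add: frechet_derivative_at[OF d, symmetric])
  then show ?case using differentiableI[OF d] by simp
qed

lemma Ck_on_sum:
  assumes "open S" "\<And>i. i \<in> I \<Longrightarrow> Ck_on k S (f i)"
  shows "Ck_on k S (\<lambda>x. \<Sum>i\<in>I. f i x)"
  using assms(2) by (induction I rule: infinite_finite_induct) (auto intro: Ck_on_add[OF assms(1)])

lemma Ck_on_bilinear:
  assumes "bounded_bilinear B" "open S" "Ck_on k S f" "Ck_on k S h"
  shows "Ck_on k S (\<lambda>x. B (f x) (h x))"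
  using assms(3,4)
proof (induction k arbitrary: f h)
  case 0
  then show ?case using assms(1) by (auto intro: bounded_bilinear.continuous_on)
next
  case (Suc k)
  have d: "((\<lambda>x. B (f x) (h x)) has_derivative
      (\<lambda>v. B (f x) (frechet_derivative h (at x) v) + B (frechet_derivative f (at x) v) (h x))) (at x)"
    if "x \<in> S" for x
    by (rule bounded_bilinear.FDERIV[OF assms(1)])
      (rule Ck_on_has_derivative[OF Suc.prems(1) that] Ck_on_has_derivative[OF Suc.prems(2) that])+
  have "Ck_on k S f" "Ck_on k S h"
    using Suc.prems Ck_on_Suc_mono by blast+
  then have "Ck_on k S (\<lambda>x. B (f x) (frechet_derivative h (at x) v) + B (frechet_derivative f (at x) v) (h x))" for v
    using Suc.IH Suc.prems by (intro Ck_on_add[OF assms(2)]) simp_all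
  then have "Ck_on k S (\<lambda>x. frechet_derivative (\<lambda>x. B (f x) (h x)) (at x) v)" for v
    by (rule Ck_on_eq[OF _ assms(2)]) (simp add: frechet_derivative_at[OF d, symmetric])
  then show ?case using differentiableI[OF d] by simp
qed

lemma Ck_on_minus:
  assumes "open S" "Ck_on k S f" "Ck_on k S h"
  shows "Ck_on k S (\<lambda>x. f x - h x)"
  using Ck_on_add[OF assms(1,2) Ck_on_bounded_linear[OF bounded_linear_minus[OF bounded_linear_ident] assms(1,3)]]
  by simp

section \<open>Joint continuity of derivatives and composition of C^1 maps\<close>

lemma linear_basis_expand:
  fixes f :: "'a::euclidean_space \<Rightarrow> 'b::real_vector"
  assumes "linear f"
  shows "f v = (\<Sum>b\<in>Basis. (v \<bullet> b) *\<^sub>R f b)"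
proof -
  have "f v = f (\<Sum>b\<in>Basis. (v \<bullet> b) *\<^sub>R b)" by (simp add: euclidean_representation)
  also have "\<dots> = (\<Sum>b\<in>Basis. (v \<bullet> b) *\<^sub>R f b)"
    using assms by (simp add: linear_sum linear_scale)
  finally show ?thesis .
qed

text \<open>\<open>Ck_on 1\<close> gives continuity of the derivative in the base point for each
  fixed direction. Expanding the direction in the standard basis leaves finitely many such
  functions, hence continuity in point and direction together.\<close>

lemma continuous_on_frechet_derivative:
  fixes f :: "'b::euclidean_space \<Rightarrow> 'c::real_normed_vector"
  assumes "Ck_on 1 S f" "continuous_on Z p" "continuous_on Z v" "\<And>z. z \<in> Z \<Longrightarrow> p z \<in> S"
  shows "continuous_on Z (\<lambda>z. frechet_derivative f (at (p z)) (v z))"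
proof -
  have c: "continuous_on S (\<lambda>x. frechet_derivative f (at x) b)" for b
    using assms(1) by (simp add: One_nat_def)
  have "frechet_derivative f (at (p z)) (v z) = (\<Sum>b\<in>Basis. (v z \<bullet> b) *\<^sub>R frechet_derivative f (at (p z)) b)"
    if "z \<in> Z" for z
    using assms(1,4) that by (intro linear_basis_expand linear_frechet_derivative) (auto simp: One_nat_def)
  moreover have "continuous_on Z (\<lambda>z. \<Sum>b\<in>Basis. (v z \<bullet> b) *\<^sub>R frechet_derivative f (at (p z)) b)"
    by (intro continuous_intros assms continuous_on_compose2[OF c assms(2)]) (use assms(4) in auto)
  ultimately show ?thesis by (simp cong: continuous_on_cong)
qed

lemma C1_on_compose:
  fixes f :: "'b::euclidean_space \<Rightarrow> 'c::real_normed_vector" and h :: "'d::euclidean_space \<Rightarrow> 'b"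
  assumes "open S'" "Ck_on 1 S f" "Ck_on 1 S' h" "h ` S' \<subseteq> S"
  shows "Ck_on 1 S' (\<lambda>x. f (h x))"
proof -
  have d: "((\<lambda>x. f (h x)) has_derivative
     (\<lambda>v. frechet_derivative f (at (h x)) (frechet_derivative h (at x) v))) (at x)" if "x \<in> S'" for x
    by (rule has_derivative_compose[where f=h])
      (use assms(2,3,4) that in \<open>auto intro!: Ck_on_has_derivative[where k=0] simp: One_nat_def simp del: Ck_on.simps\<close>)
  have "continuous_on S' (\<lambda>x. frechet_derivative f (at (h x)) (frechet_derivative h (at x) v))" for v
    by (rule continuous_on_frechet_derivative[OF assms(2)])
      (use assms(3,4) Ck_on_imp_continuous[OF assms(3)] in \<open>auto simp: One_nat_def\<close>)
  then have "continuous_on S' (\<lambda>x. frechet_derivative (\<lambda>x. f (h x)) (at x) v)" for v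
    using frechet_derivative_at[OF d, symmetric] by (simp cong: continuous_on_cong)
  then show ?thesis using differentiableI[OF d] unfolding One_nat_def by simp
qed

lemma Ck_on_Pair:
  assumes "open S" "Ck_on k S f" "Ck_on k S h"
  shows "Ck_on k S (\<lambda>x. (f x, h x))"
proof -
  have "bounded_linear (\<lambda>v::'b. (v, 0::'c))" "bounded_linear (\<lambda>v::'c. (0::'b, v))"
    by (intro bounded_linear_Pair bounded_linear_ident bounded_linear_zero)+
  note this[THEN Ck_on_bounded_linear, OF assms(1)]
  then have "Ck_on k S (\<lambda>x. (f x, 0) + (0, h x))"
    using assms by (intro Ck_on_add) auto
  then show ?thesis by simp
qed

section \<open>Solutions of linear equations\<close>

lemma linear_perturb_bound:
  fixes B :: "'a::t2_space \<Rightarrow> 'b::euclidean_space \<Rightarrow> 'c::euclidean_space"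
  assumes "linear (B x)" "linear (B y)"
  shows "norm (B x u - B y u) \<le> norm u * (\<Sum>b\<in>Basis. norm (B x b - B y b))"
proof -
  have "B x u - B y u = (\<Sum>b\<in>Basis. (u \<bullet> b) *\<^sub>R (B x b - B y b))"
    using linear_basis_expand[OF assms(1), of u] linear_basis_expand[OF assms(2), of u]
    by (simp add: sum_subtractf scaleR_diff_right)
  also have "norm \<dots> \<le> (\<Sum>b\<in>Basis. norm u * norm (B x b - B y b))"
    by (intro order_trans[OF norm_sum] sum_mono) (auto intro!: mult_right_mono Basis_le_norm)
  finally show ?thesis by (simp add: sum_distrib_left)
qed

text \<open>A lower bound \<open>m * norm u\<close> for \<open>B x0\<close> survives, halved, for
  \<open>x\<close> near \<open>x0\<close>. Applied to \<open>N x - N x0\<close> it leaves the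
  residual \<open>\<theta> x - B x (N x0)\<close>, which tends to 0.\<close>

lemma linear_solve_continuous:
  fixes B :: "'a::t2_space \<Rightarrow> 'b::euclidean_space \<Rightarrow> 'c::euclidean_space"
  assumes S: "open S" and lin: "\<And>x. x \<in> S \<Longrightarrow> linear (B x)" and inj: "\<And>x. x \<in> S \<Longrightarrow> inj (B x)"
    and cB: "\<And>u. continuous_on S (\<lambda>x. B x u)" and c\<theta>: "continuous_on S \<theta>"
    and sol: "\<And>x. x \<in> S \<Longrightarrow> B x (N x) = \<theta> x"
  shows "continuous_on S N"
proof (intro continuous_at_imp_continuous_on ballI)
  fix x0 assume x0: "x0 \<in> S"
  obtain m where m: "m > 0" "\<And>u. m * norm u \<le> norm (B x0 u)"
    using linear_inj_bounded_below_pos[OF lin[OF x0] inj[OF x0]] by blast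
  have lim: "((\<lambda>x. B x u) \<longlongrightarrow> B x0 u) (at x0)" for u
    using cB x0 S by (metis at_within_open continuous_on_def)
  have "((\<lambda>x. \<Sum>b\<in>Basis. norm (B x b - B x0 b)) \<longlongrightarrow> (\<Sum>b\<in>Basis. norm (B x0 b - B x0 b))) (at x0)"
    by (intro tendsto_intros lim)
  then have "\<forall>\<^sub>F x in at x0. (\<Sum>b\<in>Basis. norm (B x b - B x0 b)) < m / 2"
    using m(1) by (intro order_tendstoD(2)[where y = "\<Sum>b\<in>Basis. norm (B x0 b - B x0 b)"]) auto
  moreover have "\<forall>\<^sub>F x in at x0. x \<in> S"
    using S x0 eventually_at_topological by blast
  ultimately have ev: "\<forall>\<^sub>F x in at x0. norm (N x - N x0) \<le> (2/m) * norm (\<theta> x - B x (N x0))"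
  proof eventually_elim
    case (elim x)
    let ?d = "N x - N x0"
    have "norm (B x ?d - B x0 ?d) \<le> norm ?d * (m/2)"
      using linear_perturb_bound[of B x x0 ?d] lin elim x0
      by (meson less_imp_le mult_left_mono norm_ge_zero order_trans)
    moreover have "norm (B x0 ?d) \<le> norm (B x ?d) + norm (B x ?d - B x0 ?d)"
      by (metis norm_minus_commute norm_triangle_sub)
    ultimately have "m * norm ?d \<le> norm (B x ?d) + norm ?d * (m/2)"
      using m(2)[of ?d] by linarith
    then have "norm ?d \<le> (2/m) * norm (B x ?d)" using m(1) by (simp add: field_simps)
    moreover have "B x ?d = \<theta> x - B x (N x0)"
      using lin[of x] elim sol[of x] by (simp add: linear_diff)
    ultimately show ?case by simp
  qed
  have "((\<lambda>x. (2/m) * norm (\<theta> x - B x (N x0))) \<longlongrightarrow> (2/m) * norm (\<theta> x0 - B x0 (N x0))) (at x0)"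
    using c\<theta> x0 S by (intro tendsto_intros lim) (metis at_within_open continuous_on_def)
  then have "((\<lambda>x. (2/m) * norm (\<theta> x - B x (N x0))) \<longlongrightarrow> 0) (at x0)"
    using sol[OF x0] by simp
  then have "((\<lambda>x. N x - N x0) \<longlongrightarrow> 0) (at x0)"
    by (rule Lim_null_comparison[OF ev])
  then show "isCont N x0"
    using LIM_zero_iff isCont_def by blast
qed

text \<open>At a zero of one factor the product is differentiable even if the other factor is merely
  continuous. This serves below, where the coefficients of a solution are not yet known to be
  differentiable.\<close>

lemma has_derivative_scaleR_vanishing:
  fixes f :: "'a::real_normed_vector \<Rightarrow> real" and h :: "'a \<Rightarrow> 'b::real_normed_vector"
  assumes f: "isCont f x" and h: "(h has_derivative h') (at x)" and h0: "h x = 0"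
  shows "((\<lambda>y. f y *\<^sub>R h y) has_derivative (\<lambda>v. f x *\<^sub>R h' v)) (at x)"
proof -
  have bl: "bounded_linear h'" using h has_derivative_bounded_linear by blast
  obtain K where K: "K > 0" "\<And>v. norm (h' v) \<le> norm v * K"
    using bounded_linear.pos_bounded[OF bl] by blast
  have "((\<lambda>y. (f y - f x) *\<^sub>R h y) has_derivative (\<lambda>v. 0)) (at x)"
    unfolding has_derivative_at_alt
  proof (intro conjI allI impI)
    fix e :: real assume e: "e > 0"
    define e' where "e' = e / (K + 1)"
    have e': "e' > 0" using e K by (simp add: e'_def)
    obtain d1 where d1: "d1 > 0" "\<And>y. norm (y - x) < d1 \<Longrightarrow> norm (h y - h x - h' (y - x)) \<le> 1 * norm (y - x)"
      using h unfolding has_derivative_at_alt by (metis zero_less_one)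
    obtain d2 where d2: "d2 > 0" "\<And>y. norm (y - x) < d2 \<Longrightarrow> \<bar>f y - f x\<bar> < e'"
      using f e' unfolding isCont_def LIM_def dist_norm
      by (metis abs_zero diff_self real_norm_def)
    show "\<exists>d>0. \<forall>y. norm (y - x) < d \<longrightarrow>
      norm ((f y - f x) *\<^sub>R h y - (f x - f x) *\<^sub>R h x - 0) \<le> e * norm (y - x)"
    proof (intro exI conjI allI impI)
      show "min d1 d2 > 0" using d1 d2 by simp
      fix y assume y: "norm (y - x) < min d1 d2"
      have "norm (h y) \<le> norm (h y - h x - h' (y - x)) + norm (h' (y - x))"
        using h0 norm_triangle_sub[of "h y" "h' (y-x)"] by (simp add: add.commute)
      also have "\<dots> \<le> 1 * norm (y - x) + norm (y - x) * K"
        using d1(2) K(2) y by (intro add_mono) auto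
      finally have "norm (h y) \<le> (K + 1) * norm (y - x)" by (simp add: algebra_simps)
      then have "\<bar>f y - f x\<bar> * norm (h y) \<le> e' * ((K + 1) * norm (y - x))"
        using d2(2)[of y] y by (intro mult_mono) auto
      also have "\<dots> = e * norm (y - x)" using K by (simp add: e'_def)
      finally show "norm ((f y - f x) *\<^sub>R h y - (f x - f x) *\<^sub>R h x - 0) \<le> e * norm (y - x)" by simp
    qed
  qed simp
  then have "((\<lambda>y. f x *\<^sub>R h y + (f y - f x) *\<^sub>R h y) has_derivative (\<lambda>v. f x *\<^sub>R h' v + 0)) (at x)"
    by (intro has_derivative_add has_derivative_scaleR_right h)
  then show ?thesis by (simp add: algebra_simps)
qed

text \<open>With a left inverse \<open>I\<close> of \<open>B x0\<close> the equation is rearranged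
  so that the unknown coefficients \<open>N x \<bullet> b\<close> on the right only multiply the
  differences \<open>B x b - B x0 b\<close>. These vanish at \<open>x0\<close>, so the continuity of
  \<open>N\<close> already gives its derivative.\<close>

lemma linear_solve_has_derivative:
  fixes B :: "'a::euclidean_space \<Rightarrow> 'b::euclidean_space \<Rightarrow> 'c::euclidean_space"
  assumes S: "open S" and lin: "\<And>x. x \<in> S \<Longrightarrow> linear (B x)" and inj: "\<And>x. x \<in> S \<Longrightarrow> inj (B x)"
    and cB: "\<And>u. Ck_on 1 S (\<lambda>x. B x u)" and c\<theta>: "Ck_on 1 S \<theta>"
    and sol: "\<And>x. x \<in> S \<Longrightarrow> B x (N x) = \<theta> x" and x0: "x0 \<in> S"
  shows "N differentiable (at x0)"
    and "B x0 (frechet_derivative N (at x0) v) = frechet_derivative \<theta> (at x0) v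
      - (\<Sum>b\<in>Basis. (N x0 \<bullet> b) *\<^sub>R frechet_derivative (\<lambda>x. B x b) (at x0) v)"
proof -
  have contN: "continuous_on S N"
    by (rule linear_solve_continuous[OF S lin inj _ _ sol]) (use cB c\<theta> Ck_on_imp_continuous in blast)+
  obtain I where I: "linear I" "I \<circ> B x0 = id"
    using linear_injective_left_inverse[OF lin[OF x0] inj[OF x0]] by blast
  have dB: "((\<lambda>x. B x u) has_derivative frechet_derivative (\<lambda>x. B x u) (at x0)) (at x0)" for u
    using Ck_on_has_derivative[OF cB[of u, unfolded One_nat_def] x0] .
  have d\<theta>: "(\<theta> has_derivative frechet_derivative \<theta> (at x0)) (at x0)"
    using Ck_on_has_derivative[OF c\<theta>[unfolded One_nat_def] x0] .
  have contNb: "isCont (\<lambda>x. N x \<bullet> b) x0" for b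
    using contN S x0 by (intro continuous_intros) (simp add: continuous_on_eq_continuous_at)
  define D where "D = (\<lambda>v. I (frechet_derivative \<theta> (at x0) v
      - (\<Sum>b\<in>Basis. (N x0 \<bullet> b) *\<^sub>R frechet_derivative (\<lambda>x. B x b) (at x0) v)))"
  have e1: "((\<lambda>x. (N x \<bullet> b) *\<^sub>R (B x b - B x0 b)) has_derivative
      (\<lambda>v. (N x0 \<bullet> b) *\<^sub>R frechet_derivative (\<lambda>x. B x b) (at x0) v)) (at x0)" for b
    using has_derivative_diff[OF dB[of b] has_derivative_const[of "B x0 b"]]
    by (intro has_derivative_scaleR_vanishing contNb) auto
  have "((\<lambda>x. N x0 + I (\<theta> x - \<theta> x0 - (\<Sum>b\<in>Basis. (N x \<bullet> b) *\<^sub>R (B x b - B x0 b))))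
      has_derivative (\<lambda>v. 0 + I (frechet_derivative \<theta> (at x0) v - 0
      - (\<Sum>b\<in>Basis. (N x0 \<bullet> b) *\<^sub>R frechet_derivative (\<lambda>x. B x b) (at x0) v)))) (at x0)"
    by (intro has_derivative_add has_derivative_const
        bounded_linear.has_derivative[OF I(1)[unfolded linear_conv_bounded_linear]]
        has_derivative_diff d\<theta> has_derivative_sum e1)
  then have "((\<lambda>x. N x0 + I (\<theta> x - \<theta> x0 - (\<Sum>b\<in>Basis. (N x \<bullet> b) *\<^sub>R (B x b - B x0 b))))
      has_derivative D) (at x0)" by (simp add: D_def)
  then have D: "(N has_derivative D) (at x0)"
  proof (rule has_derivative_transform_within_open[OF _ S x0])
    fix x assume x: "x \<in> S"
    have "(\<Sum>b\<in>Basis. (N x \<bullet> b) *\<^sub>R (B x b - B x0 b)) = \<theta> x - B x0 (N x)"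
      using linear_basis_expand[OF lin[OF x], of "N x"] linear_basis_expand[OF lin[OF x0], of "N x"] sol[OF x]
      by (simp add: scaleR_diff_right sum_subtractf)
    then have "\<theta> x - \<theta> x0 - (\<Sum>b\<in>Basis. (N x \<bullet> b) *\<^sub>R (B x b - B x0 b)) = B x0 (N x - N x0)"
      using sol[OF x0] lin[OF x0] by (simp add: linear_diff)
    moreover have "I (B x0 (N x - N x0)) = N x - N x0"
      using I(2) by (metis comp_apply id_apply)
    ultimately show "N x0 + I (\<theta> x - \<theta> x0 - (\<Sum>b\<in>Basis. (N x \<bullet> b) *\<^sub>R (B x b - B x0 b))) = N x" by simp
  qed
  then show diff: "N differentiable (at x0)" using differentiableI by blast
  have dN: "(N has_derivative frechet_derivative N (at x0)) (at x0)"
    using diff frechet_derivative_works by blast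
  have "((\<lambda>x. B x0 (N x) + (\<Sum>b\<in>Basis. (N x \<bullet> b) *\<^sub>R (B x b - B x0 b))) has_derivative
    (\<lambda>v. B x0 (frechet_derivative N (at x0) v)
       + (\<Sum>b\<in>Basis. (N x0 \<bullet> b) *\<^sub>R frechet_derivative (\<lambda>x. B x b) (at x0) v))) (at x0)"
    by (intro has_derivative_add has_derivative_sum e1 dN
        bounded_linear.has_derivative[OF lin[OF x0, unfolded linear_conv_bounded_linear]])
  then have "(\<theta> has_derivative
    (\<lambda>v. B x0 (frechet_derivative N (at x0) v)
       + (\<Sum>b\<in>Basis. (N x0 \<bullet> b) *\<^sub>R frechet_derivative (\<lambda>x. B x b) (at x0) v))) (at x0)"
  proof (rule has_derivative_transform_within_open[OF _ S x0])
    fix x assume x: "x \<in> S"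
    have "(\<Sum>b\<in>Basis. (N x \<bullet> b) *\<^sub>R (B x b - B x0 b)) = \<theta> x - B x0 (N x)"
      using linear_basis_expand[OF lin[OF x], of "N x"] linear_basis_expand[OF lin[OF x0], of "N x"] sol[OF x]
      by (simp add: scaleR_diff_right sum_subtractf)
    then show "B x0 (N x) + (\<Sum>b\<in>Basis. (N x \<bullet> b) *\<^sub>R (B x b - B x0 b)) = \<theta> x" by simp
  qed
  from frechet_derivative_at[OF this]
  have "frechet_derivative \<theta> (at x0) v = B x0 (frechet_derivative N (at x0) v)
       + (\<Sum>b\<in>Basis. (N x0 \<bullet> b) *\<^sub>R frechet_derivative (\<lambda>x. B x b) (at x0) v)"
    by (rule fun_cong[OF sym])
  then show "B x0 (frechet_derivative N (at x0) v) = frechet_derivative \<theta> (at x0) v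
      - (\<Sum>b\<in>Basis. (N x0 \<bullet> b) *\<^sub>R frechet_derivative (\<lambda>x. B x b) (at x0) v)"
    by simp
qed

text \<open>A derivative of \<open>N\<close> solves a system with the same \<open>B\<close> and a
  new right-hand side, so the induction runs over all \<open>\<theta>\<close> and \<open>N\<close>
  at once. The gradient of \<open>t\<close>, given by a description, and the quotient
  \<open>X\<close> obtain their regularity in this way.\<close>

lemma linear_solve_Ck:
  fixes B :: "'a::euclidean_space \<Rightarrow> 'b::euclidean_space \<Rightarrow> 'c::euclidean_space"
  assumes S: "open S" and lin: "\<And>x. x \<in> S \<Longrightarrow> linear (B x)" and inj: "\<And>x. x \<in> S \<Longrightarrow> inj (B x)"
    and cB: "\<And>u. Ck_on k S (\<lambda>x. B x u)" and c\<theta>: "Ck_on k S \<theta>"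
    and sol: "\<And>x. x \<in> S \<Longrightarrow> B x (N x) = \<theta> x"
  shows "Ck_on k S N"
  using cB c\<theta> sol
proof (induction k arbitrary: \<theta> N)
  case 0
  then show ?case using linear_solve_continuous[OF S lin inj] by auto
next
  case (Suc k)
  have one: "Ck_on 1 S (\<lambda>x. B x u)" "Ck_on 1 S \<theta>" for u
    using Suc.prems(1,2) by (auto simp: One_nat_def intro: Ck_on_imp_continuous)
  note d = linear_solve_has_derivative[OF S lin inj one Suc.prems(3)]
  have N: "Ck_on k S N"
    by (rule Suc.IH[OF _ _ Suc.prems(3)]) (use Suc.prems(1,2) Ck_on_Suc_mono in blast)+
  have "Ck_on k S (\<lambda>x. frechet_derivative N (at x) v)" for v
  proof (rule Suc.IH)
    show "Ck_on k S (\<lambda>x. B x u)" for u using Suc.prems(1) Ck_on_Suc_mono by blast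
    show "B x (frechet_derivative N (at x) v) = frechet_derivative \<theta> (at x) v
      - (\<Sum>b\<in>Basis. (N x \<bullet> b) *\<^sub>R frechet_derivative (\<lambda>x. B x b) (at x) v)" if "x \<in> S" for x
      using d(2) that by simp
    show "Ck_on k S (\<lambda>x. frechet_derivative \<theta> (at x) v
      - (\<Sum>b\<in>Basis. (N x \<bullet> b) *\<^sub>R frechet_derivative (\<lambda>x. B x b) (at x) v))"
      using Suc.prems(1,2)
      by (intro Ck_on_minus[OF S] Ck_on_sum[OF S] Ck_on_bilinear[OF bounded_bilinear_scaleR S]
          Ck_on_bounded_linear[OF bounded_linear_inner_left S N]) auto
  qed
  then show ?case using d(1) by auto
qed

section \<open>Local flows of vector fields\<close>

lemma norm_fst_diff_le: "norm (fst x - fst y) \<le> norm (x - y)"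
  by (metis fst_diff norm_fst_le prod.collapse)

lemma vector_derivative_bound:
  fixes h :: "real \<Rightarrow> 'v::real_normed_vector"
  assumes h: "\<And>s. s \<in> {a..b} \<Longrightarrow> (h has_vector_derivative h' s) (at s within {a..b})"
    and B: "\<And>s. s \<in> {a..b} \<Longrightarrow> norm (h' s) \<le> B" and "x \<in> {a..b}" "y \<in> {a..b}"
  shows "norm (h x - h y) \<le> B * \<bar>x - y\<bar>"
proof -
  have "onorm (\<lambda>r. r *\<^sub>R h' s) \<le> B" if "s \<in> {a..b}" for s
    by (rule onorm_le) (use B[OF that] in \<open>auto simp: mult.commute[of B] intro: mult_left_mono\<close>)
  from differentiable_bound[OF convex_real_interval(5) h[unfolded has_vector_derivative_def] this assms(3,4)]
  show ?thesis by simp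
qed

text \<open>A short-time Gronwall estimate. Where \<open>norm h\<close> is maximal, the differential
  inequality bounds it by half of itself plus the data, because \<open>(b - a) * L\<close> is at
  most 1/2; absorbing that half gives the factor 2.\<close>

lemma vector_derivative_small_interval_bound:
  fixes h :: "real \<Rightarrow> 'v::real_normed_vector"
  assumes h: "\<And>s. s \<in> {a..b} \<Longrightarrow> (h has_vector_derivative h' s) (at s within {a..b})"
    and B: "\<And>s. s \<in> {a..b} \<Longrightarrow> norm (h' s) \<le> L * norm (h s) + C"
    and L: "L \<ge> 0" "(b - a) * L \<le> 1/2" and C: "C \<ge> 0" and s0: "s0 \<in> {a..b}" and s: "s \<in> {a..b}"
  shows "norm (h s) \<le> 2 * (norm (h s0) + (b - a) * C)"
proof -
  have "continuous_on {a..b} h"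
    using h has_vector_derivative_continuous continuous_on_eq_continuous_within by blast
  then have "continuous_on {a..b} (\<lambda>s. norm (h s))" by (rule continuous_on_norm)
  then obtain m where m: "m \<in> {a..b}" "\<And>s. s \<in> {a..b} \<Longrightarrow> norm (h s) \<le> norm (h m)"
    using continuous_attains_sup[of "{a..b}" "\<lambda>s. norm (h s)"] s by (metis compact_Icc empty_iff)
  have "norm (h m - h s0) \<le> (L * norm (h m) + C) * \<bar>m - s0\<bar>"
  proof (rule vector_derivative_bound[OF h _ m(1) s0])
    fix s assume s: "s \<in> {a..b}"
    then show "norm (h' s) \<le> L * norm (h m) + C"
      using B[OF s] mult_left_mono[OF m(2)[OF s] L(1)] by linarith
  qed
  also have "\<dots> \<le> (L * norm (h m) + C) * (b - a)"
    using m(1) s0 L C by (intro mult_left_mono) auto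
  also have "\<dots> = ((b - a) * L) * norm (h m) + (b - a) * C" by (simp add: algebra_simps)
  also have "\<dots> \<le> 1/2 * norm (h m) + (b - a) * C"
    using L C by (intro add_mono mult_right_mono) auto
  finally have "norm (h m) \<le> norm (h s0) + 1/2 * norm (h m) + (b - a) * C"
    using norm_triangle_sub[of "h m" "h s0"] by linarith
  then show ?thesis using m(2)[OF s] by (simp add: algebra_simps)
qed

text \<open>The Picard operator contracts by 1/2 on bounded continuous curves in the ball of radius
  \<open>2*R\<close>: they start within radius \<open>R\<close> and travel at most
  \<open>\<epsilon> * M \<le> R\<close> further.\<close>

lemma picard_local:
  fixes F :: "'v::banach \<Rightarrow> 'v"
  assumes lip: "\<And>x y. x \<in> cball v0 (2*R) \<Longrightarrow> y \<in> cball v0 (2*R) \<Longrightarrow> norm (F x - F y) \<le> L * norm (x - y)"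
    and bound: "\<And>x. x \<in> cball v0 (2*R) \<Longrightarrow> norm (F x) \<le> M"
    and R: "R > 0" and \<epsilon>: "\<epsilon> > 0" and \<epsilon>M: "\<epsilon> * M \<le> R" and L: "L \<ge> 0" and \<epsilon>L: "\<epsilon> * L \<le> 1/2" and v: "v \<in> cball v0 R"
  obtains u where "u 0 = v" "\<And>\<tau>. \<tau> \<in> {-\<epsilon>..\<epsilon>} \<Longrightarrow> u \<tau> \<in> cball v0 (2*R)"
    "\<And>\<tau>. \<tau> \<in> {-\<epsilon>..\<epsilon>} \<Longrightarrow> (u has_vector_derivative F (u \<tau>)) (at \<tau> within {-\<epsilon>..\<epsilon>})"
proof -
  \<comment> \<open>Time is clamped to the interval, so that all curves live on the whole line and
    form a complete set of bounded continuous functions.\<close>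
  define c where "c = (\<lambda>\<tau>::real. max (-\<epsilon>) (min \<epsilon> \<tau>))"
  have cin: "c \<tau> \<in> {-\<epsilon>..\<epsilon>}" for \<tau> using \<epsilon> by (auto simp: c_def)
  have cid: "c \<tau> = \<tau>" if "\<tau> \<in> {-\<epsilon>..\<epsilon>}" for \<tau> using that by (auto simp: c_def)
  have z: "0 \<in> {-\<epsilon>..\<epsilon>}" using \<epsilon> by simp
  have Fc: "continuous_on (cball v0 (2*R)) F"
    by (rule lipschitz_on_continuous_on[of L]) (use lip L in \<open>auto simp: lipschitz_on_def dist_norm\<close>)
  define S :: "(real \<Rightarrow>\<^sub>C 'v) set" where "S = PiC UNIV (\<lambda>_. cball v0 (2*R))"
  have Sin: "apply_bcontfun w s \<in> cball v0 (2*R)" if "w \<in> S" for w s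
    using that unfolding S_def mem_PiC_iff by auto
  \<comment> \<open>The primitive starts at the left end of the interval; subtracting its value at 0
    in \<open>P\<close> treats positive and negative times by one formula.\<close>
  define J where "J = (\<lambda>w \<tau>. integral {-\<epsilon>..\<tau>} (\<lambda>s. F (apply_bcontfun w s)))"
  have J: "(J w has_vector_derivative F (apply_bcontfun w \<tau>)) (at \<tau> within {-\<epsilon>..\<epsilon>})"
    if "w \<in> S" "\<tau> \<in> {-\<epsilon>..\<epsilon>}" for w \<tau>
    unfolding J_def
    by (rule integral_has_vector_derivative[OF continuous_on_compose2[OF Fc]])
      (use that Sin in auto)
  define P where "P = (\<lambda>w \<tau>. v + (J w (c \<tau>) - J w 0))"
  have Pball: "P w \<tau> \<in> cball v0 (2*R)" if "w \<in> S" for w \<tau>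
  proof -
    have "norm (J w (c \<tau>) - J w 0) \<le> M * \<bar>c \<tau> - 0\<bar>"
      by (rule vector_derivative_bound[OF J[OF that] _ cin z]) (use bound Sin that in auto)
    also have "\<dots> \<le> M * \<epsilon>"
      using cin[of \<tau>] bound[of v0] R
      by (intro mult_left_mono) (auto intro: order_trans[OF norm_ge_zero])
    finally have "norm (J w (c \<tau>) - J w 0) \<le> R" using \<epsilon>M by (simp add: mult.commute)
    moreover have "norm (v - v0) \<le> R" using v by (simp add: dist_norm norm_minus_commute)
    ultimately have "norm (P w \<tau> - v0) \<le> 2*R"
      using norm_triangle_ineq[of "v - v0" "J w (c \<tau>) - J w 0"] by (simp add: P_def algebra_simps)
    then show ?thesis by (simp add: dist_norm norm_minus_commute)
  qed
  have Pcont: "continuous_on UNIV (P w)" if "w \<in> S" for w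
  proof -
    have "continuous_on {-\<epsilon>..\<epsilon>} (J w)"
      using J[OF that] has_vector_derivative_continuous continuous_on_eq_continuous_within by blast
    then show ?thesis
      unfolding P_def
      by (intro continuous_intros continuous_on_compose2[of _ "J w" UNIV c])
        (use cin in \<open>auto simp: c_def intro!: continuous_intros\<close>)
  qed
  have Pb: "P w \<in> bcontfun" if "w \<in> S" for w
  proof -
    have "range (P w) \<subseteq> cball v0 (2*R)" using Pball[OF that] by blast
    then have "bounded (range (P w))" by (rule bounded_subset[OF bounded_cball])
    then show ?thesis unfolding bcontfun_def using Pcont[OF that] by simp
  qed
  define T where "T = (\<lambda>w. Bcontfun (P w))"
  have T: "apply_bcontfun (T w) = P w" if "w \<in> S" for w
    unfolding T_def by (rule Bcontfun_inverse[OF Pb[OF that]])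
  have "\<exists>!w\<in>S. T w = w"
  proof (rule Banach_fix)
    show "complete S" unfolding S_def complete_eq_closed by (intro closed_PiC) auto
    have "const_bcontfun v0 \<in> S"
      unfolding S_def mem_PiC_iff using R by (simp add: const_bcontfun.rep_eq)
    then show "S \<noteq> {}" by blast
    show "0 \<le> (1/2::real)" "1/2 < (1::real)" by auto
    show "T ` S \<subseteq> S" using T Pball by (auto simp: S_def mem_PiC_iff)
    fix w1 w2 assume w: "w1 \<in> S" "w2 \<in> S"
    show "dist (T w1) (T w2) \<le> 1/2 * dist w1 w2"
    proof (rule dist_bound)
      fix \<tau>
      have "norm ((J w1 (c \<tau>) - J w2 (c \<tau>)) - (J w1 0 - J w2 0)) \<le> (L * dist w1 w2) * \<bar>c \<tau> - 0\<bar>"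
      proof (rule vector_derivative_bound[OF has_vector_derivative_diff[OF J[OF w(1)] J[OF w(2)]] _ cin z])
        fix s assume "s \<in> {-\<epsilon>..\<epsilon>}"
        have "norm (F (apply_bcontfun w1 s) - F (apply_bcontfun w2 s)) \<le> L * dist (apply_bcontfun w1 s) (apply_bcontfun w2 s)"
          using lip[OF Sin[OF w(1)] Sin[OF w(2)]] by (simp add: dist_norm)
        also have "\<dots> \<le> L * dist w1 w2" using L dist_bounded by (intro mult_left_mono) auto
        finally show "norm (F (apply_bcontfun w1 s) - F (apply_bcontfun w2 s)) \<le> L * dist w1 w2" .
      qed auto
      also have "\<dots> \<le> (L * dist w1 w2) * \<epsilon>"
        using cin[of \<tau>] L by (intro mult_left_mono) auto
      also have "\<dots> = (\<epsilon> * L) * dist w1 w2" by simp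
      also have "\<dots> \<le> 1/2 * dist w1 w2" using \<epsilon>L by (intro mult_right_mono) auto
      finally show "dist (apply_bcontfun (T w1) \<tau>) (apply_bcontfun (T w2) \<tau>) \<le> 1/2 * dist w1 w2"
        by (simp add: T w P_def dist_norm algebra_simps)
    qed
  qed
  then obtain w where w: "w \<in> S" "T w = w" by blast
  then have weq: "apply_bcontfun w = P w" using T by metis
  show ?thesis
  proof
    show "apply_bcontfun w 0 = v" unfolding weq P_def using cid z by simp
    fix \<tau> assume \<tau>: "\<tau> \<in> {-\<epsilon>..\<epsilon>}"
    show "apply_bcontfun w \<tau> \<in> cball v0 (2*R)" using Sin w(1) by blast
    have "((\<lambda>\<tau>. v + (J w \<tau> - J w 0)) has_vector_derivative 0 + (F (apply_bcontfun w \<tau>) - 0)) (at \<tau> within {-\<epsilon>..\<epsilon>})"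
      by (intro has_vector_derivative_add has_vector_derivative_diff has_vector_derivative_const J w(1) \<tau>)
    then have "((\<lambda>\<tau>. v + (J w \<tau> - J w 0)) has_vector_derivative F (apply_bcontfun w \<tau>)) (at \<tau> within {-\<epsilon>..\<epsilon>})"
      by simp
    then show "(apply_bcontfun w has_vector_derivative F (apply_bcontfun w \<tau>)) (at \<tau> within {-\<epsilon>..\<epsilon>})"
    proof (rule has_vector_derivative_transform[OF \<tau>, rotated])
      fix s assume "s \<in> {-\<epsilon>..\<epsilon>}"
      then show "apply_bcontfun w s = v + (J w s - J w 0)"
        using fun_cong[OF weq, of s] cid by (simp add: P_def)
    qed
  qed
qed

lemma C1_lipschitz_cball:
  fixes f :: "'b::euclidean_space \<Rightarrow> 'c::real_normed_vector"
  assumes f: "Ck_on 1 U f" and sub: "cball p r \<subseteq> U"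
  obtains L where "L > 0" "\<And>y v. y \<in> cball p r \<Longrightarrow> norm (frechet_derivative f (at y) v) \<le> L * norm v"
    "\<And>y z. y \<in> cball p r \<Longrightarrow> z \<in> cball p r \<Longrightarrow> norm (f y - f z) \<le> L * norm (y - z)"
proof -
  have c: "continuous_on U (\<lambda>x. frechet_derivative f (at x) v)" for v
    using f by (simp add: One_nat_def)
  have diff: "f differentiable (at x)" if "x \<in> U" for x
    using f that by (simp add: One_nat_def)
  have "\<exists>K\<ge>0. \<forall>y\<in>cball p r. norm (frechet_derivative f (at y) b) \<le> K" for b
  proof -
    have "compact ((\<lambda>y. frechet_derivative f (at y) b) ` cball p r)"
      by (intro compact_continuous_image continuous_on_subset[OF c sub]) auto
    then obtain K where "\<forall>x\<in>(\<lambda>y. frechet_derivative f (at y) b) ` cball p r. norm x \<le> K"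
      using compact_imp_bounded bounded_iff by metis
    then show ?thesis by (intro exI[of _ "max K 0"]) auto
  qed
  then obtain K where K: "\<And>b. K b \<ge> 0" "\<And>b y. y \<in> cball p r \<Longrightarrow> norm (frechet_derivative f (at y) b) \<le> K b"
    by metis
  define L where "L = 1 + (\<Sum>b\<in>Basis. K b)"
  have L: "L > 0" unfolding L_def using K(1) by (simp add: add_pos_nonneg sum_nonneg)
  have bnd: "norm (frechet_derivative f (at y) v) \<le> L * norm v" if y: "y \<in> cball p r" for y v
  proof -
    have "frechet_derivative f (at y) v = (\<Sum>b\<in>Basis. (v \<bullet> b) *\<^sub>R frechet_derivative f (at y) b)"
      using y sub diff by (intro linear_basis_expand linear_frechet_derivative) auto
    also have "norm \<dots> \<le> (\<Sum>b\<in>Basis. norm v * K b)"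
      by (intro order_trans[OF norm_sum] sum_mono) (auto intro!: mult_mono Basis_le_norm K y)
    also have "\<dots> \<le> L * norm v" by (simp add: L_def sum_distrib_left algebra_simps)
    finally show ?thesis .
  qed
  have "norm (f y - f z) \<le> L * norm (y - z)" if "y \<in> cball p r" "z \<in> cball p r" for y z
  proof (rule differentiable_bound[OF convex_cball _ _ that])
    fix x assume x: "x \<in> cball p r"
    show "(f has_derivative frechet_derivative f (at x)) (at x within cball p r)"
      using diff x sub frechet_derivative_works has_derivative_at_withinI by blast
    show "onorm (frechet_derivative f (at x)) \<le> L"
      by (rule onorm_le) (rule bnd[OF x])
  qed
  then show ?thesis using that L bnd by blast
qed

text \<open>Order 2 makes the coefficient \<open>DX\<close> of the linearised equation Lipschitz, so
  a contraction argument also reaches the spatial derivative. The last conclusion is the linearised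
  equation at time 0; the derivative of the metric along the flow rests on it.\<close>

theorem local_flow:
  fixes X :: "'b::euclidean_space \<Rightarrow> 'b"
  assumes U: "open U" and X: "Ck_on 2 U X" and p: "p \<in> U"
  obtains \<epsilon> r \<Phi> where "\<epsilon> > 0" "r > 0"
    "\<And>y. y \<in> ball p r \<Longrightarrow> \<Phi> 0 y = y"
    "\<And>\<tau> y. \<tau> \<in> {-\<epsilon><..<\<epsilon>} \<Longrightarrow> y \<in> ball p r \<Longrightarrow> \<Phi> \<tau> y \<in> U"
    "\<And>\<tau> y. \<tau> \<in> {-\<epsilon><..<\<epsilon>} \<Longrightarrow> y \<in> ball p r \<Longrightarrow> ((\<lambda>\<tau>. \<Phi> \<tau> y) has_vector_derivative X (\<Phi> \<tau> y)) (at \<tau>)"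
    "Ck_on 1 ({-\<epsilon><..<\<epsilon>} \<times> ball p r) (\<lambda>(\<tau>, y). \<Phi> \<tau> y)"
    "\<And>w y. y \<in> ball p r \<Longrightarrow> ((\<lambda>\<tau>. frechet_derivative (\<Phi> \<tau>) (at y) w) has_vector_derivative
        frechet_derivative X (at y) w) (at 0)"
proof -
  have X1: "Ck_on 1 U X" using X by (metis Ck_on_Suc_mono Suc_1)
  have dX: "(X has_derivative frechet_derivative X (at y)) (at y)" if "y \<in> U" for y
    using X1 that by (simp add: One_nat_def frechet_derivative_works[symmetric])
  \<comment> \<open>As bounded operators the derivatives lie in a Banach space, which Picard
    iteration requires.\<close>
  define X' where "X' = (\<lambda>y. Blinfun (frechet_derivative X (at y)))"
  have X': "blinfun_apply (X' y) = frechet_derivative X (at y)" if "y \<in> U" for y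
    unfolding X'_def using dX[OF that] has_derivative_bounded_linear
    by (blast intro: bounded_linear_Blinfun_apply)
  obtain r0 where r0: "r0 > 0" "cball p r0 \<subseteq> U" using U p open_contains_cball by blast
  obtain L1 where L1: "L1 > 0" "\<And>y v. y \<in> cball p r0 \<Longrightarrow> norm (frechet_derivative X (at y) v) \<le> L1 * norm v"
    "\<And>y z. y \<in> cball p r0 \<Longrightarrow> z \<in> cball p r0 \<Longrightarrow> norm (X y - X z) \<le> L1 * norm (y - z)"
    using C1_lipschitz_cball[OF X1 r0(2)] by blast
  have nX': "norm (X' y) \<le> L1" if "y \<in> cball p r0" for y
    using L1(1,2) that X' r0 by (intro norm_blinfun_bound) auto
  have "\<exists>K>0. \<forall>y\<in>cball p r0. \<forall>z\<in>cball p r0. norm (frechet_derivative X (at y) b - frechet_derivative X (at z) b) \<le> K * norm (y - z)" for b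
  proof -
    have "Ck_on 1 U (\<lambda>x. frechet_derivative X (at x) b)" using X by (simp add: numeral_2_eq_2)
    from C1_lipschitz_cball[OF this r0(2)] show ?thesis by metis
  qed
  then obtain K where K: "\<And>b. K b > 0" "\<And>b y z. y \<in> cball p r0 \<Longrightarrow> z \<in> cball p r0 \<Longrightarrow>
      norm (frechet_derivative X (at y) b - frechet_derivative X (at z) b) \<le> K b * norm (y - z)"
    by metis
  define L2 where "L2 = (\<Sum>b\<in>Basis. K b)"
  have L2: "L2 \<ge> 0" unfolding L2_def using K(1) by (simp add: less_imp_le sum_nonneg)
  have lipX': "norm (X' y - X' z) \<le> L2 * norm (y - z)" if "y \<in> cball p r0" "z \<in> cball p r0" for y z
  proof -
    have "norm (X' y - X' z) \<le> (\<Sum>b\<in>Basis. norm (blinfun_apply (X' y - X' z) b))"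
      by (rule norm_blinfun_euclidean_le)
    also have "\<dots> \<le> (\<Sum>b\<in>Basis. K b * norm (y - z))"
      using that r0(2) by (intro sum_mono) (auto simp: blinfun.diff_left X' K subset_eq)
    finally show ?thesis by (simp add: L2_def sum_distrib_right)
  qed
  \<comment> \<open>\<open>2*R \<le> r0\<close> keeps the point component in the ball where the
    bounds hold; \<open>2*R \<le> 1\<close> keeps the operator component within distance 1 of the
    identity, hence of norm at most 2.\<close>
  define R where "R = min (r0/2) (1/2)"
  have R: "R > 0" "2*R \<le> r0" "2*R \<le> 1" using r0 by (auto simp: R_def)
  text \<open>The flow and its derivative in the initial point solve one system, with the field
    \<open>(x, E) \<mapsto> (X x, DX x \<circ> E)\<close>; only afterwards is \<open>E\<close> shown to be the derivative.\<close>
  define v0 where "v0 = (p, id_blinfun :: 'b \<Rightarrow>\<^sub>L 'b)"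
  define F where "F = (\<lambda>(x, E :: 'b \<Rightarrow>\<^sub>L 'b). (X x, X' x o\<^sub>L E))"
  have inB: "fst z \<in> cball p r0" "norm (snd z) \<le> 2" if "z \<in> cball v0 (2*R)" for z
  proof -
    have z: "norm (z - v0) \<le> 2*R" using that by (simp add: dist_norm norm_minus_commute)
    have zv: "z - v0 = (fst z - p, snd z - id_blinfun)" by (simp add: v0_def prod_eq_iff)
    have "norm (fst z - p) \<le> 2*R"
      using z norm_fst_le[of "fst z - p" "snd z - id_blinfun"] unfolding zv by linarith
    then show "fst z \<in> cball p r0" using R by (simp add: dist_norm norm_minus_commute)
    have "norm (snd z - id_blinfun) \<le> 1"
      using z R norm_snd_le[of "snd z - id_blinfun" "fst z - p"] unfolding zv by linarith
    then show "norm (snd z) \<le> 2"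
      using norm_triangle_sub[of "snd z" id_blinfun] norm_blinfun_id_le[where 'a='b] by linarith
  qed
  \<comment> \<open>One \<open>L1\<close> comes from \<open>X\<close>, another from the difference
    of the operator components; \<open>L2\<close> is doubled because an operator component has norm
    at most 2.\<close>
  define L where "L = 2 * L1 + 2 * L2"
  have L: "L \<ge> 0" "L1 \<le> L" using L1 L2 by (auto simp: L_def)
  have lip: "norm (F x - F y) \<le> L * norm (x - y)" if "x \<in> cball v0 (2*R)" "y \<in> cball v0 (2*R)" for x y
  proof -
    have "x - y = (fst x - fst y, snd x - snd y)" by (simp add: prod_eq_iff)
    then have n: "norm (fst x - fst y) \<le> norm (x - y)" "norm (snd x - snd y) \<le> norm (x - y)"
      by (metis norm_fst_le, metis norm_snd_le)
    have eq: "(X' (fst x) o\<^sub>L snd x) - (X' (fst y) o\<^sub>L snd y)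
      = (X' (fst x) o\<^sub>L (snd x - snd y)) + ((X' (fst x) - X' (fst y)) o\<^sub>L snd y)"
      by (rule blinfun_eqI) (simp add: blinfun.bilinear_simps)
    have "norm (F x - F y) \<le> norm (X (fst x) - X (fst y)) + norm ((X' (fst x) o\<^sub>L snd x) - (X' (fst y) o\<^sub>L snd y))"
      unfolding F_def by (simp add: case_prod_beta norm_Pair_le)
    also have "norm (X (fst x) - X (fst y)) \<le> L1 * norm (x - y)"
      using L1(3)[OF inB(1)[OF that(1)] inB(1)[OF that(2)]] n(1) L1(1)
      by (meson less_imp_le mult_left_mono order_trans)
    also have "norm ((X' (fst x) o\<^sub>L snd x) - (X' (fst y) o\<^sub>L snd y))
      \<le> norm (X' (fst x)) * norm (snd x - snd y) + norm (X' (fst x) - X' (fst y)) * norm (snd y)"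
      unfolding eq by (intro order_trans[OF norm_triangle_ineq] add_mono norm_blinfun_compose)
    also have "norm (X' (fst x)) * norm (snd x - snd y) \<le> L1 * norm (x - y)"
      using nX'[OF inB(1)[OF that(1)]] n(2) L1(1) by (intro mult_mono) auto
    also have "norm (X' (fst x) - X' (fst y)) * norm (snd y) \<le> (L2 * norm (x - y)) * 2"
    proof (intro mult_mono inB(2)[OF that(2)])
      show "norm (X' (fst x) - X' (fst y)) \<le> L2 * norm (x - y)"
        using lipX'[OF inB(1)[OF that(1)] inB(1)[OF that(2)]] n(1) L2 by (meson mult_left_mono order_trans)
    qed (use L2 in auto)
    finally show ?thesis by (simp add: L_def algebra_simps)
  qed
  define M where "M = norm (F v0) + L * (2*R)"
  have M: "norm (F x) \<le> M" if "x \<in> cball v0 (2*R)" for x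
  proof -
    have "norm (F x - F v0) \<le> L * norm (x - v0)" using lip[OF that, of v0] R by simp
    also have "\<dots> \<le> L * (2*R)" using that L by (intro mult_left_mono) (auto simp: dist_norm norm_minus_commute)
    finally show ?thesis using norm_triangle_sub[of "F x" "F v0"] by (simp add: M_def)
  qed
  have M0: "M \<ge> 0" using L R by (simp add: M_def)
  \<comment> \<open>The first term limits the displacement to \<open>R\<close>. The second gives
    \<open>\<epsilon> * L \<le> 1/4\<close>, half of what Picard iteration asks for, since the later
    estimates use the whole interval of length \<open>2 * \<epsilon>\<close>.\<close>
  define \<epsilon> where "\<epsilon> = min (R / (M + 1)) (1 / (4 * (L + 1)))"
  have \<epsilon>: "\<epsilon> > 0" using R M0 L by (simp add: \<epsilon>_def)
  have "\<epsilon> * M \<le> R / (M+1) * M" unfolding \<epsilon>_def using M0 by (intro mult_right_mono) auto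
  also have "\<dots> \<le> R" using M0 R by (simp add: field_simps)
  finally have \<epsilon>M: "\<epsilon> * M \<le> R" .
  have "\<epsilon> * L \<le> 1 / (4 * (L + 1)) * L" unfolding \<epsilon>_def using L by (intro mult_right_mono) auto
  also have "\<dots> \<le> 1/4" using L by (simp add: field_simps)
  finally have \<epsilon>L: "\<epsilon> * L \<le> 1/4" .
  have "\<exists>u. u 0 = (y, id_blinfun) \<and> (\<forall>\<tau>\<in>{-\<epsilon>..\<epsilon>}. u \<tau> \<in> cball v0 (2*R) \<and>
    (u has_vector_derivative F (u \<tau>)) (at \<tau> within {-\<epsilon>..\<epsilon>}))" if "y \<in> cball p R" for y
  proof -
    have "(y, id_blinfun) \<in> cball v0 R" using that by (simp add: v0_def dist_Pair_Pair)
    moreover have "\<epsilon> * L \<le> 1/2" using \<epsilon>L by simp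
    ultimately have pre: "(y, id_blinfun) \<in> cball v0 R" "\<epsilon> * L \<le> 1/2" by auto
    show ?thesis
    proof (rule picard_local[where F=F and L=L and M=M and R=R and ?v0.0=v0 and \<epsilon>=\<epsilon> and v="(y, id_blinfun)"])
      show "norm (F x - F y) \<le> L * norm (x - y)" if "x \<in> cball v0 (2*R)" "y \<in> cball v0 (2*R)" for x y
        by (rule lip[OF that])
      show "norm (F x) \<le> M" if "x \<in> cball v0 (2*R)" for x by (rule M[OF that])
    qed (use R \<epsilon> \<epsilon>M L pre in auto)
  qed
  then obtain u where u0: "\<And>y. y \<in> cball p R \<Longrightarrow> u y 0 = (y, id_blinfun)"
    and uin: "\<And>y \<tau>. y \<in> cball p R \<Longrightarrow> \<tau> \<in> {-\<epsilon>..\<epsilon>} \<Longrightarrow> u y \<tau> \<in> cball v0 (2*R)"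
    and ud: "\<And>y \<tau>. y \<in> cball p R \<Longrightarrow> \<tau> \<in> {-\<epsilon>..\<epsilon>} \<Longrightarrow> (u y has_vector_derivative F (u y \<tau>)) (at \<tau> within {-\<epsilon>..\<epsilon>})"
    by metis
  define \<Phi> where "\<Phi> = (\<lambda>\<tau> y. fst (u y \<tau>))"
  define D where "D = (\<lambda>\<tau> y. snd (u y \<tau>))"
  have len: "(\<epsilon> - (-\<epsilon>)) * L \<le> 1/2" "(\<epsilon> - (-\<epsilon>)) * L1 \<le> 1/2"
  proof -
    show "(\<epsilon> - (-\<epsilon>)) * L \<le> 1/2" using \<epsilon>L by simp
    moreover have "(\<epsilon> - (-\<epsilon>)) * L1 \<le> (\<epsilon> - (-\<epsilon>)) * L" using \<epsilon> L by (intro mult_left_mono) auto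
    ultimately show "(\<epsilon> - (-\<epsilon>)) * L1 \<le> 1/2" by linarith
  qed
  have z: "0 \<in> {-\<epsilon>..\<epsilon>}" using \<epsilon> by simp
  have d\<Phi>: "((\<lambda>\<tau>. \<Phi> \<tau> y) has_vector_derivative X (\<Phi> \<tau> y)) (at \<tau> within {-\<epsilon>..\<epsilon>})"
    and dD: "((\<lambda>\<tau>. D \<tau> y) has_vector_derivative X' (\<Phi> \<tau> y) o\<^sub>L D \<tau> y) (at \<tau> within {-\<epsilon>..\<epsilon>})"
    if "y \<in> cball p R" "\<tau> \<in> {-\<epsilon>..\<epsilon>}" for y \<tau>
    using bounded_linear.has_vector_derivative[OF bounded_linear_fst ud[OF that]]
      bounded_linear.has_vector_derivative[OF bounded_linear_snd ud[OF that]]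
    by (simp_all add: \<Phi>_def D_def F_def case_prod_beta)
  have \<Phi>in: "\<Phi> \<tau> y \<in> cball p r0" if "y \<in> cball p R" "\<tau> \<in> {-\<epsilon>..\<epsilon>}" for y \<tau>
    using inB(1)[OF uin[OF that]] by (simp add: \<Phi>_def)
  have ulip: "norm (u y \<tau> - u z \<tau>) \<le> 2 * norm (y - z)"
    if "y \<in> cball p R" "z \<in> cball p R" "\<tau> \<in> {-\<epsilon>..\<epsilon>}" for y z \<tau>
  proof -
    have "norm (u y \<tau> - u z \<tau>) \<le> 2 * (norm (u y 0 - u z 0) + (\<epsilon> - (-\<epsilon>)) * 0)"
      by (rule vector_derivative_small_interval_bound[OF has_vector_derivative_diff[OF ud[OF that(1)] ud[OF that(2)]] _ L(1) len(1) _ z that(3)])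
        (use lip uin that in auto)
    then show ?thesis using u0 that by (simp add: norm_Pair)
  qed
  have \<Phi>lip: "norm (\<Phi> \<tau> y - \<Phi> \<tau> z) \<le> 2 * norm (y - z)"
    if "y \<in> cball p R" "z \<in> cball p R" "\<tau> \<in> {-\<epsilon>..\<epsilon>}" for y z \<tau>
    using ulip[OF that] norm_fst_diff_le[of "u y \<tau>" "u z \<tau>"] by (simp add: \<Phi>_def)
  have ucont: "continuous_on ({-\<epsilon>..\<epsilon>} \<times> cball p R) (\<lambda>(\<tau>, y). u y \<tau>)"
  proof (rule lipschitz_on_continuous_on[of "M + 2"], unfold lipschitz_on_def, safe)
    fix \<tau> y \<sigma> z assume a: "\<tau> \<in> {-\<epsilon>..\<epsilon>}" "\<sigma> \<in> {-\<epsilon>..\<epsilon>}" "y \<in> cball p R" "z \<in> cball p R"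
    have "norm (u y \<tau> - u y \<sigma>) \<le> M * \<bar>\<tau> - \<sigma>\<bar>"
      by (rule vector_derivative_bound[OF ud[OF a(3)] _ a(1,2)]) (use M uin a in auto)
    moreover have "norm (u y \<sigma> - u z \<sigma>) \<le> 2 * norm (y - z)" using ulip a by blast
    moreover have "norm (u y \<tau> - u z \<sigma>) \<le> norm (u y \<tau> - u y \<sigma>) + norm (u y \<sigma> - u z \<sigma>)"
      using norm_triangle_ineq[of "u y \<tau> - u y \<sigma>" "u y \<sigma> - u z \<sigma>"] by simp
    moreover have "M * \<bar>\<tau> - \<sigma>\<bar> \<le> M * norm ((\<tau>, y) - (\<sigma>, z))"
      using norm_fst_le[of "\<tau> - \<sigma>" "y - z"] M0 by (intro mult_left_mono) auto
    moreover have "norm (y - z) \<le> norm ((\<tau>, y) - (\<sigma>, z))"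
      using norm_snd_le[of "y - z" "\<tau> - \<sigma>"] by simp
    ultimately have "norm (u y \<tau> - u z \<sigma>) \<le> (M + 2) * norm ((\<tau>, y) - (\<sigma>, z))"
      by (simp add: algebra_simps)
    then show "dist (u y \<tau>) (u z \<sigma>) \<le> (M + 2) * dist (\<tau>, y) (\<sigma>, z)" by (simp add: dist_norm)
  qed (use M0 in auto)
  \<comment> \<open>The error of the linear approximation solves the linearised equation up to the
    Taylor remainder of \<open>X\<close> and vanishes at time 0. The constant 16 collects the 2 from
    absorption, the interval length \<open>2 * \<epsilon>\<close>, and the square of the Lipschitz
    constant 2 of the flow.\<close>
  have rem: "norm (\<Phi> \<tau> z - \<Phi> \<tau> y - D \<tau> y (z - y)) \<le> (16 * \<epsilon> * L2) * (norm (z - y))\<^sup>2"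
    if a: "y \<in> cball p R" "z \<in> cball p R" "\<tau> \<in> {-\<epsilon>..\<epsilon>}" for y z \<tau>
  proof -
    let ?h = "\<lambda>\<tau>. \<Phi> \<tau> z - \<Phi> \<tau> y - D \<tau> y (z - y)"
    let ?h' = "\<lambda>\<tau>. X (\<Phi> \<tau> z) - X (\<Phi> \<tau> y) - (X' (\<Phi> \<tau> y) o\<^sub>L D \<tau> y) (z - y)"
    have dh: "(?h has_vector_derivative ?h' s) (at s within {-\<epsilon>..\<epsilon>})" if "s \<in> {-\<epsilon>..\<epsilon>}" for s
      by (intro has_vector_derivative_diff d\<Phi> a that
          bounded_linear.has_vector_derivative[OF blinfun.bounded_linear_left dD])
    have "norm (?h' s) \<le> L1 * norm (?h s) + 4 * L2 * (norm (z - y))\<^sup>2" if s: "s \<in> {-\<epsilon>..\<epsilon>}" for s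
    proof -
      let ?y = "\<Phi> s y" and ?z = "\<Phi> s z"
      have in': "?y \<in> cball p r0" "?z \<in> cball p r0" using \<Phi>in a s by auto
      have seg: "closed_segment ?y ?z \<subseteq> cball p r0" using in' by (simp add: closed_segment_subset)
      have yU: "?y \<in> U" using in' r0 by auto
      have "norm (X ?z - X ?y - X' ?y (?z - ?y)) \<le> norm (?z - ?y) * (L2 * norm (?z - ?y))"
      proof (rule differentiable_bound_linearization[where S="closed_segment ?y ?z" and f'="\<lambda>x. blinfun_apply (X' x)"])
        show "?y + t *\<^sub>R (?z - ?y) \<in> closed_segment ?y ?z" if "t \<in> {0..1}" for t
          using that by (auto simp: in_segment algebra_simps intro!: exI[of _ t])
        fix x assume x: "x \<in> closed_segment ?y ?z"
        then have xU: "x \<in> U" using seg r0 by auto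
        show "(X has_derivative blinfun_apply (X' x)) (at x within closed_segment ?y ?z)"
          using dX[OF xU] X'[OF xU] by (simp add: has_derivative_at_withinI)
        have "onorm (blinfun_apply (X' x - X' ?y)) \<le> L2 * norm (x - ?y)"
          using lipX'[of x ?y] x seg in' by (auto simp: norm_blinfun.rep_eq)
        also have "\<dots> \<le> L2 * norm (?z - ?y)"
          using L2 segment_bound(1)[OF x] by (intro mult_left_mono) (auto simp: norm_minus_commute)
        finally show "onorm (blinfun_apply (X' x) - blinfun_apply (X' ?y)) \<le> L2 * norm (?z - ?y)"
          by (simp add: minus_blinfun.rep_eq fun_diff_def)
      qed simp
      also have "\<dots> = L2 * (norm (?z - ?y))\<^sup>2" by (simp add: power2_eq_square)
      also have "\<dots> \<le> L2 * (2 * norm (z - y))\<^sup>2"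
        using \<Phi>lip[of z y s] a s L2 by (intro mult_left_mono power_mono) auto
      finally have 1: "norm (X ?z - X ?y - X' ?y (?z - ?y)) \<le> 4 * L2 * (norm (z - y))\<^sup>2"
        by (simp add: power2_eq_square)
      have 2: "norm (X' ?y (?h s)) \<le> L1 * norm (?h s)"
        using nX'[OF in'(1)] norm_blinfun[of "X' ?y" "?h s"] by (meson mult_right_mono norm_ge_zero order_trans)
      have 3: "?h' s = (X ?z - X ?y - X' ?y (?z - ?y)) + X' ?y (?h s)"
        by (simp add: blinfun.bilinear_simps)
      show ?thesis
        unfolding 3 using 1 2 norm_triangle_ineq[of "X ?z - X ?y - X' ?y (?z - ?y)" "X' ?y (?h s)"]
        by linarith
    qed
    from vector_derivative_small_interval_bound[OF dh this _ len(2) _ z a(3)]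
    have "norm (?h \<tau>) \<le> 2 * (norm (?h 0) + (\<epsilon> - (-\<epsilon>)) * (4 * L2 * (norm (z - y))\<^sup>2))"
      using L1 L2 by simp
    moreover have "?h 0 = 0" using u0 a by (simp add: \<Phi>_def D_def)
    ultimately show ?thesis by (simp add: algebra_simps)
  qed
  have fD: "(\<Phi> \<tau> has_derivative blinfun_apply (D \<tau> y)) (at y)" if y: "y \<in> ball p R" and \<tau>: "\<tau> \<in> {-\<epsilon>..\<epsilon>}" for y \<tau>
    unfolding has_derivative_at_alt
  proof (intro conjI allI impI blinfun.bounded_linear_right)
    fix e :: real assume e: "e > 0"
    define C where "C = 16 * \<epsilon> * L2 + 1"
    have C: "C > 0" "16 * \<epsilon> * L2 \<le> C" using \<epsilon> L2 by (auto simp: C_def add_nonneg_pos)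
    obtain d where d: "d > 0" "ball y d \<subseteq> ball p R"
      using y openE[OF open_ball] by blast
    show "\<exists>d>0. \<forall>z. norm (z - y) < d \<longrightarrow> norm (\<Phi> \<tau> z - \<Phi> \<tau> y - D \<tau> y (z - y)) \<le> e * norm (z - y)"
    proof (intro exI[of _ "min d (e / C)"] conjI allI impI)
      show "min d (e / C) > 0" using d e C by simp
      fix z assume zz: "norm (z - y) < min d (e / C)"
      then have "z \<in> ball y d" by (simp add: dist_norm norm_minus_commute)
      then have zin: "z \<in> cball p R" using d(2) ball_subset_cball by blast
      have "norm (\<Phi> \<tau> z - \<Phi> \<tau> y - D \<tau> y (z - y)) \<le> (16 * \<epsilon> * L2) * (norm (z - y))\<^sup>2"
        using rem[of y z \<tau>] y zin \<tau> by auto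
      also have "\<dots> \<le> C * (norm (z - y))\<^sup>2" using C by (intro mult_right_mono) auto
      also have "\<dots> = (C * norm (z - y)) * norm (z - y)" by (simp add: power2_eq_square)
      also have "\<dots> \<le> e * norm (z - y)"
        using zz C by (intro mult_right_mono) (auto simp: field_simps)
      finally show "norm (\<Phi> \<tau> z - \<Phi> \<tau> y - D \<tau> y (z - y)) \<le> e * norm (z - y)" .
    qed
  qed
  have at: "at \<tau> within {-\<epsilon>..\<epsilon>} = at \<tau>" if "\<tau> \<in> {-\<epsilon><..<\<epsilon>}" for \<tau>
    by (rule at_within_interior) (use that in \<open>simp add: interior_atLeastAtMost_real\<close>)
  have Dcont: "continuous_on ({-\<epsilon>..\<epsilon>} \<times> cball p R) (\<lambda>(\<tau>, y). D \<tau> y)"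
    and \<Phi>cont: "continuous_on ({-\<epsilon>..\<epsilon>} \<times> cball p R) (\<lambda>(\<tau>, y). \<Phi> \<tau> y)"
    unfolding D_def \<Phi>_def using continuous_on_snd[OF ucont] continuous_on_fst[OF ucont] by (auto simp: case_prod_beta)
  let ?Z = "{-\<epsilon><..<\<epsilon>} \<times> ball p R"
  have Zsub: "?Z \<subseteq> {-\<epsilon>..\<epsilon>} \<times> cball p R" by auto
  have Zo: "open ?Z" by (intro open_Times) auto
  \<comment> \<open>The spatial derivative is continuous jointly in time and point, so it combines
    with the time derivative at a single point into a total derivative.\<close>
  have joint: "((\<lambda>(\<tau>, y). \<Phi> \<tau> y) has_derivative (\<lambda>(s, w). s *\<^sub>R X (\<Phi> \<tau> y) + D \<tau> y w)) (at (\<tau>, y))"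
    if a: "\<tau> \<in> {-\<epsilon><..<\<epsilon>}" "y \<in> ball p R" for \<tau> y
  proof -
    have "((\<lambda>(\<tau>, y). \<Phi> \<tau> y) has_derivative (\<lambda>(s, w). s *\<^sub>R X (\<Phi> \<tau> y) + D \<tau> y w)) (at (\<tau>, y) within ?Z)"
    proof (rule has_derivative_partialsI)
      show "((\<lambda>x. \<Phi> x y) has_derivative (\<lambda>s. s *\<^sub>R X (\<Phi> \<tau> y))) (at \<tau> within {-\<epsilon><..<\<epsilon>})"
        using d\<Phi>[of y \<tau>] a unfolding has_vector_derivative_def
        by (auto intro: has_derivative_subset)
      show "((\<lambda>y. \<Phi> x y) has_derivative blinfun_apply (D x y)) (at y within ball p R)"
        if "x \<in> {-\<epsilon><..<\<epsilon>}" "y \<in> ball p R" for x y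
        using fD[of y x] that by (auto intro: has_derivative_at_withinI)
      show "continuous (at (\<tau>, y) within ?Z) (\<lambda>(x, y). D x y)"
        using continuous_on_subset[OF Dcont Zsub] a by (auto simp: continuous_on_eq_continuous_within)
    qed (use a in auto)
    then show ?thesis using at_within_open[OF _ Zo] a by simp
  qed
  show ?thesis
  proof
    show "\<epsilon> > 0" "R > 0" by fact+
    show "\<Phi> 0 y = y" if "y \<in> ball p R" for y using u0[of y] that by (simp add: \<Phi>_def)
    show "\<Phi> \<tau> y \<in> U" if "\<tau> \<in> {-\<epsilon><..<\<epsilon>}" "y \<in> ball p R" for \<tau> y
      using \<Phi>in[of y \<tau>] that r0 by auto
    show "((\<lambda>\<tau>. \<Phi> \<tau> y) has_vector_derivative X (\<Phi> \<tau> y)) (at \<tau>)" if "\<tau> \<in> {-\<epsilon><..<\<epsilon>}" "y \<in> ball p R" for \<tau> y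
      using d\<Phi>[of y \<tau>] that at by auto
    have "continuous_on ?Z (\<lambda>z. frechet_derivative (\<lambda>(\<tau>, y). \<Phi> \<tau> y) (at z) sw)" for sw
    proof -
      have "continuous_on ?Z (\<lambda>z. fst sw *\<^sub>R X (\<Phi> (fst z) (snd z)) + blinfun_apply (D (fst z) (snd z)) (snd sw))"
        using continuous_on_subset[OF Dcont Zsub] continuous_on_subset[OF \<Phi>cont Zsub] \<Phi>in r0
        by (intro continuous_intros continuous_on_compose2[OF Ck_on_imp_continuous[OF X]] blinfun.continuous_on)
          (auto simp: case_prod_beta subset_eq)
      moreover have "frechet_derivative (\<lambda>(\<tau>, y). \<Phi> \<tau> y) (at z) sw
        = fst sw *\<^sub>R X (\<Phi> (fst z) (snd z)) + blinfun_apply (D (fst z) (snd z)) (snd sw)" if "z \<in> ?Z" for z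
        using frechet_derivative_at[OF joint[of "fst z" "snd z"], symmetric] that by (auto simp: case_prod_beta)
      ultimately show ?thesis by (simp cong: continuous_on_cong)
    qed
    then show "Ck_on 1 ?Z (\<lambda>(\<tau>, y). \<Phi> \<tau> y)"
      using joint differentiableI unfolding One_nat_def by fastforce
    fix w y assume y: "y \<in> ball p R"
    have "((\<lambda>\<tau>. blinfun_apply (D \<tau> y) w) has_vector_derivative blinfun_apply (X' (\<Phi> 0 y) o\<^sub>L D 0 y) w) (at 0)"
      using bounded_linear.has_vector_derivative[OF blinfun.bounded_linear_left dD[of y 0]] y z at[of 0] \<epsilon> by auto
    moreover have "blinfun_apply (X' (\<Phi> 0 y) o\<^sub>L D 0 y) w = frechet_derivative X (at y) w"
      using u0[of y] y X'[of y] R r0 by (auto simp: \<Phi>_def D_def subset_eq)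
    ultimately have "((\<lambda>\<tau>. blinfun_apply (D \<tau> y) w) has_vector_derivative frechet_derivative X (at y) w) (at 0)" by simp
    then show "((\<lambda>\<tau>. frechet_derivative (\<Phi> \<tau>) (at y) w) has_vector_derivative frechet_derivative X (at y) w) (at 0)"
    proof (rule has_vector_derivative_transform_within_open[of _ _ _ "{-\<epsilon><..<\<epsilon>}"])
      fix \<tau> assume "\<tau> \<in> {-\<epsilon><..<\<epsilon>}"
      then show "blinfun_apply (D \<tau> y) w = frechet_derivative (\<Phi> \<tau>) (at y) w"
        using frechet_derivative_at[OF fD[OF y]] by auto
    qed (use \<epsilon> in auto)
  qed
qed

section \<open>Lorentzian linear algebra\<close>

lemmas bilinear_simps = bilinear_ladd bilinear_radd bilinear_lmul bilinear_rmul bilinear_lsub bilinear_rsub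
  bilinear_lzero bilinear_rzero bilinear_lneg bilinear_rneg

lemma bilinear_basis_expand:
  fixes q :: "'b::euclidean_space \<Rightarrow> 'c::euclidean_space \<Rightarrow> real"
  assumes "bilinear q"
  shows "q u v = (\<Sum>b\<in>Basis. \<Sum>b'\<in>Basis. (u \<bullet> b) * (v \<bullet> b') * q b b')"
proof -
  have "q u v = (\<Sum>b\<in>Basis. (u \<bullet> b) *\<^sub>R q b v)"
    using assms by (intro linear_basis_expand) (simp add: bilinear_def)
  also have "\<dots> = (\<Sum>b\<in>Basis. (u \<bullet> b) *\<^sub>R (\<Sum>b'\<in>Basis. (v \<bullet> b') *\<^sub>R q b b'))"
    using assms by (intro sum.cong refl arg_cong2[where f=scaleR] linear_basis_expand) (simp add: bilinear_def)
  finally show ?thesis by (simp add: sum_distrib_left mult.assoc)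
qed

lemma lorentz_form_bilinear: "lorentz_form q \<Longrightarrow> bilinear q"
  and lorentz_form_sym: "lorentz_form q \<Longrightarrow> q u v = q v u"
  by (auto simp: lorentz_form_def)

text \<open>Coordinates in an orthonormal basis: \<open>\<phi>\<close> identifies \<open>q\<close>
  with the Minkowski form whose time direction is \<open>b0\<close>. Pairing with the images of
  basis vectors recovers coordinates up to sign, whence injectivity.\<close>

lemma lorentz_form_basis:
  fixes q :: "'b::euclidean_space \<Rightarrow> 'b \<Rightarrow> real"
  assumes q: "lorentz_form q"
  obtains b0 :: 'b and \<phi> :: "'b \<Rightarrow> 'b" where "b0 \<in> Basis" "linear \<phi>" "bij \<phi>"
    "\<And>x y. q (\<phi> x) (\<phi> y) = (\<Sum>b\<in>Basis - {b0}. (x \<bullet> b) * (y \<bullet> b)) - (x \<bullet> b0) * (y \<bullet> b0)"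
proof -
  obtain e :: "'b \<Rightarrow> 'b" and b0 where b0: "b0 \<in> Basis"
    and e: "\<And>i j. i \<in> Basis \<Longrightarrow> j \<in> Basis \<Longrightarrow> q (e i) (e j) = (if i \<noteq> j then 0 else if i = b0 then -1 else 1)"
    using q unfolding lorentz_form_def by blast
  have lq: "linear (q u)" "linear (\<lambda>x. q x u)" for u
    using lorentz_form_bilinear[OF q] by (auto simp: bilinear_def)
  define \<phi> where "\<phi> = (\<lambda>x. \<Sum>b\<in>Basis. (x \<bullet> b) *\<^sub>R e b)"
  have lin: "linear \<phi>"
    unfolding \<phi>_def
    by (intro linear_compose_sum ballI linearI) (auto simp: inner_add_left scaleR_add_left)
  have "q (\<phi> x) (e j) = (if j = b0 then - (x \<bullet> j) else x \<bullet> j)" if j: "j \<in> Basis" for x j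
  proof -
    have "q (\<phi> x) (e j) = (\<Sum>b\<in>Basis. (x \<bullet> b) * q (e b) (e j))"
      unfolding \<phi>_def by (simp add: linear_sum[OF lq(2)] linear_scale[OF lq(2)])
    also have "\<dots> = (\<Sum>b\<in>Basis. if b = j then (if j = b0 then - (x \<bullet> j) else x \<bullet> j) else 0)"
      by (rule sum.cong) (use e j in auto)
    finally show ?thesis using j by simp
  qed
  note qe = this
  have qx: "q (\<phi> x) (\<phi> y) = (\<Sum>b\<in>Basis. (y \<bullet> b) * (if b = b0 then - (x \<bullet> b) else x \<bullet> b))" for x y
  proof -
    have "q (\<phi> x) (\<phi> y) = (\<Sum>b\<in>Basis. (y \<bullet> b) * q (\<phi> x) (e b))"
      by (subst (2) \<phi>_def) (simp add: linear_sum[OF lq(1)] linear_scale[OF lq(1)])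
    then show ?thesis by (simp add: qe cong: sum.cong)
  qed
  have form: "q (\<phi> x) (\<phi> y) = (\<Sum>b\<in>Basis - {b0}. (x \<bullet> b) * (y \<bullet> b)) - (x \<bullet> b0) * (y \<bullet> b0)" for x y
  proof -
    have "(\<Sum>b\<in>Basis. (y \<bullet> b) * (if b = b0 then - (x \<bullet> b) else x \<bullet> b))
      = (y \<bullet> b0) * (- (x \<bullet> b0)) + (\<Sum>b\<in>Basis - {b0}. (y \<bullet> b) * (if b = b0 then - (x \<bullet> b) else x \<bullet> b))"
      using b0 by (subst sum.remove[OF _ b0]) auto
    also have "(\<Sum>b\<in>Basis - {b0}. (y \<bullet> b) * (if b = b0 then - (x \<bullet> b) else x \<bullet> b))
      = (\<Sum>b\<in>Basis - {b0}. (x \<bullet> b) * (y \<bullet> b))"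
      by (rule sum.cong) auto
    finally show ?thesis using qx by simp
  qed
  have "x = 0" if "\<phi> x = 0" for x
  proof (rule euclidean_eqI)
    fix j :: 'b assume j: "j \<in> Basis"
    have 0: "q (\<phi> x) (\<phi> j) = 0" using that lorentz_form_bilinear[OF q] by (simp add: bilinear_lzero)
    then have "(\<Sum>b\<in>Basis. (j \<bullet> b) * (if b = b0 then - (x \<bullet> b) else x \<bullet> b)) = 0" using qx by simp
    moreover have "(\<Sum>b\<in>Basis. (j \<bullet> b) * (if b = b0 then - (x \<bullet> b) else x \<bullet> b))
      = (\<Sum>b\<in>Basis. if b = j then (if j = b0 then - (x \<bullet> j) else x \<bullet> j) else 0)"
      by (rule sum.cong) (use j in \<open>auto simp: inner_Basis\<close>)
    ultimately show "x \<bullet> j = 0 \<bullet> j" using j by (simp split: if_splits)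
  qed
  then have "inj \<phi>" using lin linear_injective_0 by blast
  moreover then have "surj \<phi>" using lin linear_injective_imp_surjective by blast
  ultimately have "bij \<phi>" by (simp add: bij_def)
  then show ?thesis by (rule that[OF b0 lin _ form])
qed

lemma lorentz_form_nondegenerate:
  assumes q: "lorentz_form (q :: 'b::euclidean_space \<Rightarrow> 'b \<Rightarrow> real)" and u: "\<And>v. q u v = 0"
  shows "u = 0"
proof -
  obtain b0 :: 'b and \<phi> :: "'b \<Rightarrow> 'b" where b0: "b0 \<in> Basis" and \<phi>: "linear \<phi>" "bij \<phi>"
    and f: "\<And>x y. q (\<phi> x) (\<phi> y) = (\<Sum>b\<in>Basis - {b0}. (x \<bullet> b) * (y \<bullet> b)) - (x \<bullet> b0) * (y \<bullet> b0)"
    by (rule lorentz_form_basis[OF q], rule that) auto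
  obtain x where x: "u = \<phi> x" using \<phi>(2) by (metis bij_pointE)
  have "x = 0"
  proof (rule euclidean_eqI)
    fix j :: 'b assume j: "j \<in> Basis"
    have "(\<Sum>b\<in>Basis - {b0}. (x \<bullet> b) * (j \<bullet> b)) = (\<Sum>b\<in>Basis - {b0}. if b = j then x \<bullet> j else 0)"
      by (rule sum.cong) (use j in \<open>auto simp: inner_Basis\<close>)
    then show "x \<bullet> j = 0 \<bullet> j"
      using f[of x j] u[of "\<phi> j"] x j b0 by (auto simp: inner_Basis split: if_splits)
  qed
  then show ?thesis using x \<phi>(1) linear_0 by blast
qed

text \<open>In Minkowski coordinates orthogonality equates the spatial product of \<open>n\<close>
  and \<open>x\<close> with the product of their time components. Cauchy-Schwarz for the spatial
  parts, together with the larger time part of \<open>n\<close>, forces the spatial part of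
  \<open>x\<close> to dominate.\<close>

lemma lorentz_form_orthogonal_pos:
  assumes q: "lorentz_form (q :: 'b::euclidean_space \<Rightarrow> 'b \<Rightarrow> real)"
    and N: "q N N < 0" and w: "q N w = 0" "w \<noteq> 0"
  shows "q w w > 0"
proof -
  obtain b0 :: 'b and \<phi> :: "'b \<Rightarrow> 'b" where b0: "b0 \<in> Basis" and \<phi>: "linear \<phi>" "bij \<phi>"
    and f: "\<And>x y. q (\<phi> x) (\<phi> y) = (\<Sum>b\<in>Basis - {b0}. (x \<bullet> b) * (y \<bullet> b)) - (x \<bullet> b0) * (y \<bullet> b0)"
    by (rule lorentz_form_basis[OF q], rule that) auto
  obtain n where n: "N = \<phi> n" using \<phi>(2) by (metis bij_pointE)
  obtain x where x: "w = \<phi> x" using \<phi>(2) by (metis bij_pointE)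
  let ?S = "\<lambda>x y. \<Sum>b\<in>Basis - {b0}. (x \<bullet> b) * (y \<bullet> b)"
  have Spos: "?S y y \<ge> 0" for y by (simp add: sum_nonneg)
  have cs: "(?S n x)\<^sup>2 \<le> ?S n n * ?S x x"
    using Cauchy_Schwarz_ineq_sum[of "\<lambda>b. n \<bullet> b" "\<lambda>b. x \<bullet> b" "Basis - {b0}"] by (simp add: power2_eq_square)
  have n0: "?S n n < (n \<bullet> b0)\<^sup>2" using f[of n n] N n by (simp add: power2_eq_square)
  have sx: "?S n x = (n \<bullet> b0) * (x \<bullet> b0)" using f[of n x] w(1) n x by simp
  have "?S x x > 0"
  proof (rule ccontr)
    assume "\<not> ?S x x > 0"
    then have z: "?S x x = 0" using Spos[of x] by linarith
    then have "\<forall>b\<in>Basis - {b0}. x \<bullet> b = 0"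
      by (subst (asm) sum_nonneg_eq_0_iff) auto
    moreover have "n \<bullet> b0 \<noteq> 0" using n0 Spos[of n] by auto
    then have "x \<bullet> b0 = 0" using cs z sx by auto
    ultimately have "x = 0" by (metis Diff_iff euclidean_all_zero_iff singletonD)
    then show False using w(2) x \<phi>(1) linear_0 by blast
  qed
  then have "?S n n * ?S x x < (n \<bullet> b0)\<^sup>2 * ?S x x" using n0 by (rule mult_strict_right_mono[rotated])
  then have "(n \<bullet> b0)\<^sup>2 * (x \<bullet> b0)\<^sup>2 < (n \<bullet> b0)\<^sup>2 * ?S x x" using cs sx by (simp add: power_mult_distrib)
  then have "(x \<bullet> b0)\<^sup>2 < ?S x x" by (simp add: mult_less_cancel_left)
  then show ?thesis using f[of x x] x by (simp add: power2_eq_square)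
qed

lemma lorentz_form_orthogonal_nonneg:
  assumes "lorentz_form (q :: 'b::euclidean_space \<Rightarrow> 'b \<Rightarrow> real)" "q N N < 0" "q N w = 0"
  shows "q w w \<ge> 0"
  using lorentz_form_orthogonal_pos[OF assms] lorentz_form_bilinear[OF assms(1)]
  by (cases "w = 0") (auto simp: bilinear_lzero)

text \<open>On the orthogonal complement of \<open>N\<close> the form is positive, so the usual
  argument applies to \<open>u\<close> minus its projection to \<open>v\<close>.\<close>

lemma lorentz_form_orthogonal_CS:
  assumes q: "lorentz_form (q :: 'b::euclidean_space \<Rightarrow> 'b \<Rightarrow> real)" and N: "q N N < 0"
    and u: "q N u = 0" and v: "q N v = 0"
  shows "(q u v)\<^sup>2 \<le> q u u * q v v"
proof (cases "v = 0")
  case True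
  then show ?thesis using lorentz_form_bilinear[OF q] by (simp add: bilinear_simps)
next
  case False
  note b = lorentz_form_bilinear[OF q]
  have p: "q v v > 0" using lorentz_form_orthogonal_pos[OF q N v False] .
  define s where "s = q u v / q v v"
  have "q N (u - s *\<^sub>R v) = 0" using u v b by (simp add: bilinear_simps)
  from lorentz_form_orthogonal_nonneg[OF q N this]
  have "0 \<le> q u u - 2 * s * q u v + s\<^sup>2 * q v v"
    using lorentz_form_sym[OF q, of v u] by (simp add: bilinear_simps[OF b] algebra_simps power2_eq_square)
  also have "\<dots> = q u u - (q u v)\<^sup>2 / q v v" using p by (simp add: s_def power2_eq_square field_simps)
  finally show ?thesis using p by (simp add: field_simps)
qed

text \<open>\<open>q N v * q N w / q N N\<close> is the part of \<open>q\<close> carried by the line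
  of \<open>N\<close>; subtracting it twice reverses its sign and leaves the orthogonal complement
  untouched.\<close>

definition flip_form :: "('b::euclidean_space \<Rightarrow> 'b \<Rightarrow> real) \<Rightarrow> 'b \<Rightarrow> 'b \<Rightarrow> 'b \<Rightarrow> real" where
  "flip_form q N v w = q v w - 2 * q N v * q N w / q N N"

lemma lorentz_form_split:
  assumes q: "lorentz_form (q :: 'b::euclidean_space \<Rightarrow> 'b \<Rightarrow> real)" and N: "q N N < 0"
  obtains \<alpha> u where "v = \<alpha> *\<^sub>R N + u" "q N u = 0" "\<alpha> = q N v / q N N"
proof
  show "v = (q N v / q N N) *\<^sub>R N + (v - (q N v / q N N) *\<^sub>R N)" by simp
  show "q N (v - (q N v / q N N) *\<^sub>R N) = 0"
    using N lorentz_form_bilinear[OF q] by (simp add: bilinear_simps)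
qed simp

lemma flip_form_unique:
  assumes q: "lorentz_form (q :: 'b::euclidean_space \<Rightarrow> 'b \<Rightarrow> real)" and N: "q N N < 0"
  shows "(THE G. is_flip_form q N G) = flip_form q N"
proof (rule the_equality)
  note b = lorentz_form_bilinear[OF q] and s = lorentz_form_sym[OF q]
  have fb: "bilinear (flip_form q N)"
    unfolding bilinear_def flip_form_def
    by (intro conjI allI linearI) (auto simp: bilinear_simps[OF b] algebra_simps add_divide_distrib)
  have s0: "q w N = 0" if "q N w = 0" for w using s[of w N] that by simp
  from fb show "is_flip_form q N (flip_form q N)"
    using N unfolding is_flip_form_def
    by (auto simp: span_singleton flip_form_def bilinear_simps[OF b] s0)
  fix G assume G: "is_flip_form q N G"
  then have gb: "bilinear G" by (simp add: is_flip_form_def)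
  have NN: "N \<in> span {N}" by (simp add: span_base)
  show "G = flip_form q N"
  proof (intro ext)
    fix v w
    obtain \<alpha> u where u: "v = \<alpha> *\<^sub>R N + u" "q N u = 0" using lorentz_form_split[OF q N] by metis
    obtain \<beta> z where z: "w = \<beta> *\<^sub>R N + z" "q N z = 0" using lorentz_form_split[OF q N] by metis
    have "G N N = - q N N" "G N z = 0" "G u N = 0" "G u z = q u z"
      using G u(2) z(2) NN unfolding is_flip_form_def by auto
    then show "G v w = flip_form q N v w"
      using u(2) z(2) s[of u N] N unfolding u(1) z(1) flip_form_def
      by (simp add: bilinear_simps[OF gb] bilinear_simps[OF b])
  qed
qed

text \<open>Only the component of \<open>a\<close> orthogonal to \<open>N\<close> pairs with
  \<open>W\<close>, and the component along \<open>N\<close> can only enlarge the flip norm of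
  \<open>a\<close>. Thus a bound in the flip metric controls products under the indefinite
  form.\<close>

lemma flip_form_CS:
  assumes q: "lorentz_form (q :: 'b::euclidean_space \<Rightarrow> 'b \<Rightarrow> real)" and N: "q N N < 0" and W: "q N W = 0"
  shows "(q a W)\<^sup>2 \<le> flip_form q N a a * q W W"
proof -
  note b = lorentz_form_bilinear[OF q] and s = lorentz_form_sym[OF q]
  obtain \<alpha> u where u: "a = \<alpha> *\<^sub>R N + u" "q N u = 0" using lorentz_form_split[OF q N] by metis
  have "q a W = q u W" using W unfolding u(1) by (simp add: bilinear_simps[OF b])
  moreover have "flip_form q N a a = \<alpha>\<^sup>2 * (- q N N) + q u u"
    using u(2) s[of u N] N unfolding u(1) flip_form_def
    by (simp add: bilinear_simps[OF b] power2_eq_square)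
  moreover have "\<alpha>\<^sup>2 * (- q N N) \<ge> 0" using N by (simp add: mult_nonneg_nonpos)
  ultimately have "q u u * q W W \<le> flip_form q N a a * q W W"
    using lorentz_form_orthogonal_nonneg[OF q N W] by (intro mult_right_mono) auto
  then show ?thesis using lorentz_form_orthogonal_CS[OF q N u(2) W] \<open>q a W = q u W\<close> by simp
qed

lemma flip_form_pos:
  assumes q: "lorentz_form (q :: 'b::euclidean_space \<Rightarrow> 'b \<Rightarrow> real)" and N: "q N N < 0" and a: "a \<noteq> 0"
  shows "flip_form q N a a > 0"
proof -
  note b = lorentz_form_bilinear[OF q] and s = lorentz_form_sym[OF q]
  obtain \<alpha> u where u: "a = \<alpha> *\<^sub>R N + u" "q N u = 0" using lorentz_form_split[OF q N] by metis
  have e: "flip_form q N a a = \<alpha>\<^sup>2 * (- q N N) + q u u"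
    using u(2) s[of u N] N unfolding u(1) flip_form_def
    by (simp add: bilinear_simps[OF b] power2_eq_square)
  show ?thesis
  proof (cases "u = 0")
    case True
    then have "\<alpha> \<noteq> 0" using a u(1) by auto
    then have "\<alpha>\<^sup>2 * (- q N N) > 0" using N by (intro mult_pos_pos) auto
    then show ?thesis using e True b by (simp add: bilinear_simps)
  next
    case False
    moreover have "\<alpha>\<^sup>2 * (- q N N) \<ge> 0" using N by (simp add: mult_nonneg_nonpos)
    ultimately show ?thesis using e lorentz_form_orthogonal_pos[OF q N u(2)] by linarith
  qed
qed

text \<open>The components of \<open>v\<close> and \<open>T\<close> along \<open>N\<close> have the
  same sign and contribute a negative amount to \<open>q v T\<close>; the spatial contribution is
  strictly smaller in absolute value because \<open>T\<close> is timelike. With \<open>N\<close> the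
  gradient of \<open>t\<close>, a causal vector along which \<open>t\<close> increases is
  future-directed.\<close>

lemma causal_future_directed:
  assumes q: "lorentz_form (q :: 'b::euclidean_space \<Rightarrow> 'b \<Rightarrow> real)"
    and N: "q N N < 0" and T: "q T T < 0" and NT: "q N T > 0" and v: "q v v \<le> 0" and Nv: "q N v > 0"
  shows "q v T < 0"
proof -
  note b = lorentz_form_bilinear[OF q] and s = lorentz_form_sym[OF q]
  obtain \<alpha> u where u: "v = \<alpha> *\<^sub>R N + u" "q N u = 0" "\<alpha> = q N v / q N N" using lorentz_form_split[OF q N] by metis
  obtain \<beta> z where z: "T = \<beta> *\<^sub>R N + z" "q N z = 0" "\<beta> = q N T / q N N" using lorentz_form_split[OF q N] by metis
  define m where "m = - q N N"
  have m: "m > 0" using N by (simp add: m_def)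
  have \<alpha>\<beta>: "\<alpha> < 0" "\<beta> < 0" using u(3) z(3) Nv NT N by (auto simp: divide_pos_neg)
  have vv: "q u u \<le> \<alpha>\<^sup>2 * m"
    using v u(2) s[of u N] unfolding u(1) m_def by (simp add: bilinear_simps[OF b] power2_eq_square)
  have TT: "q z z < \<beta>\<^sup>2 * m"
    using T z(2) s[of z N] unfolding z(1) m_def by (simp add: bilinear_simps[OF b] power2_eq_square)
  have "(q u z)\<^sup>2 \<le> q u u * q z z" by (rule lorentz_form_orthogonal_CS[OF q N u(2) z(2)])
  also have "\<dots> \<le> (\<alpha>\<^sup>2 * m) * q z z"
    using vv lorentz_form_orthogonal_nonneg[OF q N z(2)] by (rule mult_right_mono)
  also have "\<dots> < (\<alpha>\<^sup>2 * m) * (\<beta>\<^sup>2 * m)"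
    using TT \<alpha>\<beta> m by (intro mult_strict_left_mono) auto
  also have "\<dots> = (\<alpha> * \<beta> * m)\<^sup>2" by (simp add: power2_eq_square)
  finally have "\<bar>q u z\<bar> < \<bar>\<alpha> * \<beta> * m\<bar>" by (simp add: abs_le_square_iff flip: not_le)
  moreover have "\<alpha> * \<beta> * m > 0" using \<alpha>\<beta> m by (simp add: mult_neg_neg)
  moreover have "q v T = - (\<alpha> * \<beta> * m) + q u z"
    using u(2) z(2) s[of u N] unfolding u(1) z(1) m_def by (simp add: bilinear_simps[OF b])
  ultimately show ?thesis by linarith
qed

text \<open>Lowering of an index, with the resulting covector read as a vector through the Euclidean
  inner product. A gradient thereby becomes the solution of a linear system between Euclidean
  spaces.\<close>

definition form_map :: "('b::euclidean_space \<Rightarrow> 'b \<Rightarrow> real) \<Rightarrow> 'b \<Rightarrow> 'b" where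
  "form_map q u = (\<Sum>b\<in>Basis. q u b *\<^sub>R b)"

lemma form_map_inner: "bilinear q \<Longrightarrow> form_map q u \<bullet> v = q u v"
  using linear_basis_expand[of "q u" v]
  by (simp add: form_map_def inner_sum_left bilinear_def mult.commute inner_commute[of v])

lemma form_map_linear: "bilinear q \<Longrightarrow> linear (form_map q)"
  by (rule linearI) (auto simp: form_map_def bilinear_simps scaleR_add_left sum.distrib scaleR_sum_right)

lemma form_map_inj:
  assumes "lorentz_form q" shows "inj (form_map q)"
proof -
  note b = lorentz_form_bilinear[OF assms]
  have "u = 0" if "form_map q u = 0" for u
    using lorentz_form_nondegenerate[OF assms, of u] form_map_inner[OF b, of u] that by simp
  then show ?thesis using form_map_linear[OF b] linear_injective_0 by blast
qed

lemma lorentz_form_ext: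
  assumes q: "lorentz_form q" and "\<And>v. q u v = q w v"
  shows "u = w"
proof -
  note b = lorentz_form_bilinear[OF q]
  have "q (u - w) v = 0" for v using assms(2) by (simp add: bilinear_simps[OF b])
  then show ?thesis using lorentz_form_nondegenerate[OF q, of "u - w"] by simp
qed

lemma lorentz_form_riesz:
  fixes \<theta> :: "'b::euclidean_space \<Rightarrow> real"
  assumes q: "lorentz_form q" and \<theta>: "linear \<theta>"
  shows "\<exists>!N. \<forall>v. q N v = \<theta> v"
proof -
  note b = lorentz_form_bilinear[OF q]
  have "surj (form_map q)"
    using form_map_linear[OF b] form_map_inj[OF q] linear_injective_imp_surjective by blast
  then obtain N where N: "form_map q N = (\<Sum>b\<in>Basis. \<theta> b *\<^sub>R b)" by (metis surjD)
  have "q N v = \<theta> v" for v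
    using form_map_inner[OF b, of N v] linear_basis_expand[OF \<theta>, of v] N
    by (simp add: inner_sum_left mult.commute inner_commute[of v])
  then show ?thesis using lorentz_form_ext[OF q] by metis
qed

text \<open>\<open>d w u v\<close> stands for the derivative in direction \<open>w\<close> of the
  metric coefficient of \<open>u\<close> and \<open>v\<close>. Constant coordinate fields commute,
  so the Koszul formula has three terms; by nondegeneracy it defines \<open>\<Gamma>\<close> and is
  forced on every other solution. This gives access to \<open>levi_civita\<close>, which is a
  definite description.\<close>

lemma koszul:
  fixes d :: "'b::euclidean_space \<Rightarrow> 'b \<Rightarrow> 'b \<Rightarrow> real"
  assumes q: "lorentz_form q"
    and d: "\<And>u v. linear (\<lambda>w. d w u v)" "\<And>w. bilinear (d w)" "\<And>w u v. d w u v = d w v u"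
  shows "\<exists>!\<Gamma>. bilinear \<Gamma> \<and> (\<forall>u v. \<Gamma> u v = \<Gamma> v u) \<and> (\<forall>w u v. d w u v = q (\<Gamma> w u) v + q u (\<Gamma> w v))"
proof -
  note b = lorentz_form_bilinear[OF q] and s = lorentz_form_sym[OF q]
  note dl = linear_add[OF d(1)] linear_scale[OF d(1)] bilinear_simps[OF d(2)]
  have "linear (\<lambda>v. (d w u v + d u w v - d v w u) / 2)" for w u
    by (rule linearI) (auto simp: dl algebra_simps add_divide_distrib diff_divide_distrib)
  from lorentz_form_riesz[OF q this]
  obtain \<Gamma> where \<Gamma>: "\<And>w u v. q (\<Gamma> w u) v = (d w u v + d u w v - d v w u) / 2" by metis
  have "bilinear \<Gamma>"
    unfolding bilinear_def
    by (intro conjI allI linearI lorentz_form_ext[OF q])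
      (auto simp: bilinear_simps[OF b] \<Gamma> dl algebra_simps add_divide_distrib diff_divide_distrib)
  moreover have "\<Gamma> u v = \<Gamma> v u" for u v
    by (rule lorentz_form_ext[OF q]) (use d(3) in \<open>simp add: \<Gamma> algebra_simps\<close>)
  moreover have "d w u v = q (\<Gamma> w u) v + q u (\<Gamma> w v)" for w u v
    using d(3)[of w u v] d(3)[of u w v] d(3)[of v w u] unfolding s[of u "\<Gamma> w v"] \<Gamma> by (simp add: field_simps)
  moreover have "\<Gamma>' = \<Gamma>" if "\<And>u v. \<Gamma>' u v = \<Gamma>' v u" "\<And>w u v. d w u v = q (\<Gamma>' w u) v + q u (\<Gamma>' w v)" for \<Gamma>'
  proof (intro ext lorentz_form_ext[OF q])
    fix w u v
    have "d w u v + d u w v - d v w u = 2 * q (\<Gamma>' w u) v"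
      unfolding that(2) using that(1)[of w u] that(1)[of v u] that(1)[of v w] s[of u "\<Gamma>' w v"] s[of w "\<Gamma>' u v"]
      s[of w "\<Gamma>' v u"] by simp
    then show "q (\<Gamma>' w u) v = q (\<Gamma> w u) v" by (simp add: \<Gamma>)
  qed
  ultimately show ?thesis by (intro ex1I[of _ \<Gamma>]) blast+
qed

section \<open>Charts and \<open>C\<^sup>1\<close> maps into the manifold\<close>

abbreviation cimg :: "('a, 'b) chart \<Rightarrow> 'b set" where
  "cimg c \<equiv> cmap c ` cdom c"

text \<open>The parameter set is Euclidean and open, while the values may wander through several
  charts. The flow fits this notion as a map of time and chart coordinates of the starting
  point.\<close>

definition C1map :: "('a::topological_space, 'b::euclidean_space) chart set \<Rightarrow> 'p::euclidean_space set \<Rightarrow> ('p \<Rightarrow> 'a) \<Rightarrow> bool" where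
  "C1map A Q f \<longleftrightarrow> open Q \<and> continuous_on Q f \<and>
     (\<forall>d\<in>A. Ck_on 1 {z\<in>Q. f z \<in> cdom d} (\<lambda>z. cmap d (f z)))"

lemma continuous_on_local:
  fixes f :: "'x::t2_space \<Rightarrow> 'y::topological_space"
  assumes "\<And>x. x \<in> S \<Longrightarrow> \<exists>U. open U \<and> x \<in> U \<and> continuous_on (S \<inter> U) f"
  shows "continuous_on S f"
  unfolding continuous_on_eq_continuous_within
proof
  fix x assume x: "x \<in> S"
  then obtain U where U: "open U" "x \<in> U" "continuous_on (S \<inter> U) f" using assms by blast
  have "at x within S = at x within (S \<inter> U)"
    by (rule at_within_nhd[OF U(2,1)]) auto
  then show "continuous (at x within S) f"
    using U x by (simp add: continuous_on_eq_continuous_within)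
qed

lemma isCont_real_nbhd:
  fixes f :: "real \<Rightarrow> 'z::topological_space"
  assumes "isCont f s" "open U" "f s \<in> U"
  shows "\<exists>e>0. \<forall>x. \<bar>x - s\<bar> < e \<longrightarrow> f x \<in> U"
proof -
  have "\<forall>\<^sub>F x in at s. f x \<in> U" using assms unfolding isCont_def by (metis topological_tendstoD)
  then obtain e where "e > 0" "\<And>x. x \<noteq> s \<Longrightarrow> dist x s < e \<Longrightarrow> f x \<in> U"
    unfolding eventually_at by blast
  then show ?thesis using assms(3) by (metis dist_real_def)
qed

lemma finite_gap:
  fixes C :: "real set"
  assumes "finite C" obtains d where "d > 0" "\<And>y. \<bar>y - x\<bar> < d \<Longrightarrow> y \<noteq> x \<Longrightarrow> y \<notin> C"
proof -
  have "open (- (C - {x}))" using assms by (intro open_Compl finite_imp_closed finite_Diff)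
  then obtain d where "d > 0" "ball x d \<subseteq> - (C - {x})" using openE[of "- (C - {x})" x] by auto
  moreover have "y \<in> ball x d" if "\<bar>y - x\<bar> < d" for y
    using that by (simp add: dist_real_def abs_minus_commute)
  ultimately show ?thesis using that[of d] by blast
qed

text \<open>On an interval of positive length one-sided derivatives are unique, so the local
  derivative functions all coincide with \<open>vector_derivative\<close> and glue to one continuous
  function per chart.\<close>

lemma C1_curve_onI:
  assumes ab: "a < b" and cont: "continuous_on {a..b} \<gamma>"
    and loc: "\<And>s0 d. s0 \<in> {a..b} \<Longrightarrow> d \<in> A \<Longrightarrow> \<gamma> s0 \<in> cdom d \<Longrightarrow>
      \<exists>U D. open U \<and> s0 \<in> U \<and> (\<forall>s\<in>{a..b} \<inter> U. ((\<lambda>s. cmap d (\<gamma> s)) has_vector_derivative D s) (at s within {a..b}))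
        \<and> continuous_on ({a..b} \<inter> U) D"
  shows "C1_curve_on A \<gamma> a b"
  unfolding C1_curve_on_def
proof (intro conjI ballI cont)
  fix d assume d: "d \<in> A"
  define D where "D = (\<lambda>s. vector_derivative (\<lambda>s. cmap d (\<gamma> s)) (at s within {a..b}))"
  have *: "\<exists>U. open U \<and> s0 \<in> U \<and> (\<forall>s\<in>{a..b} \<inter> U. ((\<lambda>s. cmap d (\<gamma> s)) has_vector_derivative D s) (at s within {a..b}))
      \<and> continuous_on ({a..b} \<inter> U) D" if s0: "s0 \<in> {a..b}" "\<gamma> s0 \<in> cdom d" for s0
  proof -
    obtain U E where U: "open U" "s0 \<in> U"
      "\<And>s. s\<in>{a..b} \<inter> U \<Longrightarrow> ((\<lambda>s. cmap d (\<gamma> s)) has_vector_derivative E s) (at s within {a..b})"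
      "continuous_on ({a..b} \<inter> U) E"
      using loc[OF s0(1) d s0(2)] by blast
    have "D s = E s" if "s \<in> {a..b} \<inter> U" for s
      unfolding D_def using vector_derivative_within_closed_interval[OF ab _ U(3)[OF that]] that by blast
    then show ?thesis using U by (metis continuous_on_cong)
  qed
  show "\<exists>D. (\<forall>s\<in>{a..b}. \<gamma> s \<in> cdom d \<longrightarrow> (cmap d \<circ> \<gamma> has_vector_derivative D s) (at s within {a..b})) \<and>
      continuous_on {s \<in> {a..b}. \<gamma> s \<in> cdom d} D"
  proof (intro exI[of _ D] conjI ballI impI)
    fix s assume "s \<in> {a..b}" "\<gamma> s \<in> cdom d"
    with *[OF this] show "(cmap d \<circ> \<gamma> has_vector_derivative D s) (at s within {a..b})"
      unfolding comp_def by blast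
  next
    show "continuous_on {s \<in> {a..b}. \<gamma> s \<in> cdom d} D"
    proof (rule continuous_on_local)
      fix s assume "s \<in> {s \<in> {a..b}. \<gamma> s \<in> cdom d}"
      then obtain U where "open U" "s \<in> U" "continuous_on ({a..b} \<inter> U) D" using * by blast
      then show "\<exists>U. open U \<and> s \<in> U \<and> continuous_on ({s \<in> {a..b}. \<gamma> s \<in> cdom d} \<inter> U) D"
        by (intro exI[of _ U]) (auto elim: continuous_on_subset)
    qed
  qed
qed

lemma C1_curve_on_continuous: "C1_curve_on A \<gamma> a b \<Longrightarrow> continuous_on {a..b} \<gamma>"
  by (simp add: C1_curve_on_def)

lemma C1_curve_on_derivative:
  assumes "C1_curve_on A \<gamma> a b" "a < b" "c \<in> A" "s \<in> {a..b}" "\<gamma> s \<in> cdom c"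
  shows "((\<lambda>s. cmap c (\<gamma> s)) has_vector_derivative velocity \<gamma> {a..b} c s) (at s within {a..b})"
proof -
  obtain D where D: "(cmap c \<circ> \<gamma> has_vector_derivative D s) (at s within {a..b})"
    using assms(1,3-5) unfolding C1_curve_on_def by blast
  then show ?thesis
    unfolding velocity_def vector_derivative_within_closed_interval[OF assms(2,4) D]
    by (simp add: comp_def)
qed

lemma C1_curve_on_velocity_continuous:
  assumes "C1_curve_on A \<gamma> a b" "a < b" "c \<in> A"
  shows "continuous_on {s\<in>{a..b}. \<gamma> s \<in> cdom c} (velocity \<gamma> {a..b} c)"
proof -
  obtain D where D: "\<forall>s\<in>{a..b}. \<gamma> s \<in> cdom c \<longrightarrow> (cmap c \<circ> \<gamma> has_vector_derivative D s) (at s within {a..b})"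
    "continuous_on {s\<in>{a..b}. \<gamma> s \<in> cdom c} D"
    using assms(1,3) unfolding C1_curve_on_def by blast
  then have "velocity \<gamma> {a..b} c s = D s" if "s \<in> {s\<in>{a..b}. \<gamma> s \<in> cdom c}" for s
    using vector_derivative_within_closed_interval[OF assms(2), of s "cmap c \<circ> \<gamma>" "D s"] that by (simp add: velocity_def)
  then show ?thesis using D(2) by (metis (no_types, lifting) continuous_on_cong)
qed

lemma velocity_eq:
  assumes "a < b" "s \<in> {a..b}" "((\<lambda>s. cmap c (\<gamma> s)) has_vector_derivative v) (at s within {a..b})"
  shows "velocity \<gamma> {a..b} c s = v"
  using vector_derivative_within_closed_interval[OF assms] by (simp add: velocity_def comp_def)

lemma velocity_UNIV_eq:
  assumes "s \<in> {a<..<b}"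
  shows "velocity \<gamma> UNIV c s = velocity \<gamma> {a..b} c s"
proof -
  have "at s within {a..b} = at s"
    by (rule at_within_interior) (use assms in \<open>simp add: interior_atLeastAtMost_real\<close>)
  then show ?thesis by (simp add: velocity_def)
qed

section \<open>Charts, coordinate changes and metric coefficients of a Lorentzian manifold\<close>

locale lorentz_manifold =
  fixes A :: "('a::{t2_space,second_countable_topology}, 'b::euclidean_space) chart set"
    and g :: "('a, 'b) metric" and T :: "('a, 'b) vfield"
  assumes tol: "time_oriented_lorentz_manifold A g T"
begin

lemma atlas: "smooth_atlas A" and metric: "lorentz_metric A g"
  and T_timelike: "c \<in> A \<Longrightarrow> x \<in> cdom c \<Longrightarrow> g c x (T c x) (T c x) < 0"
  using tol by (auto simp: time_oriented_lorentz_manifold_def timelike_def)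

lemma chart_at: obtains c where "c \<in> A" "x \<in> cdom c"
proof -
  have "x \<in> (\<Union>c\<in>A. cdom c)" using atlas by (simp add: smooth_atlas_def)
  then show ?thesis using that by blast
qed

lemma open_cdom: "c \<in> A \<Longrightarrow> open (cdom c)" and open_cimg: "c \<in> A \<Longrightarrow> open (cimg c)"
  and chart_homeo: "c \<in> A \<Longrightarrow> homeomorphism (cdom c) (cimg c) (cmap c) (cinv c)"
  using atlas by (auto simp: smooth_atlas_def)

lemma cinv_cmap [simp]: "c \<in> A \<Longrightarrow> x \<in> cdom c \<Longrightarrow> cinv c (cmap c x) = x"
  and cmap_cinv [simp]: "c \<in> A \<Longrightarrow> y \<in> cimg c \<Longrightarrow> cmap c (cinv c y) = y"
  and cinv_in [simp]: "c \<in> A \<Longrightarrow> y \<in> cimg c \<Longrightarrow> cinv c y \<in> cdom c"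
  using chart_homeo[of c] by (auto simp: homeomorphism_def)

lemma cmap_continuous: "c \<in> A \<Longrightarrow> continuous_on (cdom c) (cmap c)"
  and cinv_continuous: "c \<in> A \<Longrightarrow> continuous_on (cimg c) (cinv c)"
  using chart_homeo[of c] by (auto simp: homeomorphism_def)

lemma open_cmap_image:
  assumes "c \<in> A" "open W" "W \<subseteq> cdom c" shows "open (cmap c ` W)"
proof -
  have "cmap c ` W = cimg c \<inter> cinv c -` W"
    using assms(1,3) by (force simp: image_iff)
  then show ?thesis
    using continuous_open_preimage[OF cinv_continuous open_cimg assms(2)] assms(1) by simp
qed

lemma open_cinv_image:
  assumes "c \<in> A" "open W" "W \<subseteq> cimg c" shows "open (cinv c ` W)"
proof -
  have "x \<in> cinv c ` W" if "x \<in> cdom c" "cmap c x \<in> W" for x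
    using that assms(1) by (intro image_eqI[of _ _ "cmap c x"]) auto
  moreover have "cinv c y \<in> cdom c \<inter> cmap c -` W" if "y \<in> W" for y
    using assms that cmap_cinv[of c y] cinv_in[of c y] by auto
  ultimately have "cinv c ` W = cdom c \<inter> cmap c -` W" by blast
  then show ?thesis
    using continuous_open_preimage[OF cmap_continuous open_cdom assms(2)] assms(1) by simp
qed

lemma transition_Ck:
  assumes "c \<in> A" "d \<in> A"
  shows "Ck_on k (cmap c ` (cdom c \<inter> cdom d)) (\<lambda>y. cmap d (cinv c y))"
  using atlas assms unfolding smooth_atlas_def smooth_on_def comp_def by blast

lemma open_overlap: "c \<in> A \<Longrightarrow> d \<in> A \<Longrightarrow> open (cmap c ` (cdom c \<inter> cdom d))"
  by (intro open_cmap_image open_Int open_cdom) auto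

lemma transition_has_derivative:
  assumes "c \<in> A" "d \<in> A" "x \<in> cdom c" "x \<in> cdom d"
  shows "((\<lambda>y. cmap d (cinv c y)) has_derivative transition c d x) (at (cmap c x))"
  unfolding transition_def comp_def
  by (rule Ck_on_has_derivative[where k=0, OF transition_Ck]) (use assms in auto)

lemma transition_linear:
  "c \<in> A \<Longrightarrow> d \<in> A \<Longrightarrow> x \<in> cdom c \<Longrightarrow> x \<in> cdom d \<Longrightarrow> linear (transition c d x)"
  using transition_has_derivative has_derivative_linear by blast

text \<open>Continuity of \<open>f\<close> is a separate hypothesis: \<open>cmap c\<close> is
  arbitrary outside its domain, so differentiability of \<open>cmap c (f w)\<close> does not keep
  \<open>f\<close> in the chart near \<open>z\<close>. Working within a set \<open>S\<close> covers
  the one-sided derivatives of curves.\<close>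

lemma chart_change_derivative:
  fixes f :: "'p::real_normed_vector \<Rightarrow> 'a"
  assumes cd: "c \<in> A" "d \<in> A" and fz: "f z \<in> cdom c" "f z \<in> cdom d" and z: "z \<in> S"
    and cont: "continuous (at z within S) f"
    and D: "((\<lambda>w. cmap c (f w)) has_derivative D) (at z within S)"
  shows "((\<lambda>w. cmap d (f w)) has_derivative (\<lambda>v. transition c d (f z) (D v))) (at z within S)"
proof (rule has_derivative_transform_eventually[where f="\<lambda>w. cmap d (cinv c (cmap c (f w)))"])
  show "((\<lambda>w. cmap d (cinv c (cmap c (f w)))) has_derivative (\<lambda>v. transition c d (f z) (D v))) (at z within S)"
    using has_derivative_compose[OF D, of "\<lambda>y. cmap d (cinv c y)"] transition_has_derivative[OF cd fz] by blast
  have "\<forall>\<^sub>F w in at z within S. f w \<in> cdom c"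
    using cont open_cdom[OF cd(1)] fz(1) unfolding continuous_within by (metis topological_tendstoD)
  then show "\<forall>\<^sub>F w in at z within S. cmap d (cinv c (cmap c (f w))) = cmap d (f w)"
    by eventually_elim (use cd in simp)
qed (use cd fz z in auto)

lemma transition_inverse:
  assumes "c \<in> A" "d \<in> A" "x \<in> cdom c" "x \<in> cdom d"
  shows "transition d c x (transition c d x v) = v"
proof -
  have m: "cmap c x \<in> cimg c" using assms by auto
  have "((\<lambda>y. cmap c (cinv c y)) has_derivative (\<lambda>v. transition d c (cinv c (cmap c x)) (transition c d x v))) (at (cmap c x))"
  proof (rule chart_change_derivative[OF assms(2,1)])
    show "continuous (at (cmap c x)) (cinv c)"
      using cinv_continuous[OF assms(1)] continuous_on_eq_continuous_at[OF open_cimg[OF assms(1)]] m by blast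
    show "((\<lambda>w. cmap d (cinv c w)) has_derivative transition c d x) (at (cmap c x))"
      by (rule transition_has_derivative[OF assms])
  qed (use assms in auto)
  moreover have "((\<lambda>y. cmap c (cinv c y)) has_derivative (\<lambda>v. v)) (at (cmap c x))"
    by (rule has_derivative_transform_within_open[OF has_derivative_ident open_cimg[OF assms(1)] m])
      (use assms in simp)
  ultimately have "(\<lambda>v. transition d c (cinv c (cmap c x)) (transition c d x v)) = (\<lambda>v. v)"
    by (rule has_derivative_unique)
  then show ?thesis using assms by (metis cinv_cmap)
qed

lemma metric_form: "c \<in> A \<Longrightarrow> x \<in> cdom c \<Longrightarrow> lorentz_form (g c x)"
  and metric_Ck: "c \<in> A \<Longrightarrow> Ck_on k (cimg c) (\<lambda>y. g c (cinv c y) u v)"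
  and metric_transition: "c \<in> A \<Longrightarrow> d \<in> A \<Longrightarrow> x \<in> cdom c \<Longrightarrow> x \<in> cdom d \<Longrightarrow>
    g d x (transition c d x u) (transition c d x v) = g c x u v"
  using metric unfolding lorentz_metric_def smooth_on_def by (blast, blast, metis IntI)

lemmas metric_bilinear = metric_form[THEN lorentz_form_bilinear]

lemma metric_continuous:
  assumes c: "c \<in> A" and p: "continuous_on Z p" "\<And>z. z \<in> Z \<Longrightarrow> p z \<in> cdom c"
    and U: "continuous_on Z U" and V: "continuous_on Z V"
  shows "continuous_on Z (\<lambda>z. g c (p z) (U z) (V z))"
proof -
  have "continuous_on (cdom c) (\<lambda>x. g c (cinv c (cmap c x)) u v)" for u v
    by (rule continuous_on_compose2[OF Ck_on_imp_continuous[OF metric_Ck[OF c, of 0]] cmap_continuous[OF c]]) auto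
  then have gc: "continuous_on (cdom c) (\<lambda>x. g c x u v)" for u v
    using c by (simp cong: continuous_on_cong)
  have "continuous_on Z (\<lambda>z. \<Sum>b\<in>Basis. \<Sum>b'\<in>Basis. (U z \<bullet> b) * (V z \<bullet> b') * g c (p z) b b')"
    by (intro continuous_intros U V continuous_on_compose2[OF gc p(1)]) (use p(2) in auto)
  then show ?thesis
    using bilinear_basis_expand[OF metric_bilinear[OF c p(2)]] by (simp cong: continuous_on_cong)
qed

text \<open>The argument \<open>y\<close> is a coordinate point, not a point of the manifold, to
  suit the chain rule for maps written in the chart.\<close>

definition dg :: "('a, 'b) chart \<Rightarrow> 'b \<Rightarrow> 'b \<Rightarrow> 'b \<Rightarrow> 'b \<Rightarrow> real" where
  "dg c y w u v = frechet_derivative (\<lambda>y. g c (cinv c y) u v) (at y) w"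

lemma dg_has_derivative:
  assumes "c \<in> A" "y \<in> cimg c"
  shows "((\<lambda>y. g c (cinv c y) u v) has_derivative (\<lambda>w. dg c y w u v)) (at y)"
  unfolding dg_def by (rule Ck_on_has_derivative[where k=0, OF metric_Ck]) (use assms in auto)

lemma dg_unique:
  assumes "c \<in> A" "y \<in> cimg c" "(f has_derivative D) (at y)" "\<And>z. z \<in> cimg c \<Longrightarrow> f z = g c (cinv c z) u v"
  shows "dg c y w u v = D w"
proof -
  have "((\<lambda>y. g c (cinv c y) u v) has_derivative D) (at y)"
    by (rule has_derivative_transform_within_open[OF assms(3) open_cimg[OF assms(1)] assms(2,4)])
  then show ?thesis using has_derivative_unique[OF dg_has_derivative[OF assms(1,2)]] by metis
qed

lemma dg_linear: "c \<in> A \<Longrightarrow> y \<in> cimg c \<Longrightarrow> linear (\<lambda>w. dg c y w u v)"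
  using dg_has_derivative has_derivative_linear by blast

lemma dg_sym: "c \<in> A \<Longrightarrow> y \<in> cimg c \<Longrightarrow> dg c y w u v = dg c y w v u"
  using dg_unique[OF _ _ dg_has_derivative] lorentz_form_sym[OF metric_form] cinv_in by metis

lemma dg_bilinear:
  assumes c: "c \<in> A" and y: "y \<in> cimg c"
  shows "bilinear (dg c y w)"
  unfolding bilinear_def
proof (intro conjI allI linearI)
  fix u v v' :: 'b and r :: real
  note b = metric_bilinear[OF c cinv_in[OF c]]
  show "dg c y w u (v + v') = dg c y w u v + dg c y w u v'"
    by (rule dg_unique[OF c y has_derivative_add[OF dg_has_derivative[OF c y] dg_has_derivative[OF c y]]])
      (use b in \<open>simp add: bilinear_simps\<close>)
  show "dg c y w (v + v') u = dg c y w v u + dg c y w v' u"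
    by (rule dg_unique[OF c y has_derivative_add[OF dg_has_derivative[OF c y] dg_has_derivative[OF c y]]])
      (use b in \<open>simp add: bilinear_simps\<close>)
  show "dg c y w u (r *\<^sub>R v) = r *\<^sub>R dg c y w u v"
    by (rule dg_unique[OF c y has_derivative_scaleR_right[OF dg_has_derivative[OF c y]]])
      (use b in \<open>simp add: bilinear_simps\<close>)
  show "dg c y w (r *\<^sub>R v) u = r *\<^sub>R dg c y w v u"
    by (rule dg_unique[OF c y has_derivative_scaleR_right[OF dg_has_derivative[OF c y]]])
      (use b in \<open>simp add: bilinear_simps\<close>)
qed

text \<open>Expansion of \<open>U\<close> and \<open>V\<close> in the standard basis turns the
  moving base point and the two moving vectors into products of real functions. The intended case is
  the metric along an integral curve, on a vector carried by the flow.\<close>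

lemma metric_product_rule:
  fixes y :: "'z::real_normed_vector \<Rightarrow> 'b"
  assumes c: "c \<in> A" and yz: "y z \<in> cimg c" and z: "z \<in> S"
    and dy: "(y has_derivative y') (at z within S)"
    and dU: "(U has_derivative U') (at z within S)" and dV: "(V has_derivative V') (at z within S)"
  shows "((\<lambda>z. g c (cinv c (y z)) (U z) (V z)) has_derivative
    (\<lambda>h. dg c (y z) (y' h) (U z) (V z) + g c (cinv c (y z)) (U' h) (V z) + g c (cinv c (y z)) (U z) (V' h))) (at z within S)"
proof -
  let ?G = "\<lambda>z. \<lambda>b b'. g c (cinv c (y z)) b b'"
  have gd: "((\<lambda>z. ?G z b b') has_derivative (\<lambda>h. dg c (y z) (y' h) b b')) (at z within S)" for b b'
    by (rule has_derivative_compose[OF dy, of "\<lambda>x. g c (cinv c x) b b'"]) (rule dg_has_derivative[OF c yz])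
  have ub: "((\<lambda>z. U z \<bullet> b) has_derivative (\<lambda>h. U' h \<bullet> b)) (at z within S)"
    and vb: "((\<lambda>z. V z \<bullet> b) has_derivative (\<lambda>h. V' h \<bullet> b)) (at z within S)" for b
    by (rule bounded_linear.has_derivative[OF bounded_linear_inner_left], fact)+
  have "((\<lambda>z. \<Sum>b\<in>Basis. \<Sum>b'\<in>Basis. (U z \<bullet> b) * (V z \<bullet> b') * ?G z b b') has_derivative
    (\<lambda>h. \<Sum>b\<in>Basis. \<Sum>b'\<in>Basis. (U z \<bullet> b) * (V z \<bullet> b') * dg c (y z) (y' h) b b'
       + ((U z \<bullet> b) * (V' h \<bullet> b') + (U' h \<bullet> b) * (V z \<bullet> b')) * ?G z b b')) (at z within S)"
    by (intro has_derivative_sum has_derivative_mult gd ub vb)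
  then have "((\<lambda>z. \<Sum>b\<in>Basis. \<Sum>b'\<in>Basis. (U z \<bullet> b) * (V z \<bullet> b') * ?G z b b') has_derivative
    (\<lambda>h. dg c (y z) (y' h) (U z) (V z) + ?G z (U' h) (V z) + ?G z (U z) (V' h))) (at z within S)"
    unfolding bilinear_basis_expand[OF dg_bilinear[OF c yz], of _ "U z" "V z"]
      bilinear_basis_expand[OF metric_bilinear[OF c cinv_in[OF c yz]], of "U' _" "V z"]
      bilinear_basis_expand[OF metric_bilinear[OF c cinv_in[OF c yz]], of "U z" "V' _"]
    by (simp add: sum.distrib algebra_simps)
  moreover have "\<forall>\<^sub>F x in at z within S. y x \<in> cimg c"
    using has_derivative_continuous[OF dy] open_cimg[OF c] yz unfolding continuous_within by (metis topological_tendstoD)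
  then have "\<forall>\<^sub>F x in at z within S. (\<Sum>b\<in>Basis. \<Sum>b'\<in>Basis. (U x \<bullet> b) * (V x \<bullet> b') * ?G x b b') = ?G x (U x) (V x)"
    by eventually_elim (simp add: bilinear_basis_expand[OF metric_bilinear[OF c cinv_in[OF c]], symmetric])
  ultimately show ?thesis
    by (rule has_derivative_transform_eventually)
      (use z yz in \<open>auto simp: bilinear_basis_expand[OF metric_bilinear[OF c cinv_in[OF c]], symmetric]\<close>)
qed

section \<open>C^1 maps into the manifold and the curves they induce\<close>

lemma C1map_open: "C1map A Q f \<Longrightarrow> open Q" and C1map_continuous: "C1map A Q f \<Longrightarrow> continuous_on Q f"
  and C1map_Ck: "C1map A Q f \<Longrightarrow> d \<in> A \<Longrightarrow> Ck_on 1 {z\<in>Q. f z \<in> cdom d} (\<lambda>z. cmap d (f z))"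
  by (auto simp: C1map_def)

lemma C1map_open_dom: "C1map A Q f \<Longrightarrow> d \<in> A \<Longrightarrow> open {z\<in>Q. f z \<in> cdom d}"
  using continuous_open_preimage[OF C1map_continuous C1map_open open_cdom[of d]] by (simp add: vimage_def Int_def)

lemma C1map_has_derivative:
  assumes "C1map A Q f" "d \<in> A" "z \<in> Q" "f z \<in> cdom d"
  shows "((\<lambda>z. cmap d (f z)) has_derivative frechet_derivative (\<lambda>z. cmap d (f z)) (at z)) (at z)"
  by (rule Ck_on_has_derivative[OF C1map_Ck[OF assms(1,2), unfolded One_nat_def]]) (use assms in auto)

lemma C1map_chartI:
  assumes c: "c \<in> A" and Q: "open Q" and fc: "\<And>z. z \<in> Q \<Longrightarrow> f z \<in> cdom c" and k: "Ck_on 1 Q (\<lambda>z. cmap c (f z))"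
  shows "C1map A Q f"
  unfolding C1map_def
proof (intro conjI Q ballI)
  have "continuous_on Q (\<lambda>z. cinv c (cmap c (f z)))"
    by (rule continuous_on_compose2[OF cinv_continuous[OF c] Ck_on_imp_continuous[OF k]]) (use fc in auto)
  then show cont: "continuous_on Q f" using fc c by (simp cong: continuous_on_cong)
  fix d assume d: "d \<in> A"
  have o: "open {z\<in>Q. f z \<in> cdom d}"
    using continuous_open_preimage[OF cont Q open_cdom[OF d]] by (simp add: vimage_def Int_def)
  have "Ck_on 1 {z\<in>Q. f z \<in> cdom d} (\<lambda>z. cmap d (cinv c (cmap c (f z))))"
    by (rule C1_on_compose[OF o transition_Ck[OF c d] Ck_on_subset[OF k]]) (use fc in auto)
  then show "Ck_on 1 {z\<in>Q. f z \<in> cdom d} (\<lambda>z. cmap d (f z))"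
    by (rule Ck_on_eq[OF _ o]) (use fc c in auto)
qed

lemma C1map_local:
  assumes Q: "open Q" and loc: "\<And>z. z \<in> Q \<Longrightarrow> \<exists>Q'. z \<in> Q' \<and> C1map A Q' f"
  shows "C1map A Q f"
  unfolding C1map_def
proof (intro conjI Q ballI)
  show "continuous_on Q f"
    by (rule continuous_on_local) (metis C1map_def Int_lower2 continuous_on_subset loc)
  fix d assume d: "d \<in> A"
  show "Ck_on 1 {z\<in>Q. f z \<in> cdom d} (\<lambda>z. cmap d (f z))"
  proof (rule Ck_on_local)
    fix z assume z: "z \<in> {z\<in>Q. f z \<in> cdom d}"
    then obtain Q' where Q': "z \<in> Q'" "C1map A Q' f" using loc by blast
    then show "\<exists>U. open U \<and> z \<in> U \<and> Ck_on 1 U (\<lambda>z. cmap d (f z))"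
      using C1map_open_dom[OF Q'(2) d] C1map_Ck[OF Q'(2) d] z by (intro exI[of _ "{z\<in>Q'. f z \<in> cdom d}"]) auto
  qed
qed

lemma C1map_eq:
  assumes "C1map A Q f" "\<And>z. z \<in> Q \<Longrightarrow> f z = f' z" shows "C1map A Q f'"
  unfolding C1map_def
proof (intro conjI ballI)
  show "open Q" using C1map_open[OF assms(1)] .
  show "continuous_on Q f'" using C1map_continuous[OF assms(1)] assms(2) by (simp cong: continuous_on_cong)
  fix d assume d: "d \<in> A"
  have "{z\<in>Q. f z \<in> cdom d} = {z\<in>Q. f' z \<in> cdom d}" using assms(2) by auto
  then show "Ck_on 1 {z\<in>Q. f' z \<in> cdom d} (\<lambda>z. cmap d (f' z))"
    using Ck_on_eq[OF C1map_Ck[OF assms(1) d] C1map_open_dom[OF assms(1) d], of "\<lambda>z. cmap d (f' z)"] assms(2) by auto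
qed

lemma C1map_compose:
  assumes f: "C1map A Q f" and Q': "open Q'" and h: "Ck_on 1 Q' h" "h ` Q' \<subseteq> Q"
  shows "C1map A Q' (\<lambda>z. f (h z))"
  unfolding C1map_def
proof (intro conjI ballI Q')
  show cont: "continuous_on Q' (\<lambda>z. f (h z))"
    by (rule continuous_on_compose2[OF C1map_continuous[OF f] Ck_on_imp_continuous[OF h(1)] h(2)])
  fix d assume d: "d \<in> A"
  have o: "open {z\<in>Q'. f (h z) \<in> cdom d}"
    using continuous_open_preimage[OF cont Q' open_cdom[OF d]] by (simp add: vimage_def Int_def)
  show "Ck_on 1 {z\<in>Q'. f (h z) \<in> cdom d} (\<lambda>z. cmap d (f (h z)))"
    by (rule C1_on_compose[OF o C1map_Ck[OF f d] Ck_on_subset[OF h(1)]]) (use h(2) in auto)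
qed

lemma C1map_cinv: "c \<in> A \<Longrightarrow> C1map A (cimg c) (cinv c)"
  by (rule C1map_chartI[OF _ open_cimg cinv_in Ck_on_eq[OF Ck_on_id open_cimg]]) simp_all

lemma velocity_transition:
  assumes \<gamma>: "C1_curve_on A \<gamma> a b" and ab: "a < b" and cd: "c \<in> A" "d \<in> A" and s: "s \<in> {a..b}"
    and \<gamma>s: "\<gamma> s \<in> cdom c" "\<gamma> s \<in> cdom d"
  shows "velocity \<gamma> {a..b} d s = transition c d (\<gamma> s) (velocity \<gamma> {a..b} c s)"
proof (rule velocity_eq[OF ab s])
  have "((\<lambda>s. cmap d (\<gamma> s)) has_derivative (\<lambda>h. transition c d (\<gamma> s) (h *\<^sub>R velocity \<gamma> {a..b} c s))) (at s within {a..b})"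
    by (rule chart_change_derivative[where f=\<gamma> and z=s, OF cd \<gamma>s s])
      (use C1_curve_on_derivative[OF \<gamma> ab cd(1) s \<gamma>s(1)] C1_curve_on_continuous[OF \<gamma>] s
        in \<open>auto simp: has_vector_derivative_def continuous_on_eq_continuous_within\<close>)
  then show "((\<lambda>s. cmap d (\<gamma> s)) has_vector_derivative transition c d (\<gamma> s) (velocity \<gamma> {a..b} c s)) (at s within {a..b})"
    using transition_linear[OF cd \<gamma>s] by (simp add: has_vector_derivative_def linear_scale)
qed

lemma C1map_curve:
  assumes f: "C1map A Q f" and ab: "a < b" and h: "\<And>s. s \<in> {a..b} \<Longrightarrow> (h has_vector_derivative h' s) (at s within {a..b})"
    and h': "continuous_on {a..b} h'" and hO: "h ` {a..b} \<subseteq> Q"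
  shows "C1_curve_on A (\<lambda>s. f (h s)) a b"
    and "\<And>s d. s \<in> {a..b} \<Longrightarrow> d \<in> A \<Longrightarrow> f (h s) \<in> cdom d \<Longrightarrow>
      velocity (\<lambda>s. f (h s)) {a..b} d s = frechet_derivative (\<lambda>z. cmap d (f z)) (at (h s)) (h' s)"
proof -
  have hc: "continuous_on {a..b} h"
    using h has_vector_derivative_continuous continuous_on_eq_continuous_within by blast
  have fc: "continuous_on {a..b} (\<lambda>s. f (h s))"
    by (rule continuous_on_compose2[OF C1map_continuous[OF f] hc hO])
  have d: "((\<lambda>s. cmap d (f (h s))) has_vector_derivative frechet_derivative (\<lambda>z. cmap d (f z)) (at (h s)) (h' s)) (at s within {a..b})"
    if "s \<in> {a..b}" "d \<in> A" "f (h s) \<in> cdom d" for s d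
  proof -
    have hs: "h s \<in> Q" using hO that by auto
    note D = C1map_has_derivative[OF f that(2) hs that(3)]
    show ?thesis
      using has_derivative_compose[OF h[OF that(1), unfolded has_vector_derivative_def] D] linear_scale[OF has_derivative_linear[OF D]]
      by (simp add: has_vector_derivative_def)
  qed
  show "velocity (\<lambda>s. f (h s)) {a..b} d s = frechet_derivative (\<lambda>z. cmap d (f z)) (at (h s)) (h' s)"
    if "s \<in> {a..b}" "d \<in> A" "f (h s) \<in> cdom d" for s d
    by (rule velocity_eq[OF ab that(1) d[OF that]])
  show "C1_curve_on A (\<lambda>s. f (h s)) a b"
  proof (rule C1_curve_onI[OF ab fc])
    fix s0 c assume s0: "s0 \<in> {a..b}" "c \<in> A" "f (h s0) \<in> cdom c"
    obtain U where "open U" and "U \<inter> {a..b} = (\<lambda>s. f (h s)) -` cdom c \<inter> {a..b}"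
      using fc open_cdom[OF s0(2)] unfolding continuous_on_open_invariant by blast
    then have U: "s \<in> U \<longleftrightarrow> f (h s) \<in> cdom c" if "s \<in> {a..b}" for s using that by blast
    show "\<exists>U D. open U \<and> s0 \<in> U \<and> (\<forall>s\<in>{a..b} \<inter> U. ((\<lambda>s. cmap c (f (h s))) has_vector_derivative D s) (at s within {a..b}))
        \<and> continuous_on ({a..b} \<inter> U) D"
    proof (intro exI conjI ballI)
      show "open U" by fact
      show "s0 \<in> U" using U s0 by blast
      show "((\<lambda>s. cmap c (f (h s))) has_vector_derivative frechet_derivative (\<lambda>z. cmap c (f z)) (at (h s)) (h' s)) (at s within {a..b})"
        if "s \<in> {a..b} \<inter> U" for s
        by (rule d) (use that U s0(2) in auto)
      show "continuous_on ({a..b} \<inter> U) (\<lambda>s. frechet_derivative (\<lambda>z. cmap c (f z)) (at (h s)) (h' s))"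
        by (rule continuous_on_frechet_derivative[OF C1map_Ck[OF f s0(2)]])
          (use hO U in \<open>auto intro: continuous_on_subset[OF hc] continuous_on_subset[OF h']\<close>)
    qed
  qed
qed

end

section \<open>The normalised gradient field\<close>

locale sm_cauchy_manifold = lorentz_manifold A g T
  for A :: "('a::{t2_space,second_countable_topology}, 'b::euclidean_space) chart set"
    and g :: "('a, 'b) metric" and T :: "('a, 'b) vfield" +
  fixes t :: "'a \<Rightarrow> real"
  assumes sm: "sm_cauchy_temporal A g T t"
begin

lemma t_temporal: "temporal A g T t" and t_s: "s_function A g t" and t_m: "m_function A g T t"
  and t_cauchy: "causal_curve A g T I \<gamma> \<Longrightarrow> inextendible I \<gamma> \<Longrightarrow> (t \<circ> \<gamma>) ` I = UNIV"
  using sm by (auto simp: sm_cauchy_temporal_def cauchy_temporal_def)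

lemma t_Ck: "c \<in> A \<Longrightarrow> Ck_on k (cimg c) (\<lambda>y. t (cinv c y))"
  using t_s unfolding s_function_def smooth_fun_def smooth_on_def comp_def by blast

lemma t_continuous: "continuous_on UNIV t"
proof (rule continuous_on_local)
  fix x :: 'a
  obtain c where c: "c \<in> A" "x \<in> cdom c" by (rule chart_at)
  have "continuous_on (cdom c) (\<lambda>x. t (cinv c (cmap c x)))"
    by (rule continuous_on_compose2[OF Ck_on_imp_continuous[OF t_Ck[OF c(1), of 0]] cmap_continuous[OF c(1)]]) auto
  then have "continuous_on (cdom c) t" using c by (simp cong: continuous_on_cong)
  then show "\<exists>U. open U \<and> x \<in> U \<and> continuous_on (UNIV \<inter> U) t"
    using c open_cdom[OF c(1)] by (intro exI[of _ "cdom c"]) simp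
qed

abbreviation dt :: "('a, 'b) chart \<Rightarrow> 'a \<Rightarrow> 'b \<Rightarrow> real" where
  "dt \<equiv> differential t"

lemma dt_has_derivative:
  assumes "c \<in> A" "x \<in> cdom c"
  shows "((\<lambda>y. t (cinv c y)) has_derivative dt c x) (at (cmap c x))"
  unfolding differential_def comp_def
  by (rule Ck_on_has_derivative[where k=0, OF t_Ck]) (use assms in auto)

lemma dt_linear: "c \<in> A \<Longrightarrow> x \<in> cdom c \<Longrightarrow> linear (dt c x)"
  using dt_has_derivative has_derivative_linear by blast

lemma dt_transition:
  assumes cd: "c \<in> A" "d \<in> A" and x: "x \<in> cdom c" "x \<in> cdom d"
  shows "dt d x (transition c d x v) = dt c x v"
proof -
  have "((\<lambda>y. t (cinv d (cmap d (cinv c y)))) has_derivative (\<lambda>v. dt d x (transition c d x v))) (at (cmap c x))"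
    by (rule has_derivative_compose[OF transition_has_derivative[OF cd x], of "\<lambda>y. t (cinv d y)"])
      (use dt_has_derivative[OF cd(2) x(2)] cd x in simp)
  then have "((\<lambda>y. t (cinv c y)) has_derivative (\<lambda>v. dt d x (transition c d x v))) (at (cmap c x))"
    by (rule has_derivative_transform_within_open[OF _ open_overlap[OF cd]]) (use cd x in auto)
  then show ?thesis using has_derivative_unique[OF dt_has_derivative[OF cd(1) x(1)]] by metis
qed

abbreviation N :: "('a, 'b) vfield" where
  "N \<equiv> grad g t"

lemma N_eq:
  assumes "c \<in> A" "x \<in> cdom c" shows "g c x (N c x) v = dt c x v"
  using theI'[OF lorentz_form_riesz[OF metric_form[OF assms] dt_linear[OF assms]]]
  unfolding grad_def by blast

lemma N_timelike: "c \<in> A \<Longrightarrow> x \<in> cdom c \<Longrightarrow> g c x (N c x) (N c x) < 0"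
  and N_past: "c \<in> A \<Longrightarrow> x \<in> cdom c \<Longrightarrow> g c x (N c x) (T c x) > 0"
  using t_temporal by (auto simp: temporal_def timelike_def past_directed_def)

lemma N_transition:
  assumes cd: "c \<in> A" "d \<in> A" and x: "x \<in> cdom c" "x \<in> cdom d"
  shows "N d x = transition c d x (N c x)"
proof (rule lorentz_form_ext[OF metric_form[OF cd(2) x(2)]])
  fix v
  have v: "v = transition c d x (transition d c x v)"
    using transition_inverse[OF cd(2,1) x(2,1)] by simp
  have "g d x (transition c d x (N c x)) v = g c x (N c x) (transition d c x v)"
    using metric_transition[OF cd x] v by metis
  also have "\<dots> = dt d x v" using N_eq[OF cd(1) x(1)] dt_transition[OF cd(2,1) x(2,1)] by simp
  finally show "g d x (N d x) v = g d x (transition c d x (N c x)) v"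
    using N_eq[OF cd(2) x(2)] by simp
qed

text \<open>In the usual terminology the lapse function is \<open>- lapse\<close> to the power -1/2.
  The sign is kept because division by it turns the past-directed gradient into the future-directed
  \<open>X\<close>.\<close>

definition lapse :: "('a, 'b) chart \<Rightarrow> 'a \<Rightarrow> real" where
  "lapse c x = g c x (N c x) (N c x)"

lemma lapse_neg: "c \<in> A \<Longrightarrow> x \<in> cdom c \<Longrightarrow> lapse c x < 0"
  unfolding lapse_def by (rule N_timelike)

definition X :: "('a, 'b) vfield" where
  "X c x = (1 / lapse c x) *\<^sub>R N c x"

lemma X_transition:
  assumes cd: "c \<in> A" "d \<in> A" and x: "x \<in> cdom c" "x \<in> cdom d"
  shows "X d x = transition c d x (X c x)"
proof -
  have "lapse d x = lapse c x"
    using N_transition[OF assms] metric_transition[OF assms] by (simp add: lapse_def)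
  then show ?thesis
    using N_transition[OF assms] transition_linear[OF assms] by (simp add: X_def linear_scale)
qed

lemma dt_X: "c \<in> A \<Longrightarrow> x \<in> cdom c \<Longrightarrow> dt c x (X c x) = 1"
  using N_eq[of c x "N c x"] lapse_neg[of c x] dt_linear[of c x]
  by (simp add: X_def lapse_def linear_scale)

text \<open>The definite description in \<open>grad\<close> carries no regularity of its own; it
  comes from the linear system with the metric as matrix and \<open>dt\<close> as right-hand
  side.\<close>

lemma N_Ck:
  assumes c: "c \<in> A" shows "Ck_on k (cimg c) (\<lambda>y. N c (cinv c y))"
proof (rule linear_solve_Ck[where B="\<lambda>y. form_map (g c (cinv c y))"])
  show "open (cimg c)" by (rule open_cimg[OF c])
  show "linear (form_map (g c (cinv c y)))" "inj (form_map (g c (cinv c y)))" if "y \<in> cimg c" for y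
    using form_map_linear[OF metric_bilinear] form_map_inj[OF metric_form] cinv_in[OF c that] c by blast+
  show "Ck_on k (cimg c) (\<lambda>y. form_map (g c (cinv c y)) u)" for u
    unfolding form_map_def
    by (intro Ck_on_sum[OF open_cimg[OF c]] Ck_on_bounded_linear[OF bounded_linear_scaleR_left open_cimg[OF c]]
        metric_Ck[OF c])
  have "Ck_on k (cimg c) (\<lambda>y. frechet_derivative (\<lambda>y. t (cinv c y)) (at y) b)" for b
    using t_Ck[OF c, of "Suc k"] by simp
  then show "Ck_on k (cimg c) (\<lambda>y. \<Sum>b\<in>Basis. frechet_derivative (\<lambda>y. t (cinv c y)) (at y) b *\<^sub>R b)"
    by (intro Ck_on_sum[OF open_cimg[OF c]] Ck_on_bounded_linear[OF bounded_linear_scaleR_left open_cimg[OF c]])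
  show "form_map (g c (cinv c y)) (N c (cinv c y)) = (\<Sum>b\<in>Basis. frechet_derivative (\<lambda>y. t (cinv c y)) (at y) b *\<^sub>R b)"
    if "y \<in> cimg c" for y
    unfolding form_map_def using N_eq[OF c cinv_in[OF c that]] cmap_cinv[OF c that]
    by (simp add: differential_def comp_def)
qed

lemma lapse_Ck:
  assumes c: "c \<in> A" shows "Ck_on k (cimg c) (\<lambda>y. lapse c (cinv c y))"
proof -
  have "Ck_on k (cimg c) (\<lambda>y. \<Sum>b\<in>Basis. (N c (cinv c y) \<bullet> b) *\<^sub>R frechet_derivative (\<lambda>y. t (cinv c y)) (at y) b)"
    by (intro Ck_on_sum[OF open_cimg[OF c]] Ck_on_bilinear[OF bounded_bilinear_scaleR open_cimg[OF c]]
        Ck_on_bounded_linear[OF bounded_linear_inner_left open_cimg[OF c] N_Ck[OF c]])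
      (use t_Ck[OF c, of "Suc k"] in simp)
  then show ?thesis
  proof (rule Ck_on_eq[OF _ open_cimg[OF c]])
    fix y assume y: "y \<in> cimg c"
    show "(\<Sum>b\<in>Basis. (N c (cinv c y) \<bullet> b) *\<^sub>R frechet_derivative (\<lambda>y. t (cinv c y)) (at y) b) = lapse c (cinv c y)"
      unfolding lapse_def N_eq[OF c cinv_in[OF c y]]
      using linear_basis_expand[OF dt_linear[OF c cinv_in[OF c y]], of "N c (cinv c y)"] cmap_cinv[OF c y]
      by (simp add: differential_def comp_def)
  qed
qed

text \<open>Division by \<open>lapse\<close> is read as a linear system as well, with multiplication
  by \<open>lapse\<close> as its matrix.\<close>

lemma X_Ck:
  assumes c: "c \<in> A" shows "Ck_on k (cimg c) (\<lambda>y. X c (cinv c y))"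
proof (rule linear_solve_Ck[where B="\<lambda>y u. lapse c (cinv c y) *\<^sub>R u"])
  show "open (cimg c)" by (rule open_cimg[OF c])
  show "linear (\<lambda>u. lapse c (cinv c y) *\<^sub>R u)" for y
    by (rule linearI) (auto simp: scaleR_add_right)
  show "inj (\<lambda>u::'b. lapse c (cinv c y) *\<^sub>R u)" if "y \<in> cimg c" for y
    using lapse_neg[OF c cinv_in[OF c that]] by (auto simp: inj_def)
  show "Ck_on k (cimg c) (\<lambda>y. lapse c (cinv c y) *\<^sub>R u)" for u :: 'b
    by (intro Ck_on_bounded_linear[OF bounded_linear_scaleR_left open_cimg[OF c]] lapse_Ck[OF c])
  show "Ck_on k (cimg c) (\<lambda>y. N c (cinv c y))" by (rule N_Ck[OF c])
  show "lapse c (cinv c y) *\<^sub>R X c (cinv c y) = N c (cinv c y)" if "y \<in> cimg c" for y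
    using lapse_neg[OF c cinv_in[OF c that]] by (simp add: X_def)
qed

section \<open>Bounds from the s and m conditions\<close>

lemma flip_metric_eq: "c \<in> A \<Longrightarrow> x \<in> cdom c \<Longrightarrow> flip_metric g t c x = flip_form (g c x) (N c x)"
  unfolding flip_metric_def by (rule flip_form_unique[OF metric_form N_timelike])

lemma levi_civita_eq:
  assumes c: "c \<in> A" and x: "x \<in> cdom c"
  shows "bilinear (levi_civita g c x)" "levi_civita g c x u v = levi_civita g c x v u"
    "dg c (cmap c x) w u v = g c x (levi_civita g c x w u) v + g c x u (levi_civita g c x w v)"
proof -
  have y: "cmap c x \<in> cimg c" using x by simp
  have "\<exists>!\<Gamma>. bilinear \<Gamma> \<and> (\<forall>u v. \<Gamma> u v = \<Gamma> v u) \<and>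
    (\<forall>w u v. dg c (cmap c x) w u v = g c x (\<Gamma> w u) v + g c x u (\<Gamma> w v))"
    by (rule koszul[OF metric_form[OF c x] dg_linear[OF c y] dg_bilinear[OF c y] dg_sym[OF c y]])
  from theI'[OF this]
  have "bilinear (levi_civita g c x) \<and> (\<forall>u v. levi_civita g c x u v = levi_civita g c x v u) \<and>
    (\<forall>w u v. dg c (cmap c x) w u v = g c x (levi_civita g c x w u) v + g c x u (levi_civita g c x w v))"
    unfolding levi_civita_def dg_def .
  then show "bilinear (levi_civita g c x)" "levi_civita g c x u v = levi_civita g c x v u"
    "dg c (cmap c x) w u v = g c x (levi_civita g c x w u) v + g c x u (levi_civita g c x w v)"
    by blast+
qed

definition dN :: "('a, 'b) chart \<Rightarrow> 'a \<Rightarrow> 'b \<Rightarrow> 'b" where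
  "dN c x = frechet_derivative (\<lambda>y. N c (cinv c y)) (at (cmap c x))"

definition covN :: "('a, 'b) chart \<Rightarrow> 'a \<Rightarrow> 'b \<Rightarrow> 'b" where
  "covN c x v = dN c x v + levi_civita g c x v (N c x)"

lemma covN_iterated: "iterated_cov g N c [v] x = covN c x v"
  by (simp add: covN_def dN_def)

lemma dN_has_derivative:
  assumes "c \<in> A" "x \<in> cdom c"
  shows "((\<lambda>y. N c (cinv c y)) has_derivative dN c x) (at (cmap c x))"
  unfolding dN_def by (rule Ck_on_has_derivative[where k=0, OF N_Ck]) (use assms in auto)

lemma covN_scale:
  assumes "c \<in> A" "x \<in> cdom c" shows "covN c x (r *\<^sub>R v) = r *\<^sub>R covN c x v"
  using has_derivative_linear[OF dN_has_derivative[OF assms]] levi_civita_eq(1)[OF assms]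
  by (simp add: covN_def linear_scale bilinear_simps scaleR_add_right)

lemma Ck_norm_1_bounds:
  assumes "Ck_norm 1 A g S G Y \<le> ennreal K" "K \<ge> 0" "c \<in> A" "x \<in> S \<inter> cdom c"
  shows "sqrt (G c x (Y c x) (Y c x)) \<le> K"
    and "G c x v v = 1 \<Longrightarrow> sqrt (G c x (iterated_cov g Y c [v] x) (iterated_cov g Y c [v] x)) \<le> K"
proof -
  define f where "f = (\<lambda>(c, x, vs). ennreal (sqrt (G c x (iterated_cov g Y c vs x) (iterated_cov g Y c vs x))))"
  define I where "I = (\<lambda>i::nat. {(c, x, vs). c \<in> A \<and> x \<in> S \<inter> cdom c \<and> length vs = i \<and> (\<forall>v\<in>set vs. G c x v v = 1)})"
  have n: "Ck_norm 1 A g S G Y = Sup (f ` I 0) + Sup (f ` I 1)"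
    unfolding Ck_norm_def f_def I_def by (simp add: atMost_Suc add.commute)
  have le: "f z \<le> ennreal K" if "z \<in> I 0 \<union> I 1" for z
  proof -
    have "f z \<le> Sup (f ` I 0) + Sup (f ` I 1)"
      using that by (auto intro: add_increasing add_increasing2 SUP_upper)
    then show ?thesis using assms(1) n by simp
  qed
  have "(c, x, []) \<in> I 0" using assms by (simp add: I_def)
  then show "sqrt (G c x (Y c x) (Y c x)) \<le> K" using le[of "(c, x, [])"] assms(2) by (simp add: f_def)
  assume "G c x v v = 1"
  then have "(c, x, [v]) \<in> I 1" using assms by (simp add: I_def)
  then show "sqrt (G c x (iterated_cov g Y c [v] x) (iterated_cov g Y c [v] x)) \<le> K"
    using le[of "(c, x, [v])"] assms(2) by (simp add: f_def del: iterated_cov.simps)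
qed

text \<open>Since \<open>t\<close> is onto, \<open>h\<close> and \<open>C\<close> are continuous on
  the whole compact interval \<open>{a..a+1}\<close>; \<open>h0\<close> is minus the maximum of
  \<open>h\<close> there, \<open>C0\<close> the maximum of \<open>C\<close>. The m condition is used
  in both orders: order zero bounds \<open>- lapse\<close> by \<open>C0\<^sup>2\<close>, order one
  bounds the covariant derivative.\<close>

lemma slab_bounds:
  assumes "range t = UNIV"
  obtains h0 C0 where "h0 > 0" "C0 > 0"
    "\<And>c x. c \<in> A \<Longrightarrow> x \<in> cdom c \<Longrightarrow> t x \<in> {a..a+1} \<Longrightarrow> h0 \<le> - lapse c x \<and> - lapse c x \<le> C0\<^sup>2"
    "\<And>c x v. c \<in> A \<Longrightarrow> x \<in> cdom c \<Longrightarrow> t x \<in> {a..a+1} \<Longrightarrow> flip_form (g c x) (N c x) v v = 1 \<Longrightarrow>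
       flip_form (g c x) (N c x) (covN c x v) (covN c x v) \<le> C0\<^sup>2"
proof -
  obtain h where h: "continuous_on UNIV h" "\<And>a. h a < (0::real)"
    "\<And>a c x. c \<in> A \<Longrightarrow> x \<in> level_set t a \<inter> cdom c \<Longrightarrow> g c x (N c x) (N c x) < h a"
    using t_s assms unfolding s_function_def by auto
  obtain C where C: "continuous_on UNIV C" "\<And>a. C a > (0::real)"
    "\<And>a. Ck_norm 1 A g (level_set t a) (flip_metric g t) N \<le> ennreal (C a)"
    using t_m assms unfolding m_function_def by auto
  have cpt: "compact {a..a+1}" "{a..a+1} \<noteq> {}" by auto
  obtain s1 where s1: "\<And>s. s \<in> {a..a+1} \<Longrightarrow> h s \<le> h s1"
    using continuous_attains_sup[OF cpt continuous_on_subset[OF h(1)]] by blast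
  obtain s2 where s2: "\<And>s. s \<in> {a..a+1} \<Longrightarrow> C s \<le> C s2"
    using continuous_attains_sup[OF cpt continuous_on_subset[OF C(1)]] by blast
  show ?thesis
  proof (rule that[of "- h s1" "C s2"])
    show "- h s1 > 0" "C s2 > 0" using h(2) C(2) by auto
    fix c x assume c: "c \<in> A" and x: "x \<in> cdom c" and tx: "t x \<in> {a..a+1}"
    have xl: "x \<in> level_set t (t x) \<inter> cdom c" using x by (simp add: level_set_def)
    note G = flip_metric_eq[OF c x]
    note cb = Ck_norm_1_bounds[OF C(3) less_imp_le[OF C(2)] c xl, unfolded G]
    \<comment> \<open>The flip metric reverses the sign on \<open>N\<close>, so the order zero norm
      of the gradient is the square root of \<open>- lapse\<close>.\<close>
    have GN: "flip_form (g c x) (N c x) (N c x) (N c x) = - lapse c x"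
      using lapse_neg[OF c x] by (simp add: flip_form_def lapse_def)
    have sq: "r \<le> (C s2)\<^sup>2" if "sqrt r \<le> C (t x)" "r \<ge> 0" for r
    proof -
      have "sqrt r \<le> C s2" using that(1) s2[OF tx] by linarith
      then have "(sqrt r)\<^sup>2 \<le> (C s2)\<^sup>2" using that(2) by (intro power_mono) auto
      then show ?thesis using that(2) by simp
    qed
    show "- h s1 \<le> - lapse c x \<and> - lapse c x \<le> (C s2)\<^sup>2"
    proof
      show "- h s1 \<le> - lapse c x" using h(3)[OF c xl] s1[OF tx] by (simp add: lapse_def)
      show "- lapse c x \<le> (C s2)\<^sup>2"
        using cb(1) lapse_neg[OF c x] by (intro sq) (simp_all add: GN)
    qed
    fix v assume v: "flip_form (g c x) (N c x) v v = 1"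
    have "flip_form (g c x) (N c x) u u \<ge> 0" for u
      using flip_form_pos[OF metric_form[OF c x] N_timelike[OF c x], of u] metric_bilinear[OF c x]
      by (cases "u = 0") (auto simp: flip_form_def bilinear_simps)
    then show "flip_form (g c x) (N c x) (covN c x v) (covN c x v) \<le> (C s2)\<^sup>2"
      using cb(2)[OF v] by (intro sq) (simp_all only: covN_iterated)
  qed
qed

section \<open>The Lie derivative of the metric along \<open>X\<close>\<close>

definition dX :: "('a, 'b) chart \<Rightarrow> 'a \<Rightarrow> 'b \<Rightarrow> 'b" where
  "dX c x = frechet_derivative (\<lambda>y. X c (cinv c y)) (at (cmap c x))"

text \<open>The coordinate form of \<open>(L\<^sub>X g)(W,W)\<close>: the derivative of
  \<open>g(W,W)\<close> along \<open>X\<close> when \<open>W\<close> is carried by the flow, so that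
  its rate of change is \<open>dX c x W\<close>.\<close>

definition lie_metric :: "('a, 'b) chart \<Rightarrow> 'a \<Rightarrow> 'b \<Rightarrow> real" where
  "lie_metric c x W = dg c (cmap c x) (X c x) W W + g c x (dX c x W) W + g c x W (dX c x W)"

text \<open>Differentiating the factor \<open>1 / lapse\<close> produces a multiple of
  \<open>N\<close>, which is orthogonal to \<open>W\<close>, so its derivative \<open>L\<close> may
  stay unevaluated. Metric compatibility turns the derivative of the coefficients into a Christoffel
  term, and the symmetry of \<open>levi_civita\<close> makes it the term completing
  \<open>dN\<close> to \<open>covN\<close>.\<close>

lemma lie_metric_eq:
  assumes c: "c \<in> A" and x: "x \<in> cdom c" and W: "dt c x W = 0"
  shows "lie_metric c x W = 2 * g c x (covN c x W) W / lapse c x"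
proof -
  note b = metric_bilinear[OF c x] and s = lorentz_form_sym[OF metric_form[OF c x]]
  have NW: "g c x (N c x) W = 0" using N_eq[OF c x] W by simp
  have y: "cmap c x \<in> cimg c" using x by simp
  have l: "((\<lambda>y. lapse c (cinv c y)) has_derivative frechet_derivative (\<lambda>y. lapse c (cinv c y)) (at (cmap c x))) (at (cmap c x))"
    by (rule Ck_on_has_derivative[where k=0, OF lapse_Ck[OF c] y])
  have lx: "lapse c (cinv c (cmap c x)) \<noteq> 0" using lapse_neg[OF c x] c x by simp
  obtain L where L: "((\<lambda>y. 1 / lapse c (cinv c y)) has_derivative L) (at (cmap c x))"
    using has_derivative_divide[OF has_derivative_const[of 1] l lx] by blast
  have "((\<lambda>y. X c (cinv c y)) has_derivative (\<lambda>v. (1 / lapse c (cinv c (cmap c x))) *\<^sub>R dN c x v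
     + L v *\<^sub>R N c (cinv c (cmap c x)))) (at (cmap c x))"
    unfolding X_def by (rule has_derivative_scaleR[OF L dN_has_derivative[OF c x]])
  then have dX: "dX c x W = (1 / lapse c x) *\<^sub>R dN c x W + L W *\<^sub>R N c x"
    unfolding dX_def by (subst frechet_derivative_at[symmetric]) (use c x in simp_all)
  have 1: "g c x (dX c x W) W = g c x (dN c x W) W / lapse c x"
    unfolding dX using NW by (simp add: bilinear_simps[OF b])
  have 2: "dg c (cmap c x) (X c x) W W = 2 * g c x (levi_civita g c x W (N c x)) W / lapse c x"
    using levi_civita_eq(3)[OF c x, of "X c x" W W] levi_civita_eq(2)[OF c x, of W "N c x"]
      s[of W "levi_civita g c x (N c x) W"]
    by (simp add: X_def bilinear_simps[OF levi_civita_eq(1)[OF c x]] bilinear_simps[OF b])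
  have "g c x W (dX c x W) = g c x (dX c x W) W" by (rule s)
  then show ?thesis
    unfolding lie_metric_def 1 2 covN_def by (simp add: 1 bilinear_simps[OF b] add_divide_distrib distrib_left)
qed

text \<open>The m norm speaks of unit vectors of the flip metric, so \<open>W\<close> is normalised
  first; on tangent vectors of a level set the flip metric is \<open>g\<close>. Cauchy-Schwarz
  contributes \<open>C0\<close>, and the lower bound of \<open>- lapse\<close> contributes
  \<open>1 / h0\<close>.\<close>

lemma lie_metric_bound:
  assumes c: "c \<in> A" and x: "x \<in> cdom c" and W: "dt c x W = 0"
    and h0: "h0 > 0" "h0 \<le> - lapse c x" and C0: "C0 > 0"
    and cov: "\<And>v. flip_form (g c x) (N c x) v v = 1 \<Longrightarrow> flip_form (g c x) (N c x) (covN c x v) (covN c x v) \<le> C0\<^sup>2"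
  shows "lie_metric c x W \<le> (2 * C0 / h0) * g c x W W"
proof (cases "W = 0")
  case True
  then show ?thesis using metric_bilinear[OF c x] dg_bilinear[OF c, of "cmap c x"] x
    by (simp add: lie_metric_def bilinear_simps)
next
  case False
  note q = metric_form[OF c x] and b = metric_bilinear[OF c x]
  have NW: "g c x (N c x) W = 0" using N_eq[OF c x] W by simp
  define \<omega> where "\<omega> = g c x W W"
  have \<omega>: "\<omega> > 0" unfolding \<omega>_def by (rule lorentz_form_orthogonal_pos[OF q N_timelike[OF c x] NW False])
  define v where "v = (1 / sqrt \<omega>) *\<^sub>R W"
  have Wv: "W = sqrt \<omega> *\<^sub>R v" using \<omega> by (simp add: v_def)
  have "g c x (N c x) v = 0" using NW by (simp add: v_def bilinear_simps[OF b])
  then have "flip_form (g c x) (N c x) v v = 1"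
    using \<omega> by (simp add: flip_form_def v_def bilinear_simps[OF b] \<omega>_def[symmetric])
  then have "flip_form (g c x) (N c x) (covN c x v) (covN c x v) \<le> C0\<^sup>2" by (rule cov)
  then have "(g c x (covN c x v) W)\<^sup>2 \<le> C0\<^sup>2 * \<omega>"
    using flip_form_CS[OF q N_timelike[OF c x] NW, of "covN c x v"] \<omega>
      mult_right_mono[of "flip_form (g c x) (N c x) (covN c x v) (covN c x v)" "C0\<^sup>2" \<omega>]
    unfolding \<omega>_def by linarith
  also have "\<dots> = (C0 * sqrt \<omega>)\<^sup>2" using \<omega> by (simp add: power_mult_distrib)
  finally have "\<bar>g c x (covN c x v) W\<bar> \<le> C0 * sqrt \<omega>"
    using C0 \<omega> abs_le_square_iff[of "g c x (covN c x v) W" "C0 * sqrt \<omega>"] by simp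
  then have "sqrt \<omega> * \<bar>g c x (covN c x v) W\<bar> \<le> sqrt \<omega> * (C0 * sqrt \<omega>)"
    using \<omega> by (intro mult_left_mono) auto
  also have "\<dots> = C0 * \<omega>" using \<omega> by simp
  also have "sqrt \<omega> * \<bar>g c x (covN c x v) W\<bar> = \<bar>g c x (covN c x W) W\<bar>"
  proof -
    have "covN c x W = sqrt \<omega> *\<^sub>R covN c x v" using covN_scale[OF c x] Wv by metis
    then show ?thesis using \<omega> by (simp add: bilinear_simps[OF b] abs_mult)
  qed
  finally have b1: "\<bar>g c x (covN c x W) W\<bar> \<le> C0 * \<omega>" .
  have "lie_metric c x W \<le> \<bar>2 * g c x (covN c x W) W / lapse c x\<bar>"
    unfolding lie_metric_eq[OF c x W] by (rule abs_ge_self)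
  also have "\<dots> = 2 * \<bar>g c x (covN c x W) W\<bar> / (- lapse c x)"
    using lapse_neg[OF c x] by (simp add: abs_mult)
  also have "\<dots> \<le> 2 * (C0 * \<omega>) / h0"
    using b1 h0 C0 \<omega> by (intro frac_le mult_left_mono) auto
  finally show ?thesis by (simp add: \<omega>_def algebra_simps)
qed

end

section \<open>Integral curves and the global flow\<close>

context sm_cauchy_manifold
begin

text \<open>The interval is open, so derivatives are two-sided and curves with a common point can be
  glued. The equation is demanded in every chart around the point; as \<open>X\<close> transforms
  like a vector field, checking it in one chart suffices.\<close>

definition integral_curve :: "real set \<Rightarrow> (real \<Rightarrow> 'a) \<Rightarrow> bool" where
  "integral_curve I \<sigma> \<longleftrightarrow> open I \<and> is_interval I \<and> continuous_on I \<sigma> \<and>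
     (\<forall>s\<in>I. \<forall>c\<in>A. \<sigma> s \<in> cdom c \<longrightarrow> ((\<lambda>s. cmap c (\<sigma> s)) has_vector_derivative X c (\<sigma> s)) (at s))"

lemma integral_curveD:
  assumes "integral_curve I \<sigma>"
  shows "open I" "is_interval I" "continuous_on I \<sigma>"
    "\<And>s c. s \<in> I \<Longrightarrow> c \<in> A \<Longrightarrow> \<sigma> s \<in> cdom c \<Longrightarrow> ((\<lambda>s. cmap c (\<sigma> s)) has_vector_derivative X c (\<sigma> s)) (at s)"
  using assms by (auto simp: integral_curve_def)

lemma integral_curve_isCont: "integral_curve I \<sigma> \<Longrightarrow> s \<in> I \<Longrightarrow> isCont \<sigma> s"
  using integral_curveD(1,3) continuous_on_eq_continuous_at by blast

lemma integral_curve_chartI: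
  assumes c: "c \<in> A" and I: "open I" "is_interval I" and \<sigma>c: "\<And>s. s \<in> I \<Longrightarrow> \<sigma> s \<in> cdom c"
    and d: "\<And>s. s \<in> I \<Longrightarrow> ((\<lambda>s. cmap c (\<sigma> s)) has_vector_derivative X c (\<sigma> s)) (at s)"
  shows "integral_curve I \<sigma>"
  unfolding integral_curve_def
proof (intro conjI I ballI impI)
  have "continuous_on I (\<lambda>s. cmap c (\<sigma> s))"
    by (intro continuous_at_imp_continuous_on ballI) (rule has_vector_derivative_continuous[OF d])
  then have "continuous_on I (\<lambda>s. cinv c (cmap c (\<sigma> s)))"
    by (rule continuous_on_compose2[OF cinv_continuous[OF c]]) (use \<sigma>c in auto)
  then show cont: "continuous_on I \<sigma>" using \<sigma>c c by (simp cong: continuous_on_cong)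
  fix s e assume s: "s \<in> I" and e: "e \<in> A" "\<sigma> s \<in> cdom e"
  have "((\<lambda>s. cmap e (\<sigma> s)) has_derivative (\<lambda>h. transition c e (\<sigma> s) (h *\<^sub>R X c (\<sigma> s)))) (at s)"
    by (rule chart_change_derivative[where f=\<sigma> and z=s, OF c e(1) \<sigma>c[OF s] e(2) UNIV_I])
      (use d[OF s] cont I(1) s in \<open>auto simp: has_vector_derivative_def continuous_on_eq_continuous_at\<close>)
  then show "((\<lambda>s. cmap e (\<sigma> s)) has_vector_derivative X e (\<sigma> s)) (at s)"
    using transition_linear[OF c e(1) \<sigma>c[OF s] e(2)] X_transition[OF c e(1) \<sigma>c[OF s] e(2)]
    by (simp add: has_vector_derivative_def linear_scale)
qed

lemma integral_curve_local_unique: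
  assumes 1: "integral_curve I \<sigma>" and 2: "integral_curve J \<tau>" and s0: "s0 \<in> I" "s0 \<in> J" and eq: "\<sigma> s0 = \<tau> s0"
  obtains e where "e > 0" "\<And>s. \<bar>s - s0\<bar> < e \<Longrightarrow> s \<in> I \<and> s \<in> J \<and> \<sigma> s = \<tau> s"
proof -
  obtain c where c: "c \<in> A" "\<sigma> s0 \<in> cdom c" by (rule chart_at)
  obtain r where r: "r > 0" "cball (cmap c (\<sigma> s0)) r \<subseteq> cimg c"
    using open_cimg[OF c(1)] c(2) open_contains_cball by (metis imageI)
  obtain L where L: "L > 0" "\<And>y z. y \<in> cball (cmap c (\<sigma> s0)) r \<Longrightarrow> z \<in> cball (cmap c (\<sigma> s0)) r \<Longrightarrow>
      norm (X c (cinv c y) - X c (cinv c z)) \<le> L * norm (y - z)"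
    using C1_lipschitz_cball[OF X_Ck[OF c(1)] r(2)] by metis
  define U where "U = cinv c ` ball (cmap c (\<sigma> s0)) r"
  have sub: "ball (cmap c (\<sigma> s0)) r \<subseteq> cimg c" using r by auto
  have U: "open U" unfolding U_def by (rule open_cinv_image[OF c(1) open_ball sub])
  have \<sigma>U: "\<sigma> s0 \<in> U" unfolding U_def using r c by (intro image_eqI[of _ _ "cmap c (\<sigma> s0)"]) auto
  have Uin: "x \<in> cdom c \<and> cmap c x \<in> cball (cmap c (\<sigma> s0)) r" if xU: "x \<in> U" for x
  proof -
    obtain y where y: "x = cinv c y" "y \<in> ball (cmap c (\<sigma> s0)) r"
      using xU unfolding U_def by blast
    then have "y \<in> cimg c" using sub by blast
    then show ?thesis using y cmap_cinv[OF c(1)] cinv_in[OF c(1)] by (metis less_imp_le mem_ball mem_cball)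
  qed
  obtain e1 where e1: "e1 > 0" "\<And>s. \<bar>s - s0\<bar> < e1 \<Longrightarrow> \<sigma> s \<in> U"
    using isCont_real_nbhd[OF integral_curve_isCont[OF 1 s0(1)] U \<sigma>U] by blast
  obtain e2 where e2: "e2 > 0" "\<And>s. \<bar>s - s0\<bar> < e2 \<Longrightarrow> \<tau> s \<in> U"
    using isCont_real_nbhd[OF integral_curve_isCont[OF 2 s0(2)] U] \<sigma>U eq by metis
  obtain e3 where e3: "e3 > 0" "\<And>s. \<bar>s - s0\<bar> < e3 \<Longrightarrow> s \<in> I \<inter> J"
    using isCont_real_nbhd[where f="\<lambda>x. x" and s=s0 and U="I \<inter> J", OF continuous_ident] integral_curveD(1)[OF 1] integral_curveD(1)[OF 2] s0 by auto
  \<comment> \<open>Halving puts the closed interval of radius \<open>e\<close> inside all three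
    neighbourhoods; \<open>1 / (4 * L)\<close> makes the absorption estimate valid on its length
    \<open>2 * e\<close>.\<close>
  define e where "e = min (min e1 e2) (min e3 (1 / (4 * L))) / 2"
  have e: "e > 0" "e < e1" "e < e2" "e < e3" "e * L \<le> 1/4"
  proof -
    define m where "m = min (min e1 e2) (min e3 (1 / (4 * L)))"
    have m: "m > 0" "m \<le> e1" "m \<le> e2" "m \<le> e3" "m \<le> 1 / (4 * L)" "e = m / 2"
      using e1 e2 e3 L by (auto simp: m_def e_def)
    then show "e > 0" "e < e1" "e < e2" "e < e3" by linarith+
    have "e \<le> 1 / (4 * L)" using m by linarith
    then show "e * L \<le> 1/4" using L by (simp add: field_simps)
  qed
  have in': "s \<in> I \<inter> J" "\<sigma> s \<in> U" "\<tau> s \<in> U" if "s \<in> {s0-e..s0+e}" for s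
    using e1 e2 e3 e that by auto
  let ?h = "\<lambda>s. cmap c (\<sigma> s) - cmap c (\<tau> s)"
  have "\<sigma> s = \<tau> s" if s: "s \<in> {s0-e..s0+e}" for s
  proof -
    \<comment> \<open>There is no inhomogeneous term and the curves agree at \<open>s0\<close>, so
      the bound on their difference is 0.\<close>
    have "norm (?h s) \<le> 2 * (norm (?h s0) + ((s0+e) - (s0-e)) * 0)"
    proof (rule vector_derivative_small_interval_bound[where L=L])
      fix s assume s: "s \<in> {s0-e..s0+e}"
      show "(?h has_vector_derivative (X c (\<sigma> s) - X c (\<tau> s))) (at s within {s0-e..s0+e})"
      proof (rule has_vector_derivative_diff)
        show "((\<lambda>s. cmap c (\<sigma> s)) has_vector_derivative X c (\<sigma> s)) (at s within {s0-e..s0+e})"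
          by (rule has_vector_derivative_at_within[OF integral_curveD(4)[OF 1 _ c(1)]]) (use in'[OF s] Uin in blast)+
        show "((\<lambda>s. cmap c (\<tau> s)) has_vector_derivative X c (\<tau> s)) (at s within {s0-e..s0+e})"
          by (rule has_vector_derivative_at_within[OF integral_curveD(4)[OF 2 _ c(1)]]) (use in'[OF s] Uin in blast)+
      qed
      show "norm (X c (\<sigma> s) - X c (\<tau> s)) \<le> L * norm (?h s) + 0"
        using L(2)[of "cmap c (\<sigma> s)" "cmap c (\<tau> s)"] in'[OF s] Uin c(1) by (metis add_0_right cinv_cmap)
    qed (use e L s in auto)
    then have "cmap c (\<sigma> s) = cmap c (\<tau> s)" using eq by simp
    then show ?thesis using in'[OF s] Uin c(1) by (metis cinv_cmap)
  qed
  note eqs = this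
  show ?thesis
  proof (rule that[OF e(1)])
    fix s assume "\<bar>s - s0\<bar> < e"
    then have s: "s \<in> {s0-e..s0+e}" by (auto simp: abs_less_iff)
    show "s \<in> I \<and> s \<in> J \<and> \<sigma> s = \<tau> s" using eqs[OF s] in'(1)[OF s] by blast
  qed
qed

text \<open>The times of agreement form an open set by local uniqueness, the times of disagreement
  by the Hausdorff property, and the common interval is connected.\<close>

lemma integral_curve_unique:
  assumes 1: "integral_curve I \<sigma>" and 2: "integral_curve J \<tau>" and s0: "s0 \<in> I" "s0 \<in> J" and eq: "\<sigma> s0 = \<tau> s0"
    and s: "s \<in> I" "s \<in> J"
  shows "\<sigma> s = \<tau> s"
proof (rule ccontr)
  assume ne: "\<sigma> s \<noteq> \<tau> s"
  define E where "E = {s \<in> I \<inter> J. \<sigma> s = \<tau> s}"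
  define D where "D = {s \<in> I \<inter> J. \<sigma> s \<noteq> \<tau> s}"
  have con: "connected (I \<inter> J)"
    using integral_curveD(2)[OF 1] integral_curveD(2)[OF 2] is_interval_Int is_interval_connected by blast
  have "open E"
    unfolding open_dist
  proof
    fix x assume "x \<in> E"
    then obtain e where "e > 0" "\<And>s. \<bar>s - x\<bar> < e \<Longrightarrow> s \<in> I \<and> s \<in> J \<and> \<sigma> s = \<tau> s"
      using integral_curve_local_unique[OF 1 2, of x] unfolding E_def by blast
    then show "\<exists>e>0. \<forall>y. dist y x < e \<longrightarrow> y \<in> E" by (auto simp: E_def dist_real_def)
  qed
  moreover have "open D"
    unfolding open_dist
  proof
    fix x assume x: "x \<in> D"
    then obtain U V where UV: "open U" "open V" "\<sigma> x \<in> U" "\<tau> x \<in> V" "U \<inter> V = {}"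
      using hausdorff[of "\<sigma> x" "\<tau> x"] by (auto simp: D_def)
    obtain e1 where e1: "e1 > 0" "\<And>s. \<bar>s - x\<bar> < e1 \<Longrightarrow> \<sigma> s \<in> U"
      using isCont_real_nbhd[OF integral_curve_isCont[OF 1] UV(1,3)] x by (auto simp: D_def)
    obtain e2 where e2: "e2 > 0" "\<And>s. \<bar>s - x\<bar> < e2 \<Longrightarrow> \<tau> s \<in> V"
      using isCont_real_nbhd[OF integral_curve_isCont[OF 2] UV(2,4)] x by (auto simp: D_def)
    obtain e3 where e3: "e3 > 0" "\<And>s. \<bar>s - x\<bar> < e3 \<Longrightarrow> s \<in> I \<inter> J"
      using isCont_real_nbhd[where f="\<lambda>x. x" and s=x and U="I \<inter> J", OF continuous_ident] integral_curveD(1)[OF 1] integral_curveD(1)[OF 2] x by (auto simp: D_def)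
    show "\<exists>e>0. \<forall>y. dist y x < e \<longrightarrow> y \<in> D"
    proof (intro exI[of _ "min e1 (min e2 e3)"] conjI allI impI)
      fix y assume "dist y x < min e1 (min e2 e3)"
      then have "\<sigma> y \<in> U" "\<tau> y \<in> V" "y \<in> I \<inter> J" using e1(2) e2(2) e3(2) by (auto simp: dist_real_def)
      then show "y \<in> D" using UV(5) by (auto simp: D_def)
    qed (use e1 e2 e3 in auto)
  qed
  moreover have "s0 \<in> E" "s \<in> D" using s0 s eq ne by (auto simp: E_def D_def)
  moreover have "E \<inter> D \<inter> (I \<inter> J) = {}" "I \<inter> J \<subseteq> E \<union> D" by (auto simp: E_def D_def)
  ultimately show False using connectedD[OF con, of E D] s0 s by blast
qed

lemma integral_curve_union:
  assumes 1: "integral_curve I \<sigma>" and 2: "integral_curve J \<tau>" and s0: "s0 \<in> I" "s0 \<in> J" and eq: "\<sigma> s0 = \<tau> s0"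
  shows "integral_curve (I \<union> J) (\<lambda>s. if s \<in> I then \<sigma> s else \<tau> s)"
proof -
  let ?u = "\<lambda>s. if s \<in> I then \<sigma> s else \<tau> s"
  have uI: "?u s = \<sigma> s" if "s \<in> I" for s using that by simp
  have uJ: "?u s = \<tau> s" if "s \<in> J" for s using integral_curve_unique[OF 1 2 s0 eq _ that] by simp
  have oI: "open I" and oJ: "open J" using integral_curveD(1)[OF 1] integral_curveD(1)[OF 2] .
  have "continuous_on I ?u" "continuous_on J ?u"
    using continuous_on_eq[OF integral_curveD(3)[OF 1], of ?u] continuous_on_eq[OF integral_curveD(3)[OF 2], of ?u] uI uJ by metis+
  then have cont: "continuous_on (I \<union> J) ?u" by (rule continuous_on_open_Un[OF oI oJ])
  have "connected (I \<union> J)"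
    using integral_curveD(2)[OF 1] integral_curveD(2)[OF 2] s0 by (intro connected_Un) (auto simp: is_interval_connected)
  then have int: "is_interval (I \<union> J)" by (simp add: is_interval_connected_1)
  have "((\<lambda>s. cmap c (?u s)) has_vector_derivative X c (?u s)) (at s)"
    if s: "s \<in> I \<union> J" and c: "c \<in> A" "?u s \<in> cdom c" for s c
  proof (cases "s \<in> I")
    case True
    show ?thesis
      by (rule has_vector_derivative_transform_within_open[OF _ oI True, of "\<lambda>s. cmap c (\<sigma> s)"])
        (use integral_curveD(4)[OF 1 True c(1)] c True in auto)
  next
    case False
    then have s: "s \<in> J" using s by blast
    show ?thesis
      unfolding uJ[OF s]
    proof (rule has_vector_derivative_transform_within_open[OF _ oJ s, of "\<lambda>s. cmap c (\<tau> s)"])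
      show "((\<lambda>s. cmap c (\<tau> s)) has_vector_derivative X c (\<tau> s)) (at s)"
        using integral_curveD(4)[OF 2 s c(1)] c(2) uJ[OF s] by simp
      show "cmap c (\<tau> y) = cmap c (?u y)" if "y \<in> J" for y using uJ[OF that] by simp
    qed
  qed
  then show ?thesis unfolding integral_curve_def using oI oJ cont int by blast
qed

lemma integral_curve_shift:
  assumes "integral_curve I \<sigma>"
  shows "integral_curve {s. s + r \<in> I} (\<lambda>s. \<sigma> (s + r))"
  unfolding integral_curve_def
proof (intro conjI ballI impI)
  have eq: "{s. s + r \<in> I} = (\<lambda>s. s + r) -` I" by auto
  show "open {s. s + r \<in> I}"
    unfolding eq by (rule open_vimage[OF integral_curveD(1)[OF assms]]) (intro continuous_intros)
  show "is_interval {s. s + r \<in> I}"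
    using integral_curveD(2)[OF assms] unfolding is_interval_1 by (metis add_le_cancel_right mem_Collect_eq)
  show "continuous_on {s. s + r \<in> I} (\<lambda>s. \<sigma> (s + r))"
    by (rule continuous_on_compose2[OF integral_curveD(3)[OF assms]]) (auto intro!: continuous_intros)
  fix s c assume s: "s \<in> {s. s + r \<in> I}" and c: "c \<in> A" "\<sigma> (s + r) \<in> cdom c"
  have "((\<lambda>s. s + r) has_vector_derivative 1) (at s)" by (auto intro!: derivative_eq_intros)
  from vector_diff_chain_at[OF this integral_curveD(4)[OF assms _ c]] s
  show "((\<lambda>s. cmap c (\<sigma> (s + r))) has_vector_derivative X c (\<sigma> (s + r))) (at s)"
    by (simp add: comp_def)
qed

lemma integral_curve_t:
  assumes \<sigma>: "integral_curve I \<sigma>" and "s0 \<in> I" "s \<in> I"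
  shows "t (\<sigma> s) = t (\<sigma> s0) + (s - s0)"
proof -
  have "((\<lambda>s. t (\<sigma> s) - s) has_vector_derivative 0) (at s within I)" if s: "s \<in> I" for s
  proof -
    obtain c where c: "c \<in> A" "\<sigma> s \<in> cdom c" by (rule chart_at)
    have "((\<lambda>s. t (cinv c (cmap c (\<sigma> s)))) has_derivative (\<lambda>h. dt c (\<sigma> s) (h *\<^sub>R X c (\<sigma> s)))) (at s within I)"
      by (rule has_derivative_compose[of "\<lambda>s. cmap c (\<sigma> s)" _ _ _ "\<lambda>y. t (cinv c y)"])
        (use integral_curveD(4)[OF \<sigma> s c] dt_has_derivative[OF c]
          in \<open>auto simp: has_vector_derivative_def intro: has_derivative_at_withinI\<close>)
    moreover have "(\<lambda>h. dt c (\<sigma> s) (h *\<^sub>R X c (\<sigma> s))) = (\<lambda>h. h *\<^sub>R 1)"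
      using dt_linear[OF c] dt_X[OF c] by (auto simp: linear_scale)
    ultimately have "((\<lambda>s. t (cinv c (cmap c (\<sigma> s)))) has_vector_derivative 1) (at s within I)"
      unfolding has_vector_derivative_def by simp
    moreover have "\<forall>\<^sub>F x in at s within I. \<sigma> x \<in> cdom c"
      using integral_curveD(3)[OF \<sigma>] s open_cdom[OF c(1)] c(2)
      unfolding continuous_on_def by (metis topological_tendstoD)
    then have "\<forall>\<^sub>F x in at s within I. t (cinv c (cmap c (\<sigma> x))) = t (\<sigma> x)"
      by eventually_elim (use c in simp)
    ultimately have "((\<lambda>s. t (\<sigma> s)) has_vector_derivative 1) (at s within I)"
      unfolding has_vector_derivative_def by (rule has_derivative_transform_eventually) (use c s in auto)
    from has_vector_derivative_diff[OF this has_vector_derivative_id] show ?thesis by simp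
  qed
  then obtain k where "\<And>s. s \<in> I \<Longrightarrow> t (\<sigma> s) - s = k"
    using has_vector_derivative_zero_constant[of I "\<lambda>s. t (\<sigma> s) - s"] integral_curveD(2)[OF \<sigma>] is_interval_convex by blast
  from this[OF assms(2)] this[OF assms(3)] show ?thesis by simp
qed

text \<open>The flow of \<open>X\<close> in a chart around \<open>p\<close>. The time
  \<open>\<epsilon>\<close> is common to all starting points in the ball; both the extension of
  integral curves and the propagation of differentiability depend on this uniformity.\<close>

lemma flow_box:
  obtains c \<epsilon> r \<Phi> where "c \<in> A" "p \<in> cdom c" "\<epsilon> > 0" "r > 0" "ball (cmap c p) r \<subseteq> cimg c"
    "\<And>y. y \<in> ball (cmap c p) r \<Longrightarrow> \<Phi> 0 y = y"
    "\<And>\<tau> y. \<tau> \<in> {-\<epsilon><..<\<epsilon>} \<Longrightarrow> y \<in> ball (cmap c p) r \<Longrightarrow> \<Phi> \<tau> y \<in> cimg c"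
    "\<And>y. y \<in> ball (cmap c p) r \<Longrightarrow> integral_curve {-\<epsilon><..<\<epsilon>} (\<lambda>\<tau>. cinv c (\<Phi> \<tau> y))"
    "Ck_on 1 ({-\<epsilon><..<\<epsilon>} \<times> ball (cmap c p) r) (\<lambda>(\<tau>, y). \<Phi> \<tau> y)"
    "\<And>w y. y \<in> ball (cmap c p) r \<Longrightarrow>
       ((\<lambda>\<tau>. frechet_derivative (\<Phi> \<tau>) (at y) w) has_vector_derivative dX c (cinv c y) w) (at 0)"
proof -
  obtain c where c: "c \<in> A" "p \<in> cdom c" by (rule chart_at)
  have pc: "cmap c p \<in> cimg c" using c by simp
  show ?thesis
  proof (rule local_flow[OF open_cimg[OF c(1)] X_Ck[OF c(1)] pc])
    fix \<epsilon> r :: real and \<Phi> :: "real \<Rightarrow> 'b \<Rightarrow> 'b"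
    assume f: "\<epsilon> > 0" "r > 0" "\<And>y. y \<in> ball (cmap c p) r \<Longrightarrow> \<Phi> 0 y = y"
    "\<And>\<tau> y. \<tau> \<in> {-\<epsilon><..<\<epsilon>} \<Longrightarrow> y \<in> ball (cmap c p) r \<Longrightarrow> \<Phi> \<tau> y \<in> cimg c"
    "\<And>\<tau> y. \<tau> \<in> {-\<epsilon><..<\<epsilon>} \<Longrightarrow> y \<in> ball (cmap c p) r \<Longrightarrow> ((\<lambda>\<tau>. \<Phi> \<tau> y) has_vector_derivative X c (cinv c (\<Phi> \<tau> y))) (at \<tau>)"
    "Ck_on 1 ({-\<epsilon><..<\<epsilon>} \<times> ball (cmap c p) r) (\<lambda>(\<tau>, y). \<Phi> \<tau> y)"
    "\<And>w y. y \<in> ball (cmap c p) r \<Longrightarrow> ((\<lambda>\<tau>. frechet_derivative (\<Phi> \<tau>) (at y) w) has_vector_derivative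
        frechet_derivative (\<lambda>y. X c (cinv c y)) (at y) w) (at 0)"
  obtain r1 where r1: "r1 > 0" "ball (cmap c p) r1 \<subseteq> cimg c" using open_cimg[OF c(1)] pc openE by blast
  define r2 where "r2 = min r r1"
  have r2: "r2 > 0" "ball (cmap c p) r2 \<subseteq> ball (cmap c p) r" "ball (cmap c p) r2 \<subseteq> cimg c"
    using f(2) r1 by (auto simp: r2_def)
  show ?thesis
  proof (rule that[of c \<epsilon> r2 \<Phi>])
    show "integral_curve {-\<epsilon><..<\<epsilon>} (\<lambda>\<tau>. cinv c (\<Phi> \<tau> y))" if y: "y \<in> ball (cmap c p) r2" for y
    proof (rule integral_curve_chartI[OF c(1)])
      fix s assume s: "s \<in> {-\<epsilon><..<\<epsilon>}"
      have y': "y \<in> ball (cmap c p) r" using r2(2) y by blast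
      show "cinv c (\<Phi> s y) \<in> cdom c" using f(4)[OF s y'] c(1) by simp
      show "((\<lambda>s. cmap c (cinv c (\<Phi> s y))) has_vector_derivative X c (cinv c (\<Phi> s y))) (at s)"
        by (rule has_vector_derivative_transform_within_open[OF f(5)[OF s y'] _ s])
          (use f(4)[OF _ y'] c(1) in auto)
    qed (auto simp: is_interval_oo)
    show "Ck_on 1 ({-\<epsilon><..<\<epsilon>} \<times> ball (cmap c p) r2) (\<lambda>(\<tau>, y). \<Phi> \<tau> y)"
      by (rule Ck_on_subset[OF f(6)]) (use r2(2) in auto)
    show "((\<lambda>\<tau>. frechet_derivative (\<Phi> \<tau>) (at y) w) has_vector_derivative dX c (cinv c y) w) (at 0)"
      if y: "y \<in> ball (cmap c p) r2" for w y
    proof -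
      have "y \<in> ball (cmap c p) r" "cmap c (cinv c y) = y" using r2(2,3) y c(1) cmap_cinv by auto
      then show ?thesis using f(7)[of y w] by (simp add: dX_def)
    qed
  qed (use c f r2 in \<open>auto simp del: mem_ball\<close>)
  qed
qed

lemma integral_curve_causal:
  assumes \<sigma>: "integral_curve I \<sigma>" and ne: "I \<noteq> {}"
  shows "causal_curve A g T I \<sigma>"
proof -
  have C1: "C1_curve_on A \<sigma> a b" if "a < b" "{a..b} \<subseteq> I" for a b
  proof (rule C1_curve_onI[OF that(1)])
    show cont: "continuous_on {a..b} \<sigma>" using integral_curveD(3)[OF \<sigma>] that(2) by (rule continuous_on_subset)
    fix s0 c assume s0: "s0 \<in> {a..b}" "c \<in> A" "\<sigma> s0 \<in> cdom c"
    define U where "U = I \<inter> \<sigma> -` cdom c"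
    have U: "open U" unfolding U_def
      by (rule continuous_open_preimage[OF integral_curveD(3,1)[OF \<sigma>] open_cdom[OF s0(2)]])
    have cU: "continuous_on U (\<lambda>s. cmap c (\<sigma> s))"
      by (rule continuous_on_compose2[OF cmap_continuous[OF s0(2)] continuous_on_subset[OF integral_curveD(3)[OF \<sigma>]]])
        (auto simp: U_def)
    have "continuous_on U (\<lambda>s. X c (cinv c (cmap c (\<sigma> s))))"
      by (rule continuous_on_compose2[OF Ck_on_imp_continuous[OF X_Ck[OF s0(2), of 0]] cU]) (auto simp: U_def)
    then have cX: "continuous_on U (\<lambda>s. X c (\<sigma> s))"
      by (rule continuous_on_eq) (use s0(2) in \<open>auto simp: U_def\<close>)
    show "\<exists>U D. open U \<and> s0 \<in> U \<and> (\<forall>s\<in>{a..b} \<inter> U. ((\<lambda>s. cmap c (\<sigma> s)) has_vector_derivative D s) (at s within {a..b}))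
        \<and> continuous_on ({a..b} \<inter> U) D"
    proof (intro exI[of _ U] exI[of _ "\<lambda>s. X c (\<sigma> s)"] conjI ballI)
      show "s0 \<in> U" using s0 that by (auto simp: U_def)
      show "((\<lambda>s. cmap c (\<sigma> s)) has_vector_derivative X c (\<sigma> s)) (at s within {a..b})" if "s \<in> {a..b} \<inter> U" for s
        using integral_curveD(4)[OF \<sigma> _ s0(2)] that by (auto simp: U_def intro: has_vector_derivative_at_within)
      show "continuous_on ({a..b} \<inter> U) (\<lambda>s. X c (\<sigma> s))" using cX by (rule continuous_on_subset) auto
    qed fact
  qed
  have vel: "velocity \<sigma> {a..b} c s = X c (\<sigma> s)"
    if "a < b" "{a..b} \<subseteq> I" "s \<in> {a..b}" "c \<in> A" "\<sigma> s \<in> cdom c" for a b c s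
    by (rule velocity_eq[OF that(1,3)]) (use has_vector_derivative_at_within[OF integral_curveD(4)[OF \<sigma> _ that(4,5)]] that(2,3) in blast)
  have caus: "causal (g c x) (X c x)" "future_directed g T c x (X c x)" if "c \<in> A" "x \<in> cdom c" for c x
  proof -
    note l = lapse_neg[OF that] and b = metric_bilinear[OF that]
    have "X c x \<noteq> 0" using dt_X[OF that] linear_0[OF dt_linear[OF that]] by auto
    moreover have "g c x (X c x) (X c x) \<le> 0"
      using l by (simp add: X_def bilinear_simps[OF b] lapse_def[symmetric] divide_nonneg_neg)
    ultimately show "causal (g c x) (X c x)" by (simp add: causal_def)
    show "future_directed g T c x (X c x)"
      using l N_past[OF that] by (simp add: future_directed_def X_def bilinear_simps[OF b] divide_pos_neg)
  qed
  obtain a where a: "a \<in> I" using ne by blast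
  then obtain e where e: "e > 0" "ball a e \<subseteq> I" using integral_curveD(1)[OF \<sigma>] openE by blast
  have "a + e/2 \<in> I" using e by (intro subsetD[OF e(2)]) (auto simp: dist_real_def)
  then have "\<exists>a\<in>I. \<exists>b\<in>I. a < b" using a e(1) by (intro bexI[of _ a] bexI[of _ "a + e/2"]) auto
  then have "piecewise_C1_curve A I {} \<sigma>"
    unfolding piecewise_C1_curve_def piece_def using integral_curveD(2,3)[OF \<sigma>] C1 by auto
  then show ?thesis
    unfolding causal_curve_def using vel caus by (intro exI[of _ "{}"]) (auto simp: piece_def)
qed

section \<open>The maximal flow and its completeness\<close>

definition max_dom :: "'a \<Rightarrow> real set" where
  "max_dom x = \<Union>{I. \<exists>\<sigma>. integral_curve I \<sigma> \<and> 0 \<in> I \<and> \<sigma> 0 = x}"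

text \<open>The choice is harmless on \<open>max_dom x\<close>: by uniqueness all integral curves
  that start at \<open>x\<close> at time 0 have the same value at \<open>s\<close>.\<close>

definition F :: "real \<Rightarrow> 'a \<Rightarrow> 'a" where
  "F s x = (SOME y. \<exists>I \<sigma>. integral_curve I \<sigma> \<and> 0 \<in> I \<and> s \<in> I \<and> \<sigma> 0 = x \<and> y = \<sigma> s)"

lemma F_eq:
  assumes "integral_curve I \<sigma>" "0 \<in> I" "s \<in> I" "\<sigma> 0 = x"
  shows "F s x = \<sigma> s"
proof -
  have "\<exists>I \<sigma>. integral_curve I \<sigma> \<and> 0 \<in> I \<and> s \<in> I \<and> \<sigma> 0 = x \<and> F s x = \<sigma> s"
    unfolding F_def by (rule someI_ex) (use assms in blast)
  then show ?thesis using integral_curve_unique[OF _ assms(1) _ assms(2)] assms(3,4) by metis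
qed

lemma max_dom_0: "0 \<in> max_dom x" and F_0: "F 0 x = x"
proof -
  obtain c \<epsilon> r \<Phi> where f: "c \<in> A" "x \<in> cdom c" "\<epsilon> > 0" "r > 0" "ball (cmap c x) r \<subseteq> cimg c"
    "\<And>y. y \<in> ball (cmap c x) r \<Longrightarrow> \<Phi> 0 y = y"
    "\<And>y. y \<in> ball (cmap c x) r \<Longrightarrow> integral_curve {-\<epsilon><..<\<epsilon>} (\<lambda>\<tau>. cinv c (\<Phi> \<tau> y))"
    using flow_box[of x] by metis
  have y: "cmap c x \<in> ball (cmap c x) r" using f(4) by simp
  have s: "cinv c (\<Phi> 0 (cmap c x)) = x" using f(6)[OF y] f(1,2) by simp
  note i = f(7)[OF y]
  show "0 \<in> max_dom x" unfolding max_dom_def using i s f(3) by fastforce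
  show "F 0 x = x" using F_eq[OF i _ _ s, of 0] s f(3) by simp
qed

lemma F_integral_curve: "integral_curve (max_dom x) (\<lambda>s. F s x)"
proof -
  have ex: "\<exists>I \<sigma>. integral_curve I \<sigma> \<and> 0 \<in> I \<and> s \<in> I \<and> \<sigma> 0 = x \<and> I \<subseteq> max_dom x \<and> (\<forall>s\<in>I. F s x = \<sigma> s)"
    if s: "s \<in> max_dom x" for s
  proof -
    obtain I \<sigma> where i: "integral_curve I \<sigma>" "0 \<in> I" "s \<in> I" "\<sigma> 0 = x" using s unfolding max_dom_def by blast
    moreover have "I \<subseteq> max_dom x" using i unfolding max_dom_def by blast
    ultimately show ?thesis using F_eq by blast
  qed
  have o: "open (max_dom x)" unfolding max_dom_def by (rule open_Union) (auto dest: integral_curveD(1))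
  have "connected (max_dom x)" unfolding max_dom_def
    by (rule connected_Union) (auto simp: is_interval_connected dest: integral_curveD(2))
  then have int: "is_interval (max_dom x)" by (simp add: is_interval_connected_1)
  have "continuous_on (max_dom x) (\<lambda>s. F s x)"
  proof (rule continuous_on_local)
    fix s assume "s \<in> max_dom x"
    then obtain I \<sigma> where i: "integral_curve I \<sigma>" "s \<in> I" "\<forall>s\<in>I. F s x = \<sigma> s" using ex by blast
    have "continuous_on I (\<lambda>s. F s x)" by (rule continuous_on_eq[OF integral_curveD(3)[OF i(1)]]) (use i in auto)
    then show "\<exists>U. open U \<and> s \<in> U \<and> continuous_on (max_dom x \<inter> U) (\<lambda>s. F s x)"
      using i(2) integral_curveD(1)[OF i(1)] continuous_on_subset[of I "\<lambda>s. F s x" "max_dom x \<inter> I"] by blast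
  qed
  moreover have "((\<lambda>s. cmap c (F s x)) has_vector_derivative X c (F s x)) (at s)"
    if s: "s \<in> max_dom x" and c: "c \<in> A" "F s x \<in> cdom c" for s c
  proof -
    obtain I \<sigma> where i: "integral_curve I \<sigma>" "s \<in> I" "\<forall>s\<in>I. F s x = \<sigma> s" using ex[OF s] by blast
    show ?thesis
      by (rule has_vector_derivative_transform_within_open[OF _ integral_curveD(1)[OF i(1)] i(2), of "\<lambda>s. cmap c (\<sigma> s)"])
        (use integral_curveD(4)[OF i(1,2) c(1)] i c in auto)
  qed
  ultimately show ?thesis unfolding integral_curve_def using o int by blast
qed

lemma max_dom_maximal:
  assumes "integral_curve J \<tau>" "s0 \<in> max_dom x" "s0 \<in> J" "\<tau> s0 = F s0 x"
  shows "J \<subseteq> max_dom x"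
proof -
  have "integral_curve (max_dom x \<union> J) (\<lambda>s. if s \<in> max_dom x then F s x else \<tau> s)"
    by (rule integral_curve_union[OF F_integral_curve assms(1-3)]) (use assms in simp)
  moreover have "(if 0 \<in> max_dom x then F 0 x else \<tau> 0) = x" using max_dom_0 F_0 by simp
  ultimately have "max_dom x \<union> J \<in> {I. \<exists>\<sigma>. integral_curve I \<sigma> \<and> 0 \<in> I \<and> \<sigma> 0 = x}"
    using max_dom_0 by blast
  then have "max_dom x \<union> J \<subseteq> \<Union>{I. \<exists>\<sigma>. integral_curve I \<sigma> \<and> 0 \<in> I \<and> \<sigma> 0 = x}" by (rule Union_upper)
  then show ?thesis unfolding max_dom_def[symmetric] by blast
qed

text \<open>Near a would-be end point the flow box runs for a time independent of the starting point,
  so the parameter, which is \<open>t\<close> up to a constant, leaves every small neighbourhood of it.\<close>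

lemma no_endpoint:
  "\<exists>U \<delta>. open U \<and> p \<in> U \<and> \<delta> > 0 \<and> (\<forall>x s0. s0 \<in> max_dom x \<and> F s0 x \<in> U \<longrightarrow>
     s0 + \<delta> \<in> max_dom x \<and> F (s0 + \<delta>) x \<notin> U \<and> s0 - \<delta> \<in> max_dom x \<and> F (s0 - \<delta>) x \<notin> U)"
proof -
  obtain c \<epsilon> r \<Phi> where f: "c \<in> A" "p \<in> cdom c" "\<epsilon> > 0" "r > 0" "ball (cmap c p) r \<subseteq> cimg c"
    "\<And>y. y \<in> ball (cmap c p) r \<Longrightarrow> \<Phi> 0 y = y"
    "\<And>y. y \<in> ball (cmap c p) r \<Longrightarrow> integral_curve {-\<epsilon><..<\<epsilon>} (\<lambda>\<tau>. cinv c (\<Phi> \<tau> y))"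
    using flow_box[of p] by metis
  \<comment> \<open>The open window for \<open>t\<close> has width \<open>\<epsilon>/2\<close>,
    exactly the change of \<open>t\<close> in time \<open>\<epsilon>/2\<close>; a curve that is in
    \<open>U\<close> is therefore outside after this time, in either direction.\<close>
  define U where "U = cinv c ` ball (cmap c p) r \<inter> t -` {t p - \<epsilon>/4<..<t p + \<epsilon>/4}"
  have oU: "open U" unfolding U_def
    by (intro open_Int open_cinv_image[OF f(1) open_ball f(5)] open_vimage[OF _ t_continuous]) auto
  have pU: "p \<in> U" unfolding U_def using f by (auto intro!: image_eqI[of _ _ "cmap c p"])
  have main: "s1 \<in> max_dom x \<and> F s1 x \<notin> U" if s0: "s0 \<in> max_dom x" "F s0 x \<in> U" and s1: "\<bar>s1 - s0\<bar> = \<epsilon>/2" for x s0 s1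
  proof -
    obtain y where y: "F s0 x = cinv c y" "y \<in> ball (cmap c p) r" using s0(2) unfolding U_def by blast
    let ?J = "{s. s + (- s0) \<in> {-\<epsilon><..<\<epsilon>}}"
    have J: "integral_curve ?J (\<lambda>s. cinv c (\<Phi> (s + (- s0)) y))" by (rule integral_curve_shift[OF f(7)[OF y(2)]])
    have "?J \<subseteq> max_dom x"
      by (rule max_dom_maximal[OF J s0(1)]) (use f(3) f(6)[OF y(2)] y(1) in auto)
    moreover have "\<bar>s1 - s0\<bar> < \<epsilon>" using s1 f(3) by linarith
    then have "s1 \<in> ?J" by (auto simp: abs_less_iff)
    ultimately have s1': "s1 \<in> max_dom x" by blast
    have "t (F s1 x) = t (F s0 x) + (s1 - s0)" by (rule integral_curve_t[OF F_integral_curve s0(1) s1'])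
    moreover have "t (F s0 x) \<in> {t p - \<epsilon>/4<..<t p + \<epsilon>/4}" using s0(2) by (simp add: U_def)
    ultimately have "F s1 x \<notin> U" using s1 unfolding U_def by (auto simp: abs_if split: if_splits)
    then show ?thesis using s1' by blast
  qed
  show ?thesis
  proof (intro exI conjI allI impI)
    show "open U" "p \<in> U" "\<epsilon>/2 > 0" using oU pU f(3) by auto
    fix x s0 assume "s0 \<in> max_dom x \<and> F s0 x \<in> U"
    then show "s0 + \<epsilon>/2 \<in> max_dom x" "F (s0 + \<epsilon>/2) x \<notin> U" "s0 - \<epsilon>/2 \<in> max_dom x" "F (s0 - \<epsilon>/2) x \<notin> U"
      using main[of s0 x "s0 + \<epsilon>/2"] main[of s0 x "s0 - \<epsilon>/2"] f(3) by auto
  qed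
qed

text \<open>Along an integral curve \<open>t\<close> is the parameter up to a constant. Once end
  points are excluded, the Cauchy condition makes \<open>t\<close> onto along the maximal curve, and
  hence every parameter value is attained.\<close>

lemma max_dom_UNIV: "max_dom x = UNIV"
proof -
  note F = F_integral_curve[of x]
  have "\<not> right_endpoint (max_dom x) (\<lambda>s. F s x) p" for p
  proof
    assume r: "right_endpoint (max_dom x) (\<lambda>s. F s x) p"
    obtain U \<delta> where U: "open U" "p \<in> U" "\<delta> > 0"
      "\<And>x s0. s0 \<in> max_dom x \<Longrightarrow> F s0 x \<in> U \<Longrightarrow> s0 + \<delta> \<in> max_dom x \<and> F (s0 + \<delta>) x \<notin> U
       \<and> s0 - \<delta> \<in> max_dom x \<and> F (s0 - \<delta>) x \<notin> U" using no_endpoint[of p] by metis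
    obtain s0 where "s0 \<in> max_dom x" "\<forall>s\<in>max_dom x. s0 \<le> s \<longrightarrow> F s x \<in> U"
      using r U(1,2) unfolding right_endpoint_def by blast
    then show False using U(3) U(4)[of s0 x] by force
  qed
  moreover have "\<not> left_endpoint (max_dom x) (\<lambda>s. F s x) p" for p
  proof
    assume r: "left_endpoint (max_dom x) (\<lambda>s. F s x) p"
    obtain U \<delta> where U: "open U" "p \<in> U" "\<delta> > 0"
      "\<And>x s0. s0 \<in> max_dom x \<Longrightarrow> F s0 x \<in> U \<Longrightarrow> s0 + \<delta> \<in> max_dom x \<and> F (s0 + \<delta>) x \<notin> U
       \<and> s0 - \<delta> \<in> max_dom x \<and> F (s0 - \<delta>) x \<notin> U" using no_endpoint[of p] by metis
    obtain s0 where "s0 \<in> max_dom x" "\<forall>s\<in>max_dom x. s \<le> s0 \<longrightarrow> F s x \<in> U"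
      using r U(1,2) unfolding left_endpoint_def by blast
    then show False using U(3) U(4)[of s0 x] by force
  qed
  ultimately have "inextendible (max_dom x) (\<lambda>s. F s x)" by (simp add: inextendible_def)
  moreover have "causal_curve A g T (max_dom x) (\<lambda>s. F s x)"
    using integral_curve_causal[OF F] max_dom_0 by blast
  ultimately have surj: "(t \<circ> (\<lambda>s. F s x)) ` max_dom x = UNIV" by (intro t_cauchy)
  have "s \<in> max_dom x" for s
  proof -
    have "t x + s \<in> (t \<circ> (\<lambda>s. F s x)) ` max_dom x" unfolding surj by simp
    then obtain s' where s': "s' \<in> max_dom x" "t (F s' x) = t x + s" by auto
    then show ?thesis using integral_curve_t[OF F max_dom_0 s'(1)] F_0 by simp
  qed
  then show ?thesis by blast
qed

lemma F_curve: "integral_curve UNIV (\<lambda>s. F s x)"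
  using F_integral_curve max_dom_UNIV by simp

lemma F_unique: "integral_curve J \<sigma> \<Longrightarrow> s0 \<in> J \<Longrightarrow> \<sigma> s0 = F s0 x \<Longrightarrow> s \<in> J \<Longrightarrow> F s x = \<sigma> s"
  using integral_curve_unique[OF F_curve] by (metis UNIV_I)

lemma F_add: "F (s + r) x = F s (F r x)"
proof -
  have "integral_curve {s. s + r \<in> UNIV} (\<lambda>s. F (s + r) x)" by (rule integral_curve_shift[OF F_curve])
  then show ?thesis using F_unique[of UNIV "\<lambda>s. F (s + r) x" 0 "F r x" s] F_0 by simp
qed

lemma t_F: "t (F s x) = t x + s"
  using integral_curve_t[OF F_curve, of 0 s x] F_0 by simp

lemma range_t: "range t = UNIV"
proof -
  \<comment> \<open>The manifold is a whole type and hence nonempty; one flow line already meets all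
    level sets.\<close>
  obtain x :: 'a where True by blast
  have "a = t (F (a - t x) x)" for a by (simp add: t_F)
  then show ?thesis by blast
qed

section \<open>Differentiability of the flow in time and starting point\<close>

lemma F_box_eq:
  assumes "c \<in> A" "\<epsilon> > 0" "\<Phi> 0 y = y" "\<tau> \<in> {-\<epsilon><..<\<epsilon>}" "integral_curve {-\<epsilon><..<\<epsilon>} (\<lambda>\<tau>. cinv c (\<Phi> \<tau> y))"
  shows "F \<tau> (cinv c y) = cinv c (\<Phi> \<tau> y)"
  by (rule F_unique[OF assms(5), of 0]) (use assms F_0 in auto)

text \<open>By the group law \<open>F s\<close> is \<open>F (s - \<tau>1)\<close> after
  \<open>F \<tau>1\<close>, and for times near \<open>\<tau>\<close> the second factor lands in one
  flow box around \<open>F \<tau> (cinv c y0)\<close>. So differentiability at one nearby time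
  spreads to all of them, jointly in time and point, with a radius depending on
  \<open>\<tau>\<close> alone.\<close>

lemma flow_C1_step:
  assumes c: "c \<in> A" and y0: "y0 \<in> cimg c"
  obtains e where "e > 0"
    "\<And>\<tau>1 \<tau>2 V. \<bar>\<tau>1 - \<tau>\<bar> < e \<Longrightarrow> \<bar>\<tau>2 - \<tau>\<bar> < e \<Longrightarrow> y0 \<in> V \<Longrightarrow> C1map A V (\<lambda>y. F \<tau>1 (cinv c y)) \<Longrightarrow>
      \<exists>W. (\<tau>2, y0) \<in> W \<and> C1map A W (\<lambda>z. F (fst z) (cinv c (snd z)))"
proof -
  define p where "p = F \<tau> (cinv c y0)"
  obtain d \<epsilon> r \<Phi> where f: "d \<in> A" "p \<in> cdom d" "\<epsilon> > 0" "r > 0" "ball (cmap d p) r \<subseteq> cimg d"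
    "\<And>y. y \<in> ball (cmap d p) r \<Longrightarrow> \<Phi> 0 y = y"
    "\<And>\<tau> y. \<tau> \<in> {-\<epsilon><..<\<epsilon>} \<Longrightarrow> y \<in> ball (cmap d p) r \<Longrightarrow> \<Phi> \<tau> y \<in> cimg d"
    "\<And>y. y \<in> ball (cmap d p) r \<Longrightarrow> integral_curve {-\<epsilon><..<\<epsilon>} (\<lambda>\<tau>. cinv d (\<Phi> \<tau> y))"
    "Ck_on 1 ({-\<epsilon><..<\<epsilon>} \<times> ball (cmap d p) r) (\<lambda>(\<tau>, y). \<Phi> \<tau> y)"
    using flow_box[of p] by metis
  let ?B = "{-\<epsilon><..<\<epsilon>} \<times> ball (cmap d p) r"
  have oB: "open ?B" by (intro open_Times) auto
  have box: "F \<tau> (cinv d y) = cinv d (\<Phi> \<tau> y)" if "\<tau> \<in> {-\<epsilon><..<\<epsilon>}" "y \<in> ball (cmap d p) r" for \<tau> y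
    by (rule F_box_eq[where \<Phi>=\<Phi>, OF f(1,3) f(6)[OF that(2)] that(1) f(8)[OF that(2)]])
  have CB: "C1map A ?B (\<lambda>z. F (fst z) (cinv d (snd z)))"
  proof (rule C1map_chartI[OF f(1) oB])
    show "F (fst z) (cinv d (snd z)) \<in> cdom d" if "z \<in> ?B" for z
      using box[of "fst z" "snd z"] f(7)[of "fst z" "snd z"] that f(1) by (auto simp: mem_Times_iff simp del: mem_ball)
    show "Ck_on 1 ?B (\<lambda>z. cmap d (F (fst z) (cinv d (snd z))))"
      by (rule Ck_on_eq[OF f(9) oB])
        (use box f(7) f(1) in \<open>auto simp: mem_Times_iff case_prod_beta simp del: mem_ball\<close>)
  qed
  define V where "V = cinv d ` ball (cmap d p) r"
  have oV: "open V" unfolding V_def by (rule open_cinv_image[OF f(1) open_ball f(5)])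
  have pV: "F \<tau> (cinv c y0) \<in> V"
    unfolding V_def p_def[symmetric] using f by (intro image_eqI[of _ _ "cmap d p"]) auto
  obtain e1 where e1: "e1 > 0" "\<And>s. \<bar>s - \<tau>\<bar> < e1 \<Longrightarrow> F s (cinv c y0) \<in> V"
    using isCont_real_nbhd[OF integral_curve_isCont[OF F_curve UNIV_I] oV pV] by blast
  show ?thesis
  \<comment> \<open>Both times lie within \<open>\<epsilon>/2\<close> of \<open>\<tau>\<close>, so
    they differ by less than the existence time \<open>\<epsilon>\<close> of the box.\<close>
  proof (rule that[of "min e1 (\<epsilon>/2)"])
    fix \<tau>1 \<tau>2 W assume \<tau>1: "\<bar>\<tau>1 - \<tau>\<bar> < min e1 (\<epsilon>/2)" and \<tau>2: "\<bar>\<tau>2 - \<tau>\<bar> < min e1 (\<epsilon>/2)"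
      and W: "y0 \<in> W" "C1map A W (\<lambda>y. F \<tau>1 (cinv c y))"
    let ?f = "\<lambda>y. F \<tau>1 (cinv c y)"
    define Y where "Y = (W \<inter> ?f -` V) \<inter> cimg c"
    have oY: "open Y" unfolding Y_def
      by (intro open_Int continuous_open_preimage[OF C1map_continuous[OF W(2)] C1map_open[OF W(2)] oV] open_cimg[OF c])
    have y0Y: "y0 \<in> Y" using W(1) e1(2)[of \<tau>1] \<tau>1 y0 by (simp add: Y_def)
    have Vd: "v \<in> cdom d \<and> cmap d v \<in> ball (cmap d p) r" if v: "v \<in> V" for v
    proof -
      obtain y where "v = cinv d y" "y \<in> ball (cmap d p) r" "y \<in> cimg d" using v f(5) unfolding V_def by blast
      then show ?thesis using f(1) by (metis cinv_in cmap_cinv)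
    qed
    let ?W = "{\<tau>1 - \<epsilon><..<\<tau>1 + \<epsilon>} \<times> Y"
    have oW: "open ?W" using oY by (intro open_Times) auto
    have k: "Ck_on 1 Y (\<lambda>y. cmap d (?f y))"
      by (rule Ck_on_subset[OF C1map_Ck[OF W(2) f(1)]]) (use Vd in \<open>auto simp: Y_def\<close>)
    have snd1: "Ck_on 1 ?W snd" "Ck_on 1 ?W fst"
      using Ck_on_bounded_linear[OF bounded_linear_snd oW Ck_on_id] Ck_on_bounded_linear[OF bounded_linear_fst oW Ck_on_id] by auto
    have k2: "Ck_on 1 ?W (\<lambda>z. cmap d (?f (snd z)))"
      by (rule C1_on_compose[OF oW k snd1(1)]) auto
    have h: "Ck_on 1 ?W (\<lambda>z. (fst z - \<tau>1, cmap d (?f (snd z))))"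
      by (intro Ck_on_Pair[OF oW] Ck_on_minus[OF oW] snd1 k2 Ck_on_const)
    have "C1map A ?W (\<lambda>z. F (fst (fst z - \<tau>1, cmap d (?f (snd z)))) (cinv d (snd (fst z - \<tau>1, cmap d (?f (snd z))))))"
      by (rule C1map_compose[OF CB oW h]) (use Vd in \<open>auto simp: Y_def simp del: mem_ball\<close>)
    then have CW: "C1map A ?W (\<lambda>z. F (fst z) (cinv c (snd z)))"
    proof (rule C1map_eq)
      fix z assume z: "z \<in> ?W"
      then have "?f (snd z) \<in> cdom d" using Vd by (auto simp: Y_def)
      then have "cinv d (cmap d (?f (snd z))) = ?f (snd z)" using f(1) by simp
      then show "F (fst (fst z - \<tau>1, cmap d (?f (snd z)))) (cinv d (snd (fst z - \<tau>1, cmap d (?f (snd z)))))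
        = F (fst z) (cinv c (snd z))"
        using F_add[of "fst z - \<tau>1" \<tau>1 "cinv c (snd z)"] by simp
    qed
    have "\<bar>\<tau>2 - \<tau>1\<bar> < \<epsilon>" using \<tau>1 \<tau>2 by linarith
    then have "(\<tau>2, y0) \<in> ?W" using y0Y by (auto simp: abs_less_iff)
    with CW show "\<exists>W. (\<tau>2, y0) \<in> W \<and> C1map A W (\<lambda>z. F (fst z) (cinv c (snd z)))"
      by (intro exI conjI)
  qed (use e1 f(3) in auto)
qed

text \<open>For a fixed starting point the times whose flow map is C^1 nearby form an open set with
  open complement, since the step radius is the same whether or not the property holds at the
  centre. The set contains 0, hence is everything, and one last step gives joint
  differentiability.\<close>

lemma flow_C1:
  assumes c: "c \<in> A"
  shows "C1map A (UNIV \<times> cimg c) (\<lambda>z. F (fst z) (cinv c (snd z)))"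
proof (rule C1map_local)
  show "open ((UNIV :: real set) \<times> cimg c)" by (intro open_Times open_UNIV open_cimg[OF c])
  fix z :: "real \<times> 'b" assume "z \<in> UNIV \<times> cimg c"
  then obtain \<tau> y0 where z: "z = (\<tau>, y0)" and y0: "y0 \<in> cimg c" by auto
  define Good where "Good = {s. \<exists>V. y0 \<in> V \<and> C1map A V (\<lambda>y. F s (cinv c y))}"
  have slice: "\<exists>V. y0 \<in> V \<and> C1map A V (\<lambda>y. F s (cinv c y))"
    if W: "(s, y0) \<in> W" "C1map A W (\<lambda>z. F (fst z) (cinv c (snd z)))" for s W
  proof -
    have o: "open ((\<lambda>y. (s, y)) -` W)"
      by (rule open_vimage[OF C1map_open[OF W(2)]]) (intro continuous_intros)
    have "C1map A ((\<lambda>y. (s, y)) -` W) (\<lambda>y. F (fst (s, y)) (cinv c (snd (s, y))))"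
      by (rule C1map_compose[OF W(2) o Ck_on_Pair[OF o Ck_on_const Ck_on_id]]) auto
    then show ?thesis using W(1) by (intro exI[of _ "(\<lambda>y. (s, y)) -` W"]) simp
  qed
  have step: "\<exists>e>0. \<forall>s1 s2. \<bar>s1 - s\<bar> < e \<longrightarrow> \<bar>s2 - s\<bar> < e \<longrightarrow> s1 \<in> Good \<longrightarrow>
      (\<exists>W. (s2, y0) \<in> W \<and> C1map A W (\<lambda>z. F (fst z) (cinv c (snd z))))" for s
    unfolding Good_def by (rule flow_C1_step[OF c y0, of s]) blast
  have step': "\<exists>e>0. \<forall>s1 s2. \<bar>s1 - s\<bar> < e \<longrightarrow> \<bar>s2 - s\<bar> < e \<longrightarrow> s1 \<in> Good \<longrightarrow> s2 \<in> Good" for s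
  proof -
    obtain e where e: "e > 0" "\<And>s1 s2. \<bar>s1 - s\<bar> < e \<Longrightarrow> \<bar>s2 - s\<bar> < e \<Longrightarrow> s1 \<in> Good \<Longrightarrow>
      (\<exists>W. (s2, y0) \<in> W \<and> C1map A W (\<lambda>z. F (fst z) (cinv c (snd z))))" using step[of s] by blast
    have "s2 \<in> Good" if s12: "\<bar>s1 - s\<bar> < e" "\<bar>s2 - s\<bar> < e" "s1 \<in> Good" for s1 s2
    proof -
      obtain W where "(s2, y0) \<in> W" "C1map A W (\<lambda>z. F (fst z) (cinv c (snd z)))" using e(2)[OF s12] by blast
      from slice[OF this] show ?thesis unfolding Good_def by (rule CollectI)
    qed
    then show ?thesis using e(1) by blast
  qed
  have "\<exists>e>0. \<forall>y. \<bar>y - s\<bar> < e \<longrightarrow> (y \<in> Good \<longleftrightarrow> s \<in> Good)" for s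
  proof -
    obtain e where e: "e > 0" "\<And>s1 s2. \<bar>s1 - s\<bar> < e \<Longrightarrow> \<bar>s2 - s\<bar> < e \<Longrightarrow> s1 \<in> Good \<Longrightarrow> s2 \<in> Good"
      using step'[of s] by blast
    have "y \<in> Good \<longleftrightarrow> s \<in> Good" if "\<bar>y - s\<bar> < e" for y
      using e(2)[of y s] e(2)[of s y] that e(1) by auto
    then show ?thesis using e(1) by blast
  qed
  note nbhd = this
  have "open Good" unfolding open_dist dist_real_def using nbhd by blast
  moreover have "open (- Good)" unfolding open_dist dist_real_def using nbhd by blast
  then have "closed Good" by (simp add: closed_def)
  moreover have "0 \<in> Good"
    unfolding Good_def using C1map_cinv[OF c] y0 F_0 by (intro CollectI exI[of _ "cimg c"]) simp
  ultimately have "Good = UNIV" using clopen[of Good] by blast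
  then have "\<tau> \<in> Good" by blast
  moreover obtain e where "e > 0" "\<forall>s1 s2. \<bar>s1 - \<tau>\<bar> < e \<longrightarrow> \<bar>s2 - \<tau>\<bar> < e \<longrightarrow> s1 \<in> Good \<longrightarrow>
      (\<exists>W. (s2, y0) \<in> W \<and> C1map A W (\<lambda>z. F (fst z) (cinv c (snd z))))" using step by blast
  ultimately show "\<exists>W. z \<in> W \<and> C1map A W (\<lambda>z. F (fst z) (cinv c (snd z)))"
    unfolding z using abs_0 diff_self[of \<tau>] by (metis (no_types))
qed

lemma F_continuous: "continuous_on UNIV (\<lambda>z. F (fst z) (snd z))"
proof (rule continuous_on_local)
  fix z :: "real \<times> 'a"
  obtain c where c: "c \<in> A" "snd z \<in> cdom c" by (rule chart_at)
  have "continuous_on (UNIV \<times> cdom c) (\<lambda>z. (fst z :: real, cmap c (snd z)))"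
    by (intro continuous_intros continuous_on_compose2[OF cmap_continuous[OF c(1)]]) auto
  from continuous_on_compose2[OF C1map_continuous[OF flow_C1[OF c(1)]] this]
  have "continuous_on (UNIV \<times> cdom c) (\<lambda>z. F (fst z) (cinv c (cmap c (snd z))))" by fastforce
  then have "continuous_on (UNIV \<times> cdom c) (\<lambda>z. F (fst z) (snd z))"
    by (rule continuous_on_eq) (use c in auto)
  then show "\<exists>U. open U \<and> z \<in> U \<and> continuous_on (UNIV \<inter> U) (\<lambda>z. F (fst z) (snd z))"
    using c open_cdom[OF c(1)] by (intro exI[of _ "UNIV \<times> cdom c"]) (auto intro: open_Times simp: mem_Times_iff)
qed

end

section \<open>Growth of the spatial metric along the flow\<close>

context sm_cauchy_manifold
begin

definition dF :: "('a, 'b) chart \<Rightarrow> ('a, 'b) chart \<Rightarrow> real \<Rightarrow> 'a \<Rightarrow> 'b \<Rightarrow> 'b" where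
  "dF c d \<tau> x = frechet_derivative (\<lambda>y. cmap d (F \<tau> (cinv c y))) (at (cmap c x))"

lemma flow_slice_C1:
  assumes c: "c \<in> A" shows "C1map A (cimg c) (\<lambda>y. F \<tau> (cinv c y))"
proof -
  have "C1map A (cimg c) (\<lambda>y. F (fst (\<tau>, y)) (cinv c (snd (\<tau>, y))))"
    by (rule C1map_compose[OF flow_C1[OF c] open_cimg[OF c] Ck_on_Pair[OF open_cimg[OF c] Ck_on_const Ck_on_id]]) auto
  then show ?thesis by simp
qed

lemma dF_has_derivative:
  assumes "c \<in> A" "d \<in> A" "x \<in> cdom c" "F \<tau> x \<in> cdom d"
  shows "((\<lambda>y. cmap d (F \<tau> (cinv c y))) has_derivative dF c d \<tau> x) (at (cmap c x))"
  unfolding dF_def by (rule C1map_has_derivative[OF flow_slice_C1]) (use assms in auto)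

lemma dF_transition:
  assumes c: "c \<in> A" and de: "d \<in> A" "e \<in> A" and x: "x \<in> cdom c" and Fx: "F \<tau> x \<in> cdom d" "F \<tau> x \<in> cdom e"
  shows "dF c e \<tau> x w = transition d e (F \<tau> x) (dF c d \<tau> x w)"
proof -
  have y: "cmap c x \<in> cimg c" "cinv c (cmap c x) = x" using c x by auto
  have "isCont (\<lambda>y. F \<tau> (cinv c y)) (cmap c x)"
    using C1map_continuous[OF flow_slice_C1[OF c]] continuous_on_eq_continuous_at[OF open_cimg[OF c]] y(1) by blast
  then have "((\<lambda>y. cmap e (F \<tau> (cinv c y))) has_derivative
      (\<lambda>v. transition d e (F \<tau> (cinv c (cmap c x))) (dF c d \<tau> x v))) (at (cmap c x))"
    by (intro chart_change_derivative[where f="\<lambda>y. F \<tau> (cinv c y)", OF de] dF_has_derivative[OF c de(1) x Fx(1)])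
      (use y Fx in auto)
  then show ?thesis
    using has_derivative_unique[OF dF_has_derivative[OF c de(2) x Fx(2)]] y(2) by metis
qed

text \<open>Differentiation of \<open>t (F \<tau> y) = t y + \<tau>\<close>. In particular, vectors
  tangent to a level set are carried to vectors tangent to another one.\<close>

lemma dt_dF:
  assumes c: "c \<in> A" "d \<in> A" and x: "x \<in> cdom c" "F \<tau> x \<in> cdom d"
  shows "dt d (F \<tau> x) (dF c d \<tau> x w) = dt c x w"
proof -
  have y: "cmap c x \<in> cimg c" "cinv c (cmap c x) = x" using c x by auto
  have o: "open {y\<in>cimg c. F \<tau> (cinv c y) \<in> cdom d}" by (rule C1map_open_dom[OF flow_slice_C1[OF c(1)] c(2)])
  have "((\<lambda>y. t (cinv d (cmap d (F \<tau> (cinv c y))))) has_derivative (\<lambda>w. dt d (F \<tau> x) (dF c d \<tau> x w))) (at (cmap c x))"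
    by (rule has_derivative_compose[OF dF_has_derivative[OF c x], of "\<lambda>y. t (cinv d y)"])
      (use dt_has_derivative[OF c(2) x(2)] y in simp)
  then have 1: "((\<lambda>y. t (cinv c y) + \<tau>) has_derivative (\<lambda>w. dt d (F \<tau> x) (dF c d \<tau> x w))) (at (cmap c x))"
    by (rule has_derivative_transform_within_open[OF _ o]) (use y x c in \<open>auto simp: t_F\<close>)
  have 2: "((\<lambda>y. t (cinv c y) + \<tau>) has_derivative (\<lambda>w. dt c x w + 0)) (at (cmap c x))"
    by (rule has_derivative_add[OF dt_has_derivative[OF c(1) x(1)] has_derivative_const])
  show ?thesis using fun_cong[OF has_derivative_unique[OF 1 2], of w] by simp
qed

lemma flow_total_derivative:
  assumes c: "c \<in> A" "d \<in> A" and x: "x \<in> cdom c" "F \<tau> x \<in> cdom d"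
  shows "frechet_derivative (\<lambda>z. cmap d (F (fst z) (cinv c (snd z)))) (at (\<tau>, cmap c x)) (s, w)
    = s *\<^sub>R X d (F \<tau> x) + dF c d \<tau> x w"
proof -
  let ?H = "\<lambda>z. cmap d (F (fst z) (cinv c (snd z)))"
  let ?D = "frechet_derivative ?H (at (\<tau>, cmap c x))"
  have D: "(?H has_derivative ?D) (at (\<tau>, cmap c x))"
    by (rule C1map_has_derivative[OF flow_C1[OF c(1)] c(2)]) (use c x in auto)
  have p1: "((\<lambda>s. (s, cmap c x)) has_derivative (\<lambda>h. (h, 0))) (at \<tau>)"
    and p2: "((\<lambda>y. (\<tau>, y)) has_derivative (\<lambda>h. (0, h))) (at (cmap c x))"
    by (auto intro!: derivative_eq_intros)
  have e1: "((\<lambda>s. cmap d (F s x)) has_derivative (\<lambda>h. ?D (h, 0))) (at \<tau>)"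
    using has_derivative_compose[OF p1, of ?H ?D] D c x by simp
  have e2: "((\<lambda>s. cmap d (F s x)) has_derivative (\<lambda>h. h *\<^sub>R X d (F \<tau> x))) (at \<tau>)"
    using integral_curveD(4)[OF F_curve UNIV_I c(2) x(2)] by (simp add: has_vector_derivative_def)
  have 1: "?D (s, 0) = s *\<^sub>R X d (F \<tau> x)" by (rule fun_cong[OF has_derivative_unique[OF e1 e2]])
  have e3: "((\<lambda>y. cmap d (F \<tau> (cinv c y))) has_derivative (\<lambda>h. ?D (0, h))) (at (cmap c x))"
    using has_derivative_compose[OF p2, of ?H ?D] D by simp
  have 2: "?D (0, w) = dF c d \<tau> x w"
    by (rule fun_cong[OF has_derivative_unique[OF e3 dF_has_derivative[OF c x]]])
  have "?D (s, w) = ?D ((s, 0) + (0, w))" by simp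
  also have "\<dots> = ?D (s, 0) + ?D (0, w)" by (rule linear_add[OF has_derivative_linear[OF D]])
  finally show ?thesis using 1 2 by simp
qed

text \<open>The pull-back of \<open>g\<close> under the time \<open>\<tau>\<close> flow, on
  \<open>w\<close> twice. By \<open>stretch_eq\<close> the chart picked at the end point does not
  matter; this gives one function of \<open>\<tau>\<close> that can be differentiated while the flow
  passes through many charts.\<close>

definition stretch :: "('a, 'b) chart \<Rightarrow> 'a \<Rightarrow> 'b \<Rightarrow> real \<Rightarrow> real" where
  "stretch c x w \<tau> = (let d = (SOME d. d \<in> A \<and> F \<tau> x \<in> cdom d) in g d (F \<tau> x) (dF c d \<tau> x w) (dF c d \<tau> x w))"

lemma stretch_eq:
  assumes c: "c \<in> A" "d \<in> A" and x: "x \<in> cdom c" "F \<tau> x \<in> cdom d"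
  shows "stretch c x w \<tau> = g d (F \<tau> x) (dF c d \<tau> x w) (dF c d \<tau> x w)"
proof -
  define e where "e = (SOME d. d \<in> A \<and> F \<tau> x \<in> cdom d)"
  have e: "e \<in> A" "F \<tau> x \<in> cdom e"
    using someI[of "\<lambda>d. d \<in> A \<and> F \<tau> x \<in> cdom d" d] c x unfolding e_def by auto
  have "stretch c x w \<tau> = g e (F \<tau> x) (dF c e \<tau> x w) (dF c e \<tau> x w)"
    by (simp add: stretch_def e_def Let_def)
  also have "\<dots> = g d (F \<tau> x) (dF c d \<tau> x w) (dF c d \<tau> x w)"
    unfolding dF_transition[OF c e(1) x e(2)] by (rule metric_transition[OF c(2) e(1) x(2) e(2)])
  finally show ?thesis .
qed

lemma stretch_0:
  assumes c: "c \<in> A" and x: "x \<in> cdom c" shows "stretch c x w 0 = g c x w w"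
proof -
  have "((\<lambda>y. cmap c (F 0 (cinv c y))) has_derivative (\<lambda>w. w)) (at (cmap c x))"
    by (rule has_derivative_transform_within_open[OF has_derivative_ident open_cimg[OF c]])
      (use c x F_0 in auto)
  then have "dF c c 0 x w = w"
    using has_derivative_unique[OF dF_has_derivative[OF c c x, of 0]] F_0 x by metis
  then show ?thesis using stretch_eq[OF c c x, of 0 w] F_0 x by simp
qed

text \<open>The derivative of a pulled-back metric is the pull-back of the Lie derivative. The group
  law moves the differentiation from \<open>\<tau>1\<close> to time 0 of a flow box around
  \<open>F \<tau>1 x\<close>, where the linearised equation is available.\<close>

lemma stretch_has_derivative:
  assumes c: "c \<in> A" and x: "x \<in> cdom c"
  obtains d where "d \<in> A" "F \<tau>1 x \<in> cdom d"
    "(stretch c x w has_real_derivative lie_metric d (F \<tau>1 x) (dF c d \<tau>1 x w)) (at \<tau>1)"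
proof -
  define p where "p = F \<tau>1 x"
  show ?thesis
  proof (rule flow_box[of p])
    fix d \<epsilon> r \<Phi>
    assume f: "d \<in> A" "p \<in> cdom d" "\<epsilon> > 0" "r > 0" "ball (cmap d p) r \<subseteq> cimg d"
      "\<And>y. y \<in> ball (cmap d p) r \<Longrightarrow> \<Phi> 0 y = y"
      "\<And>\<tau> y. \<tau> \<in> {-\<epsilon><..<\<epsilon>} \<Longrightarrow> y \<in> ball (cmap d p) r \<Longrightarrow> \<Phi> \<tau> y \<in> cimg d"
      "\<And>y. y \<in> ball (cmap d p) r \<Longrightarrow> integral_curve {-\<epsilon><..<\<epsilon>} (\<lambda>\<tau>. cinv d (\<Phi> \<tau> y))"
      "Ck_on 1 ({-\<epsilon><..<\<epsilon>} \<times> ball (cmap d p) r) (\<lambda>(\<tau>, y). \<Phi> \<tau> y)"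
      "\<And>w y. y \<in> ball (cmap d p) r \<Longrightarrow>
         ((\<lambda>\<tau>. frechet_derivative (\<Phi> \<tau>) (at y) w) has_vector_derivative dX d (cinv d y) w) (at 0)"
    define z0 where "z0 = cmap d p"
    have z0: "z0 \<in> ball (cmap d p) r" "cinv d z0 = p" "z0 \<in> cimg d" using f by (auto simp: z0_def)
    define W where "W = dF c d \<tau>1 x w"
    \<comment> \<open>The differential of the box flow on the fixed vector \<open>W\<close>. It will
      equal \<open>dF c d (\<tau>1 + \<eta>) x w\<close>, and its derivative at
      \<open>\<eta> = 0\<close> is \<open>dX d p W\<close>.\<close>
    define P where "P = (\<lambda>\<eta>. frechet_derivative (\<Phi> \<eta>) (at z0) W)"
    have y: "cmap c x \<in> cimg c" "cinv c (cmap c x) = x" using c x by auto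
    have box: "F \<eta> (cinv d y) = cinv d (\<Phi> \<eta> y)" if "\<eta> \<in> {-\<epsilon><..<\<epsilon>}" "y \<in> ball (cmap d p) r" for \<eta> y
      by (rule F_box_eq[where \<Phi>=\<Phi>, OF f(1,3) f(6)[OF that(2)] that(1) f(8)[OF that(2)]])
    define Y where "Y = {y\<in>cimg c. F \<tau>1 (cinv c y) \<in> cinv d ` ball (cmap d p) r}"
    have "open (cimg c \<inter> (\<lambda>y. F \<tau>1 (cinv c y)) -` (cinv d ` ball (cmap d p) r))"
      by (rule continuous_open_preimage[OF C1map_continuous[OF flow_slice_C1[OF c]] open_cimg[OF c]
            open_cinv_image[OF f(1) open_ball f(5)]])
    then have oY: "open Y" by (simp add: Y_def vimage_def Int_def)
    have xY: "cmap c x \<in> Y"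
      unfolding Y_def using y z0 by (auto simp: p_def[symmetric] simp del: mem_ball)
    have \<Phi>d: "(\<Phi> \<eta> has_derivative frechet_derivative (\<Phi> \<eta>) (at z0)) (at z0)" if \<eta>: "\<eta> \<in> {-\<epsilon><..<\<epsilon>}" for \<eta>
    proof -
      have "Ck_on 1 (ball (cmap d p) r) (\<lambda>y. (\<lambda>(\<tau>, y). \<Phi> \<tau> y) (\<eta>, y))"
        by (rule C1_on_compose[OF open_ball f(9) Ck_on_Pair[OF open_ball Ck_on_const Ck_on_id]]) (use \<eta> in auto)
      then have "Ck_on (Suc 0) (ball (cmap d p) r) (\<Phi> \<eta>)" by (simp add: One_nat_def del: Ck_on.simps)
      then show ?thesis by (rule Ck_on_has_derivative) (rule z0(1))
    qed
    have Fsum: "cmap d (F (\<tau>1 + \<eta>) (cinv c y)) = \<Phi> \<eta> (cmap d (F \<tau>1 (cinv c y)))"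
      "F (\<tau>1 + \<eta>) (cinv c y) \<in> cdom d" if \<eta>: "\<eta> \<in> {-\<epsilon><..<\<epsilon>}" and yY: "y \<in> Y" for \<eta> y
    proof -
      obtain v where v: "F \<tau>1 (cinv c y) = cinv d v" "v \<in> ball (cmap d p) r" using yY unfolding Y_def by blast
      have v': "v \<in> cimg d" using v f(5) by blast
      have "F (\<tau>1 + \<eta>) (cinv c y) = F \<eta> (cinv d v)" using F_add[of \<eta> \<tau>1] v by (simp add: add.commute)
      also have "\<dots> = cinv d (\<Phi> \<eta> v)" by (rule box[OF \<eta> v(2)])
      finally have *: "F (\<tau>1 + \<eta>) (cinv c y) = cinv d (\<Phi> \<eta> v)" .
      show "cmap d (F (\<tau>1 + \<eta>) (cinv c y)) = \<Phi> \<eta> (cmap d (F \<tau>1 (cinv c y)))"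
        unfolding * v(1) using cmap_cinv[OF f(1) f(7)[OF \<eta> v(2)]] cmap_cinv[OF f(1) v'] by simp
      show "F (\<tau>1 + \<eta>) (cinv c y) \<in> cdom d"
        unfolding * by (rule cinv_in[OF f(1) f(7)[OF \<eta> v(2)]])
    qed
    have PdF: "dF c d (\<tau>1 + \<eta>) x w = P \<eta>" "F (\<tau>1 + \<eta>) x \<in> cdom d" "F (\<tau>1 + \<eta>) x = cinv d (\<Phi> \<eta> z0)"
      if \<eta>: "\<eta> \<in> {-\<epsilon><..<\<epsilon>}" for \<eta>
    proof -
      show in': "F (\<tau>1 + \<eta>) x \<in> cdom d" using Fsum(2)[OF \<eta> xY] y by simp
      show "F (\<tau>1 + \<eta>) x = cinv d (\<Phi> \<eta> z0)"
        using Fsum(1)[OF \<eta> xY] in' f(1) y by (metis cinv_cmap p_def z0_def)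
      have "((\<lambda>y. \<Phi> \<eta> (cmap d (F \<tau>1 (cinv c y)))) has_derivative
          (\<lambda>w. frechet_derivative (\<Phi> \<eta>) (at z0) (dF c d \<tau>1 x w))) (at (cmap c x))"
        by (rule has_derivative_compose[OF dF_has_derivative[OF c f(1) x]])
          (use \<Phi>d[OF \<eta>] y f(2) in \<open>auto simp: z0_def p_def\<close>)
      then have "((\<lambda>y. cmap d (F (\<tau>1 + \<eta>) (cinv c y))) has_derivative
          (\<lambda>w. frechet_derivative (\<Phi> \<eta>) (at z0) (dF c d \<tau>1 x w))) (at (cmap c x))"
        by (rule has_derivative_transform_within_open[OF _ oY xY]) (use Fsum(1)[OF \<eta>] in simp)
      then show "dF c d (\<tau>1 + \<eta>) x w = P \<eta>"
        using has_derivative_unique[OF dF_has_derivative[OF c f(1) x in']] unfolding P_def W_def by metis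
    qed
    have 0: "0 \<in> {-\<epsilon><..<\<epsilon>}" using f(3) by simp
    have P0: "P 0 = W" using PdF(1)[OF 0] by (simp add: W_def)
    have dP: "(P has_derivative (\<lambda>h. h *\<^sub>R dX d p W)) (at 0)"
      using f(10)[OF z0(1), of W] z0(2) by (simp add: P_def has_vector_derivative_def)
    have \<Phi>0: "\<Phi> 0 z0 = z0" by (rule f(6)[OF z0(1)])
    have "((\<lambda>\<tau>. cmap d (cinv d (\<Phi> \<tau> z0))) has_vector_derivative X d (cinv d (\<Phi> 0 z0))) (at 0)"
      by (rule integral_curveD(4)[OF f(8)[OF z0(1)] 0 f(1)]) (use \<Phi>0 z0 f(2) in simp)
    then have "((\<lambda>\<tau>. \<Phi> \<tau> z0) has_vector_derivative X d (cinv d (\<Phi> 0 z0))) (at 0)"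
      by (rule has_vector_derivative_transform_within_open[of _ _ _ "{-\<epsilon><..<\<epsilon>}"])
        (use 0 f(7)[OF _ z0(1)] f(1) in auto)
    then have d\<Phi>: "((\<lambda>\<tau>. \<Phi> \<tau> z0) has_derivative (\<lambda>h. h *\<^sub>R X d p)) (at 0)"
      using \<Phi>0 z0(2) by (simp add: has_vector_derivative_def)
    have "((\<lambda>\<eta>. g d (cinv d (\<Phi> \<eta> z0)) (P \<eta>) (P \<eta>)) has_derivative
      (\<lambda>h. dg d (\<Phi> 0 z0) (h *\<^sub>R X d p) (P 0) (P 0) + g d (cinv d (\<Phi> 0 z0)) (h *\<^sub>R dX d p W) (P 0)
        + g d (cinv d (\<Phi> 0 z0)) (P 0) (h *\<^sub>R dX d p W))) (at 0)"
      by (rule metric_product_rule[OF f(1) _ UNIV_I d\<Phi> dP dP]) (use \<Phi>0 z0 in simp)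
    moreover have "(\<lambda>h. dg d (\<Phi> 0 z0) (h *\<^sub>R X d p) (P 0) (P 0) + g d (cinv d (\<Phi> 0 z0)) (h *\<^sub>R dX d p W) (P 0)
        + g d (cinv d (\<Phi> 0 z0)) (P 0) (h *\<^sub>R dX d p W)) = (\<lambda>h. h * lie_metric d p W)"
      unfolding \<Phi>0 P0 z0(2) lie_metric_def z0_def[symmetric]
      using linear_scale[OF dg_linear[OF f(1) z0(3)]] bilinear_simps[OF metric_bilinear[OF f(1,2)]]
      by (auto simp: algebra_simps)
    ultimately have "((\<lambda>\<eta>. g d (cinv d (\<Phi> \<eta> z0)) (P \<eta>) (P \<eta>)) has_derivative (\<lambda>h. h * lie_metric d p W)) (at 0)"
      by simp
    then have "((\<lambda>\<eta>. stretch c x w (\<tau>1 + \<eta>)) has_derivative (\<lambda>h. h * lie_metric d p W)) (at 0)"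
      by (rule has_derivative_transform_within_open[OF _ open_greaterThanLessThan 0])
        (use stretch_eq[OF c f(1) x] PdF in simp)
    then have "((\<lambda>\<eta>. stretch c x w (\<eta> + \<tau>1)) has_real_derivative lie_metric d p W) (at 0)"
      by (simp add: has_field_derivative_def add.commute mult.commute[of _ "lie_metric d p W"])
    then have "(stretch c x w has_real_derivative lie_metric d p W) (at \<tau>1)"
      using DERIV_shift[of "stretch c x w" "lie_metric d p W" 0 \<tau>1] by simp
    then show ?thesis using that[of d] f(1,2) by (simp add: p_def W_def)
  qed
qed

text \<open>Gronwall: the Lie derivative bound with constant \<open>K\<close> makes
  \<open>stretch\<close> times \<open>exp (- K * s)\<close> nonincreasing, so \<open>stretch\<close>
  grows at most by \<open>exp K\<close> in unit time. The factor
  \<open>- lapse \<le> C0\<^sup>2\<close> is included because the causality condition of a lift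
  contains it; hence \<open>\<kappa> = C0 * sqrt (exp K)\<close>.\<close>

lemma flow_growth:
  obtains \<kappa> where "\<kappa> > 0"
    "\<And>c d x \<tau> w. c \<in> A \<Longrightarrow> d \<in> A \<Longrightarrow> x \<in> cdom c \<Longrightarrow> F \<tau> x \<in> cdom d \<Longrightarrow> t x = a \<Longrightarrow> \<tau> \<in> {0..1} \<Longrightarrow> dt c x w = 0 \<Longrightarrow>
      - lapse d (F \<tau> x) * g d (F \<tau> x) (dF c d \<tau> x w) (dF c d \<tau> x w) \<le> \<kappa>\<^sup>2 * g c x w w"
proof -
  show ?thesis
  proof (rule slab_bounds[OF range_t, of a])
    fix h0 C0 :: real
    assume h0: "h0 > 0" and C0: "C0 > 0"
    and b1: "\<And>c x. c \<in> A \<Longrightarrow> x \<in> cdom c \<Longrightarrow> t x \<in> {a..a+1} \<Longrightarrow> h0 \<le> - lapse c x \<and> - lapse c x \<le> C0\<^sup>2"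
    and b2: "\<And>c x v. c \<in> A \<Longrightarrow> x \<in> cdom c \<Longrightarrow> t x \<in> {a..a+1} \<Longrightarrow> flip_form (g c x) (N c x) v v = 1 \<Longrightarrow>
       flip_form (g c x) (N c x) (covN c x v) (covN c x v) \<le> C0\<^sup>2"
  define K where "K = 2 * C0 / h0"
  have K: "K \<ge> 0" using h0 C0 by (simp add: K_def)
  have growth: "stretch c x w \<tau> \<le> exp K * g c x w w"
    if c: "c \<in> A" and x: "x \<in> cdom c" and tx: "t x = a" and \<tau>: "\<tau> \<in> {0..1}" and w: "dt c x w = 0" for c x w \<tau>
  proof -
    have "\<exists>y. ((\<lambda>s. stretch c x w s * exp (- K * s)) has_real_derivative y) (at s) \<and> y \<le> 0"
      if s: "0 \<le> s" "s \<le> \<tau>" for s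
    proof -
      obtain d where d: "d \<in> A" "F s x \<in> cdom d"
        "(stretch c x w has_real_derivative lie_metric d (F s x) (dF c d s x w)) (at s)"
        by (rule stretch_has_derivative[OF c x])
      have ts: "t (F s x) \<in> {a..a+1}" using s \<tau> tx by (simp add: t_F)
      have "lie_metric d (F s x) (dF c d s x w) \<le> K * g d (F s x) (dF c d s x w) (dF c d s x w)"
        unfolding K_def
        by (rule lie_metric_bound[OF d(1,2) _ h0 _ C0])
          (use dt_dF[OF c d(1) x d(2)] w b1[OF d(1,2) ts] b2[OF d(1,2) ts] in auto)
      then have le: "lie_metric d (F s x) (dF c d s x w) \<le> K * stretch c x w s"
        using stretch_eq[OF c d(1) x d(2)] by simp
      have "((\<lambda>s. exp (- K * s)) has_real_derivative exp (- K * s) * (- K)) (at s)"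
        by (auto intro!: derivative_eq_intros)
      from DERIV_mult[OF d(3) this]
      have "((\<lambda>s. stretch c x w s * exp (- K * s)) has_real_derivative
        exp (- K * s) * (lie_metric d (F s x) (dF c d s x w) - K * stretch c x w s)) (at s)"
        by (simp add: algebra_simps)
      moreover have "exp (- K * s) * (lie_metric d (F s x) (dF c d s x w) - K * stretch c x w s) \<le> 0"
        using le by (simp add: mult_nonneg_nonpos)
      ultimately show ?thesis by blast
    qed
    then have "stretch c x w \<tau> * exp (- K * \<tau>) \<le> stretch c x w 0 * exp (- K * 0)"
      using \<tau> by (intro DERIV_nonpos_imp_nonincreasing[where f="\<lambda>s. stretch c x w s * exp (- K * s)"]) simp_all
    also have "\<dots> = g c x w w" using stretch_0[OF c x] by simp
    finally have "stretch c x w \<tau> \<le> exp (K * \<tau>) * g c x w w"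
      by (simp add: exp_minus field_simps)
    also have "\<dots> \<le> exp K * g c x w w"
    proof (intro mult_right_mono)
      show "exp (K * \<tau>) \<le> exp K" using K \<tau> by (simp add: mult_left_le)
      show "0 \<le> g c x w w"
        by (rule lorentz_form_orthogonal_nonneg[OF metric_form[OF c x] N_timelike[OF c x]]) (use N_eq[OF c x] w in simp)
    qed
    finally show ?thesis .
  qed
  show ?thesis
  proof (rule that[of "C0 * sqrt (exp K)"])
    show "C0 * sqrt (exp K) > 0" using C0 by simp
    fix c d x \<tau> w assume c: "c \<in> A" "d \<in> A" and x: "x \<in> cdom c" "F \<tau> x \<in> cdom d" and tx: "t x = a"
      and \<tau>: "\<tau> \<in> {0..1}" and w: "dt c x w = 0"
    have ts: "t (F \<tau> x) \<in> {a..a+1}" using \<tau> tx by (simp add: t_F)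
    have nn: "0 \<le> g d (F \<tau> x) (dF c d \<tau> x w) (dF c d \<tau> x w)"
      by (rule lorentz_form_orthogonal_nonneg[OF metric_form[OF c(2) x(2)] N_timelike[OF c(2) x(2)]])
        (use N_eq[OF c(2) x(2)] dt_dF[OF c x] w in simp)
    have "- lapse d (F \<tau> x) * g d (F \<tau> x) (dF c d \<tau> x w) (dF c d \<tau> x w)
      \<le> C0\<^sup>2 * (exp K * g c x w w)"
      using growth[OF c(1) x(1) tx \<tau> w] stretch_eq[OF c x, of w] b1[OF c(2) x(2) ts] nn
      by (intro mult_mono) auto
    then show "- lapse d (F \<tau> x) * g d (F \<tau> x) (dF c d \<tau> x w) (dF c d \<tau> x w) \<le> (C0 * sqrt (exp K))\<^sup>2 * g c x w w"
      by (simp add: power_mult_distrib)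
  qed
  qed
qed

text \<open>\<open>X\<close> is parallel to \<open>N\<close>, so the mixed terms vanish and the
  square of the vector is \<open>s\<^sup>2 / lapse d p + g d p W W\<close>; the last hypothesis says
  that this is at most 0. Its time component \<open>s\<close> is positive, which selects the future
  cone.\<close>

lemma causal_lift:
  assumes c: "d \<in> A" "p \<in> cdom d" and W: "dt d p W = 0" and s: "s > 0" and le: "- lapse d p * g d p W W \<le> s\<^sup>2"
  shows "causal (g d p) (s *\<^sub>R X d p + W)" "future_directed g T d p (s *\<^sub>R X d p + W)"
proof -
  let ?v = "s *\<^sub>R X d p + W"
  note q = metric_form[OF c] and b = metric_bilinear[OF c] and l = lapse_neg[OF c]
  have dtv: "dt d p ?v = s" using dt_X[OF c] dt_linear[OF c] W by (simp add: linear_add linear_scale)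
  then have ne: "?v \<noteq> 0" using s linear_0[OF dt_linear[OF c]] by auto
  have NW: "g d p (N d p) W = 0" using N_eq[OF c] W by simp
  have XX: "g d p (X d p) (X d p) = 1 / lapse d p"
    using l by (simp add: X_def bilinear_simps[OF b] lapse_def[symmetric])
  have XW: "g d p (X d p) W = 0" "g d p W (X d p) = 0"
    using NW lorentz_form_sym[OF q, of W "X d p"] by (simp_all add: X_def bilinear_simps[OF b])
  have "g d p ?v ?v = s\<^sup>2 / lapse d p + g d p W W"
    using XX XW by (simp add: bilinear_simps[OF b] power2_eq_square)
  also have "\<dots> \<le> 0"
  proof -
    have "g d p W W \<le> s\<^sup>2 / (- lapse d p)" using le l by (subst pos_le_divide_eq) (auto simp: mult.commute)
    then show ?thesis by simp
  qed
  finally have vv: "g d p ?v ?v \<le> 0" .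
  show "causal (g d p) ?v" using ne vv by (simp add: causal_def)
  show "future_directed g T d p ?v"
    unfolding future_directed_def
    by (rule causal_future_directed[OF q N_timelike[OF c] T_timelike[OF c] N_past[OF c] vv]) (use N_eq[OF c] dtv s in simp)
qed

end

section \<open>Speed and length of curves\<close>

context lorentz_manifold
begin

text \<open>Velocities are taken within the piece, so this speed is continuous up to both ends. The
  two-sided derivative in \<open>speed\<close> need not exist at a break point; inside the piece the
  two agree.\<close>

definition piece_speed :: "(real \<Rightarrow> 'a) \<Rightarrow> real \<Rightarrow> real \<Rightarrow> real \<Rightarrow> real" where
  "piece_speed \<sigma> u v s = (let c = SOME c. c \<in> A \<and> \<sigma> s \<in> cdom c; w = velocity \<sigma> {u..v} c s in sqrt (g c (\<sigma> s) w w))"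

lemma piece_speed_eq:
  assumes \<sigma>: "C1_curve_on A \<sigma> u v" and uv: "u < v" and c: "c \<in> A" and s: "s \<in> {u..v}" and \<sigma>s: "\<sigma> s \<in> cdom c"
  shows "piece_speed \<sigma> u v s = sqrt (g c (\<sigma> s) (velocity \<sigma> {u..v} c s) (velocity \<sigma> {u..v} c s))"
proof -
  define e where "e = (SOME c. c \<in> A \<and> \<sigma> s \<in> cdom c)"
  have e: "e \<in> A" "\<sigma> s \<in> cdom e" using someI[of "\<lambda>c. c \<in> A \<and> \<sigma> s \<in> cdom c" c] c \<sigma>s unfolding e_def by auto
  have "piece_speed \<sigma> u v s = sqrt (g e (\<sigma> s) (velocity \<sigma> {u..v} e s) (velocity \<sigma> {u..v} e s))"
    by (simp add: piece_speed_def e_def Let_def)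
  then show ?thesis
    unfolding velocity_transition[OF \<sigma> uv c e(1) s \<sigma>s e(2)] metric_transition[OF c e(1) \<sigma>s e(2)] .
qed

lemma speed_eq_piece_speed:
  assumes "s \<in> {u<..<v}" shows "speed A g \<sigma> s = piece_speed \<sigma> u v s"
proof -
  have "velocity \<sigma> UNIV c s = velocity \<sigma> {u..v} c s" for c :: "('a, 'b) chart"
    by (rule velocity_UNIV_eq[OF assms])
  then show ?thesis by (simp add: speed_def piece_speed_def Let_def)
qed

lemma piece_speed_continuous:
  assumes \<sigma>: "C1_curve_on A \<sigma> u v" and uv: "u < v"
  shows "continuous_on {u..v} (piece_speed \<sigma> u v)"
proof (rule continuous_on_local)
  fix s assume s: "s \<in> {u..v}"
  obtain c where c: "c \<in> A" "\<sigma> s \<in> cdom c" by (rule chart_at)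
  note cont = C1_curve_on_continuous[OF \<sigma>]
  obtain U where "open U" and "U \<inter> {u..v} = \<sigma> -` cdom c \<inter> {u..v}"
    using cont open_cdom[OF c(1)] unfolding continuous_on_open_invariant by blast
  then have U: "r \<in> U \<longleftrightarrow> \<sigma> r \<in> cdom c" if "r \<in> {u..v}" for r using that by blast
  have vel: "continuous_on ({u..v} \<inter> U) (velocity \<sigma> {u..v} c)"
    by (rule continuous_on_subset[OF C1_curve_on_velocity_continuous[OF \<sigma> uv c(1)]]) (use U in auto)
  have "continuous_on ({u..v} \<inter> U) (\<lambda>s. sqrt (g c (\<sigma> s) (velocity \<sigma> {u..v} c s) (velocity \<sigma> {u..v} c s)))"
    by (intro continuous_on_real_sqrt metric_continuous[OF c(1)] vel continuous_on_subset[OF cont]) (use U in auto)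
  then have "continuous_on ({u..v} \<inter> U) (piece_speed \<sigma> u v)"
    by (rule continuous_on_eq) (use piece_speed_eq[OF \<sigma> uv c(1)] U in auto)
  then show "\<exists>U. open U \<and> s \<in> U \<and> continuous_on ({u..v} \<inter> U) (piece_speed \<sigma> u v)"
    using \<open>open U\<close> U[OF s] c(2) by blast
qed

lemma speed_integrable_piece:
  assumes \<sigma>: "C1_curve_on A \<sigma> u v" and uv: "u < v"
  shows "speed A g \<sigma> integrable_on {u..v}" "integral {u..v} (speed A g \<sigma>) = integral {u..v} (piece_speed \<sigma> u v)"
proof -
  have i: "piece_speed \<sigma> u v integrable_on {u..v}"
    by (rule integrable_continuous_real[OF piece_speed_continuous[OF assms]])
  have eq: "speed A g \<sigma> s = piece_speed \<sigma> u v s" if "s \<in> {u..v} - {u, v}" for s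
    using speed_eq_piece_speed[of s u v \<sigma>] that by auto
  show "speed A g \<sigma> integrable_on {u..v}"
    by (rule integrable_spike_finite[OF _ _ i, of "{u, v}"]) (use eq in auto)
  show "integral {u..v} (speed A g \<sigma>) = integral {u..v} (piece_speed \<sigma> u v)"
    by (rule integral_spike[of "{u, v}"]) (use eq in auto)
qed

section \<open>Translated curves and integrability of the speed\<close>

lemma C1_curve_on_const: "u < v \<Longrightarrow> C1_curve_on A (\<lambda>_. x) u v"
  by (rule C1_curve_onI) (auto intro!: exI[of _ UNIV] exI[of _ "\<lambda>_. 0"] has_vector_derivative_const)

lemma C1_curve_on_shift:
  assumes \<sigma>: "C1_curve_on A \<sigma> (u - k) (v - k)" and uv: "u < v" and "\<forall>s\<in>{u..v}. \<gamma> s = \<sigma> (s - k)"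
  shows "C1_curve_on A \<gamma> u v"
    and "\<And>s c. s \<in> {u..v} \<Longrightarrow> c \<in> A \<Longrightarrow> \<gamma> s \<in> cdom c \<Longrightarrow> velocity \<gamma> {u..v} c s = velocity \<sigma> {u-k..v-k} c (s - k)"
proof -
  have eq: "\<And>s. s \<in> {u..v} \<Longrightarrow> \<gamma> s = \<sigma> (s - k)" using assms(3) by blast
  have uv': "u - k < v - k" using uv by simp
  have im: "(\<lambda>s. s - k) ` {u..v} = {u-k..v-k}" by simp
  have d: "((\<lambda>s. cmap c (\<gamma> s)) has_vector_derivative velocity \<sigma> {u-k..v-k} c (s - k)) (at s within {u..v})"
    if s: "s \<in> {u..v}" and c: "c \<in> A" "\<gamma> s \<in> cdom c" for s c
  proof -
    have "((\<lambda>s. s - k) has_vector_derivative 1) (at s within {u..v})" by (auto intro!: derivative_eq_intros)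
    moreover have "((\<lambda>s. cmap c (\<sigma> s)) has_vector_derivative velocity \<sigma> {u-k..v-k} c (s - k)) (at (s - k) within (\<lambda>s. s - k) ` {u..v})"
      unfolding im by (rule C1_curve_on_derivative[OF \<sigma> uv' c(1)]) (use s c eq in auto)
    ultimately have "((\<lambda>s. cmap c (\<sigma> s)) \<circ> (\<lambda>s. s - k) has_vector_derivative 1 *\<^sub>R velocity \<sigma> {u-k..v-k} c (s - k)) (at s within {u..v})"
      by (rule vector_diff_chain_within)
    then have "((\<lambda>s. cmap c (\<sigma> (s - k))) has_vector_derivative velocity \<sigma> {u-k..v-k} c (s - k)) (at s within {u..v})"
      by (simp add: comp_def)
    then show ?thesis
      by (rule has_vector_derivative_transform[OF s, rotated]) (simp add: eq)
  qed
  show "velocity \<gamma> {u..v} c s = velocity \<sigma> {u-k..v-k} c (s - k)" if "s \<in> {u..v}" "c \<in> A" "\<gamma> s \<in> cdom c" for s c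
    by (rule velocity_eq[OF uv that(1) d[OF that]])
  have "continuous_on {u..v} (\<lambda>s. \<sigma> (s - k))"
    by (rule continuous_on_compose2[OF C1_curve_on_continuous[OF \<sigma>]]) (auto intro!: continuous_intros)
  then have cont: "continuous_on {u..v} \<gamma>" by (rule continuous_on_eq) (use eq in auto)
  show "C1_curve_on A \<gamma> u v"
  proof (rule C1_curve_onI[OF uv cont])
    fix s0 c assume s0: "s0 \<in> {u..v}" "c \<in> A" "\<gamma> s0 \<in> cdom c"
    obtain U where "open U" and "U \<inter> {u..v} = \<gamma> -` cdom c \<inter> {u..v}"
      using cont open_cdom[OF s0(2)] unfolding continuous_on_open_invariant by blast
    then have U: "s \<in> U \<longleftrightarrow> \<gamma> s \<in> cdom c" if "s \<in> {u..v}" for s using that by blast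
    show "\<exists>U D. open U \<and> s0 \<in> U \<and> (\<forall>s\<in>{u..v} \<inter> U. ((\<lambda>s. cmap c (\<gamma> s)) has_vector_derivative D s) (at s within {u..v}))
        \<and> continuous_on ({u..v} \<inter> U) D"
    proof (intro exI conjI ballI)
      show "open U" by fact
      show "s0 \<in> U" using U s0 by blast
      show "((\<lambda>s. cmap c (\<gamma> s)) has_vector_derivative velocity \<sigma> {u-k..v-k} c (s - k)) (at s within {u..v})" if "s \<in> {u..v} \<inter> U" for s
        by (rule d) (use that U s0(2) in auto)
      show "continuous_on ({u..v} \<inter> U) (\<lambda>s. velocity \<sigma> {u-k..v-k} c (s - k))"
        by (rule continuous_on_compose2[OF C1_curve_on_velocity_continuous[OF \<sigma> uv' s0(2)]])
          (use U eq in \<open>auto intro!: continuous_intros\<close>)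
    qed
  qed
qed

text \<open>Bisection takes the place of an enumeration of break points: every point has a
  surrounding interval with no other break point, whose two halves are pieces, and integrability
  passes to unions of adjacent intervals.\<close>

lemma speed_integrable:
  assumes pc: "piecewise_C1_curve A {0..1} B \<sigma>"
  shows "(\<lambda>s. \<bar>speed A g \<sigma> s\<bar>) integrable_on {0..1}"
proof -
  have fin: "finite (B \<inter> {0..1})" and C1: "\<And>u v. piece {0..1} B u v \<Longrightarrow> C1_curve_on A \<sigma> u v"
    using pc by (auto simp: piecewise_C1_curve_def)
  let ?f = "\<lambda>s. \<bar>speed A g \<sigma> s\<bar>"
  have ip: "?f integrable_on {u..v}" if p: "piece {0..1} B u v" for u v
  proof -
    have uv: "u < v" using p by (simp add: piece_def)
    have i: "(\<lambda>s. \<bar>piece_speed \<sigma> u v s\<bar>) integrable_on {u..v}"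
      by (intro integrable_continuous_real continuous_on_rabs piece_speed_continuous[OF C1[OF p] uv])
    show ?thesis
      by (rule integrable_spike_finite[OF _ _ i, of "{u, v}"]) (use speed_eq_piece_speed[of _ u v \<sigma>] in auto)
  qed
  have "0 \<le> (0::real) \<longrightarrow> 1 \<le> (1::real) \<longrightarrow> ?f integrable_on {0..1}"
  proof (rule Bolzano[where P="\<lambda>u v. 0 \<le> u \<longrightarrow> v \<le> 1 \<longrightarrow> ?f integrable_on {u..v}"])
    show "0 \<le> (1::real)" by simp
    show "0 \<le> u \<longrightarrow> w \<le> 1 \<longrightarrow> ?f integrable_on {u..w}"
      if "0 \<le> u \<longrightarrow> v \<le> 1 \<longrightarrow> ?f integrable_on {u..v}" "0 \<le> v \<longrightarrow> w \<le> 1 \<longrightarrow> ?f integrable_on {v..w}"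
        "u \<le> v" "v \<le> w" for u v w
      using that by (auto intro: Henstock_Kurzweil_Integration.integrable_combine)
    fix x :: real assume x: "0 \<le> x" "x \<le> 1"
    obtain d where d: "d > 0" "\<And>y. \<bar>y - x\<bar> < d \<Longrightarrow> y \<noteq> x \<Longrightarrow> y \<notin> B \<inter> {0..1}" using finite_gap[OF fin] by metis
    show "\<exists>d>0. \<forall>u v. u \<le> x \<and> x \<le> v \<and> v - u < d \<longrightarrow> 0 \<le> u \<longrightarrow> v \<le> 1 \<longrightarrow> ?f integrable_on {u..v}"
    proof (intro exI[of _ d] conjI allI impI)
      fix u v assume uv: "u \<le> x \<and> x \<le> v \<and> v - u < d" "0 \<le> u" "v \<le> 1"
      have "?f integrable_on {u..x}"
      proof (cases "u = x")
        case False
        have "y \<notin> B" if "u < y" "y < x" for y using d(2)[of y] uv that x by auto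
        then have "piece {0..1} B u x" using False uv x by (auto simp: piece_def)
        then show ?thesis by (rule ip)
      qed (use integrable_on_refl[of ?f x] in simp)
      moreover have "?f integrable_on {x..v}"
      proof (cases "v = x")
        case False
        have "y \<notin> B" if "x < y" "y < v" for y using d(2)[of y] uv that x by auto
        then have "piece {0..1} B x v" using False uv x by (auto simp: piece_def)
        then show ?thesis by (rule ip)
      qed (use integrable_on_refl[of ?f x] in simp)
      ultimately show "?f integrable_on {u..v}"
        using uv by (auto intro: Henstock_Kurzweil_Integration.integrable_combine)
    qed fact
  qed
  then show ?thesis by simp
qed

end

section \<open>Lifting curves along the flow\<close>

context sm_cauchy_manifold
begin

text \<open>\<open>t\<close> is constant along the curve, and derivatives within an interval of
  positive length are unique, so the value given by the chain rule is 0.\<close>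

lemma level_curve_dt:
  assumes \<sigma>: "C1_curve_on A \<sigma> u v" and uv: "u < v" and c: "c \<in> A" and s: "s \<in> {u..v}" "\<sigma> s \<in> cdom c"
    and lev: "\<And>s. s \<in> {u..v} \<Longrightarrow> t (\<sigma> s) = a"
  shows "dt c (\<sigma> s) (velocity \<sigma> {u..v} c s) = 0"
proof -
  let ?v = "velocity \<sigma> {u..v} c s"
  have "((\<lambda>s. t (cinv c (cmap c (\<sigma> s)))) has_derivative (\<lambda>h. dt c (\<sigma> s) (h *\<^sub>R ?v))) (at s within {u..v})"
    by (rule has_derivative_compose[of "\<lambda>s. cmap c (\<sigma> s)" _ _ _ "\<lambda>y. t (cinv c y)"])
      (use C1_curve_on_derivative[OF \<sigma> uv c s] dt_has_derivative[OF c s(2)] in \<open>auto simp: has_vector_derivative_def\<close>)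
  moreover have "\<forall>\<^sub>F x in at s within {u..v}. x \<in> {u..v}"
    by (auto simp: eventually_at_topological)
  moreover have "\<forall>\<^sub>F x in at s within {u..v}. \<sigma> x \<in> cdom c"
    using C1_curve_on_continuous[OF \<sigma>] s open_cdom[OF c] unfolding continuous_on_def by (metis topological_tendstoD)
  ultimately have d: "((\<lambda>s. t (cinv c (cmap c (\<sigma> s)))) has_derivative (\<lambda>h. dt c (\<sigma> s) (h *\<^sub>R ?v))) (at s within {u..v})"
    and "\<forall>\<^sub>F x in at s within {u..v}. x \<in> {u..v}" "\<forall>\<^sub>F x in at s within {u..v}. \<sigma> x \<in> cdom c" by auto
  from this(2,3) have "\<forall>\<^sub>F x in at s within {u..v}. t (cinv c (cmap c (\<sigma> x))) = a"
    by eventually_elim (use c lev in simp)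
  note ev = this
  have "((\<lambda>_. a) has_derivative (\<lambda>h. dt c (\<sigma> s) (h *\<^sub>R ?v))) (at s within {u..v})"
    by (rule has_derivative_transform_eventually[OF d ev]) (use c s lev in auto)
  then have "((\<lambda>_. a) has_vector_derivative dt c (\<sigma> s) ?v) (at s within {u..v})"
    using dt_linear[OF c s(2)] by (simp add: has_vector_derivative_def linear_scale mult.commute)
  then have "dt c (\<sigma> s) ?v = vector_derivative (\<lambda>_. a) (at s within {u..v})"
    using vector_derivative_within_closed_interval[OF uv s(1)] by metis
  also have "\<dots> = 0"
    using vector_derivative_within_closed_interval[OF uv s(1) has_vector_derivative_const] by metis
  finally show ?thesis .
qed

text \<open>Near each time the lift is the jointly C^1 flow, in coordinates of time and chart, after
  the curve \<open>(\<phi>, \<sigma>)\<close>. Its velocity splits into a part along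
  \<open>X\<close> and the image of the velocity of \<open>\<sigma>\<close>.\<close>

lemma lift_C1:
  assumes \<sigma>: "C1_curve_on A \<sigma> u v" and uv: "u < v"
    and \<phi>: "\<And>s. s \<in> {u..v} \<Longrightarrow> (\<phi> has_vector_derivative \<phi>' s) (at s within {u..v})" and \<phi>': "continuous_on {u..v} \<phi>'"
  shows "C1_curve_on A (\<lambda>s. F (\<phi> s) (\<sigma> s)) u v"
    and "\<And>s c d. s \<in> {u..v} \<Longrightarrow> c \<in> A \<Longrightarrow> d \<in> A \<Longrightarrow> \<sigma> s \<in> cdom c \<Longrightarrow> F (\<phi> s) (\<sigma> s) \<in> cdom d \<Longrightarrow>
      velocity (\<lambda>s. F (\<phi> s) (\<sigma> s)) {u..v} d s
        = \<phi>' s *\<^sub>R X d (F (\<phi> s) (\<sigma> s)) + dF c d (\<phi> s) (\<sigma> s) (velocity \<sigma> {u..v} c s)"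
proof -
  let ?\<gamma> = "\<lambda>s. F (\<phi> s) (\<sigma> s)"
  have \<phi>c: "continuous_on {u..v} \<phi>"
    using \<phi> has_vector_derivative_continuous continuous_on_eq_continuous_within by blast
  note \<sigma>c = C1_curve_on_continuous[OF \<sigma>]
  have cont: "continuous_on {u..v} ?\<gamma>"
    using continuous_on_compose2[OF F_continuous continuous_on_Pair[OF \<phi>c \<sigma>c]] by simp
  let ?H = "\<lambda>c d z. cmap d (F (fst z) (cinv c (snd z)))"
  let ?h = "\<lambda>c s. (\<phi> s, cmap c (\<sigma> s))"
  let ?h' = "\<lambda>c s. (\<phi>' s, velocity \<sigma> {u..v} c s)"
  have d: "((\<lambda>s. cmap d (?\<gamma> s)) has_vector_derivative frechet_derivative (?H c d) (at (?h c s)) (?h' c s)) (at s within {u..v})"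
    if s: "s \<in> {u..v}" and cd: "c \<in> A" "d \<in> A" and x: "\<sigma> s \<in> cdom c" "?\<gamma> s \<in> cdom d" for s c d
  proof -
    have D: "(?H c d has_derivative frechet_derivative (?H c d) (at (?h c s))) (at (?h c s))"
      by (rule C1map_has_derivative[OF flow_C1[OF cd(1)] cd(2)]) (use x cd in auto)
    have "(?h c has_derivative (\<lambda>r. r *\<^sub>R ?h' c s)) (at s within {u..v})"
      using has_derivative_Pair[OF \<phi>[OF s, unfolded has_vector_derivative_def]
          C1_curve_on_derivative[OF \<sigma> uv cd(1) s x(1), unfolded has_vector_derivative_def]] by simp
    from has_derivative_compose[OF this D]
    have "((\<lambda>s. ?H c d (?h c s)) has_vector_derivative frechet_derivative (?H c d) (at (?h c s)) (?h' c s)) (at s within {u..v})"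
      unfolding has_vector_derivative_def linear_scale[OF has_derivative_linear[OF D]] .
    moreover have "\<forall>\<^sub>F x in at s within {u..v}. \<sigma> x \<in> cdom c"
      using \<sigma>c s x(1) open_cdom[OF cd(1)] unfolding continuous_on_def by (metis topological_tendstoD)
    then have "\<forall>\<^sub>F x in at s within {u..v}. ?H c d (?h c x) = cmap d (?\<gamma> x)"
      by eventually_elim (use cd in simp)
    ultimately show ?thesis
      unfolding has_vector_derivative_def by (rule has_derivative_transform_eventually) (use cd s x in auto)
  qed
  show "velocity ?\<gamma> {u..v} d s = \<phi>' s *\<^sub>R X d (?\<gamma> s) + dF c d (\<phi> s) (\<sigma> s) (velocity \<sigma> {u..v} c s)"
    if "s \<in> {u..v}" "c \<in> A" "d \<in> A" "\<sigma> s \<in> cdom c" "?\<gamma> s \<in> cdom d" for s c d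
    using velocity_eq[OF uv that(1) d[OF that]] flow_total_derivative[OF that(2,3,4,5)] by simp
  show "C1_curve_on A ?\<gamma> u v"
  proof (rule C1_curve_onI[OF uv cont])
    fix s0 d assume s0: "s0 \<in> {u..v}" "d \<in> A" "?\<gamma> s0 \<in> cdom d"
    obtain c where c: "c \<in> A" "\<sigma> s0 \<in> cdom c" by (rule chart_at)
    obtain U where "open U" and "U \<inter> {u..v} = ?\<gamma> -` cdom d \<inter> {u..v}"
      using cont open_cdom[OF s0(2)] unfolding continuous_on_open_invariant by blast
    then have U: "s \<in> U \<longleftrightarrow> ?\<gamma> s \<in> cdom d" if "s \<in> {u..v}" for s using that by blast
    obtain V where "open V" and "V \<inter> {u..v} = \<sigma> -` cdom c \<inter> {u..v}"
      using \<sigma>c open_cdom[OF c(1)] unfolding continuous_on_open_invariant by blast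
    then have V: "s \<in> V \<longleftrightarrow> \<sigma> s \<in> cdom c" if "s \<in> {u..v}" for s using that by blast
    show "\<exists>U D. open U \<and> s0 \<in> U \<and> (\<forall>s\<in>{u..v} \<inter> U. ((\<lambda>s. cmap d (?\<gamma> s)) has_vector_derivative D s) (at s within {u..v}))
        \<and> continuous_on ({u..v} \<inter> U) D"
    proof (intro exI conjI ballI)
      show "open (U \<inter> V)" using \<open>open U\<close> \<open>open V\<close> by (rule open_Int)
      show "s0 \<in> U \<inter> V" using U V s0 c by blast
      show "((\<lambda>s. cmap d (?\<gamma> s)) has_vector_derivative frechet_derivative (?H c d) (at (?h c s)) (?h' c s)) (at s within {u..v})"
        if "s \<in> {u..v} \<inter> (U \<inter> V)" for s
        by (rule d) (use that U V s0(2) c(1) in auto)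
      have "continuous_on ({u..v} \<inter> (U \<inter> V)) (\<lambda>s. cmap c (\<sigma> s))"
        by (rule continuous_on_compose2[OF cmap_continuous[OF c(1)] continuous_on_subset[OF \<sigma>c]]) (use V in auto)
      moreover have "continuous_on ({u..v} \<inter> (U \<inter> V)) (velocity \<sigma> {u..v} c)"
        by (rule continuous_on_subset[OF C1_curve_on_velocity_continuous[OF \<sigma> uv c(1)]]) (use V in auto)
      ultimately show "continuous_on ({u..v} \<inter> (U \<inter> V)) (\<lambda>s. frechet_derivative (?H c d) (at (?h c s)) (?h' c s))"
        by (intro continuous_on_frechet_derivative[OF C1map_Ck[OF flow_C1[OF c(1)] s0(2)]] continuous_on_Pair
            continuous_on_subset[OF \<phi>c] continuous_on_subset[OF \<phi>'])
          (use U V c(1) in auto)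
    qed
  qed
qed

section \<open>Short curves in level sets\<close>

text \<open>This compares the manifold topology with the distance in the level set, in the direction
  needed at a limit point: coordinate segments near \<open>p\<close> are pushed into the level set,
  and their lengths are bounded by the size of the coordinate ball.\<close>

lemma short_curves:
  assumes p: "t p = a" and e: "e > 0"
  obtains U where "open U" "p \<in> U" "\<And>y. y \<in> U \<Longrightarrow> t y = a \<Longrightarrow> riem_dist A g (level_set t a) y p < ennreal e"
proof -
  obtain c where c: "c \<in> A" "p \<in> cdom c" by (rule chart_at)
  \<comment> \<open>Flowing for the missing time \<open>a - t\<close> projects a neighbourhood onto
    the level set and fixes its points.\<close>
  define P where "P = (\<lambda>y. F (a - t (cinv c y)) (cinv c y))"
  have "C1map A (cimg c) (\<lambda>y. F (fst (a - t (cinv c y), y)) (cinv c (snd (a - t (cinv c y), y))))"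
    by (rule C1map_compose[OF flow_C1[OF c(1)] open_cimg[OF c(1)]
          Ck_on_Pair[OF open_cimg[OF c(1)] Ck_on_minus[OF open_cimg[OF c(1)] Ck_on_const t_Ck[OF c(1)]] Ck_on_id]]) auto
  then have P: "C1map A (cimg c) P" by (simp add: P_def)
  have tP: "t (P y) = a" for y by (simp add: P_def t_F)
  have Pid: "P (cmap c x) = x" if "x \<in> cdom c" "t x = a" for x using c(1) that F_0 by (simp add: P_def)
  define p0 where "p0 = cmap c p"
  define Q where "Q = {y\<in>cimg c. P y \<in> cdom c}"
  have Q: "open Q" "p0 \<in> Q" unfolding Q_def p0_def using C1map_open_dom[OF P c(1)] Pid[OF c(2) p] c by auto
  have \<psi>: "Ck_on 1 Q (\<lambda>y. cmap c (P y))" unfolding Q_def by (rule C1map_Ck[OF P c(1)])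
  obtain r where r: "r > 0" "cball p0 r \<subseteq> Q" using Q open_contains_cball by blast
  obtain L where L: "L > 0" "\<And>y v. y \<in> cball p0 r \<Longrightarrow> norm (frechet_derivative (\<lambda>y. cmap c (P y)) (at y) v) \<le> L * norm v"
    using C1_lipschitz_cball[OF \<psi> r(2)] by metis
  have PQ: "continuous_on (cball p0 r) P"
    by (rule continuous_on_subset[OF C1map_continuous[OF P]]) (use r(2) in \<open>auto simp: Q_def\<close>)
  have "\<exists>K\<ge>0. \<forall>y\<in>cball p0 r. \<bar>g c (P y) b b'\<bar> \<le> K" for b b'
  proof -
    have "continuous_on (cball p0 r) (\<lambda>y. g c (P y) b b')"
      by (intro metric_continuous[OF c(1) PQ] continuous_on_const) (use r(2) in \<open>auto simp: Q_def\<close>)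
    then have "bounded ((\<lambda>y. g c (P y) b b') ` cball p0 r)"
      by (intro compact_imp_bounded compact_continuous_image) auto
    then obtain K where "\<forall>x\<in>(\<lambda>y. g c (P y) b b') ` cball p0 r. norm x \<le> K" using bounded_iff by metis
    then show ?thesis by (intro exI[of _ "max K 0"]) auto
  qed
  then obtain K where K: "\<And>b b'. K b b' \<ge> 0" "\<And>b b' y. y \<in> cball p0 r \<Longrightarrow> \<bar>g c (P y) b b'\<bar> \<le> K b b'" by metis
  \<comment> \<open>A bound for the quadratic form of the metric over the ball, obtained from bounds
    \<open>K\<close> for the coefficients.\<close>
  define M where "M = (\<Sum>b\<in>Basis. \<Sum>b'\<in>Basis. K b b')"
  have M0: "M \<ge> 0" unfolding M_def by (intro sum_nonneg K)
  have M: "g c (P y) w w \<le> M * (norm w)\<^sup>2" if y: "y \<in> cball p0 r" for y w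
  proof -
    have "P y \<in> cdom c" using y r(2) by (auto simp: Q_def)
    then have "g c (P y) w w = (\<Sum>b\<in>Basis. \<Sum>b'\<in>Basis. (w \<bullet> b) * (w \<bullet> b') * g c (P y) b b')"
      using bilinear_basis_expand[OF metric_bilinear[OF c(1)]] by blast
    also have "\<dots> \<le> (\<Sum>b\<in>Basis. \<Sum>b'\<in>Basis. (norm w)\<^sup>2 * K b b')"
    proof (intro sum_mono)
      fix b b' :: 'b assume b: "b \<in> Basis" "b' \<in> Basis"
      have "(w \<bullet> b) * (w \<bullet> b') * g c (P y) b b' \<le> \<bar>w \<bullet> b\<bar> * \<bar>w \<bullet> b'\<bar> * \<bar>g c (P y) b b'\<bar>"
        by (metis abs_ge_self abs_mult)
      also have "\<dots> \<le> norm w * norm w * K b b'"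
        using K y b by (intro mult_mono Basis_le_norm) auto
      finally show "(w \<bullet> b) * (w \<bullet> b') * g c (P y) b b' \<le> (norm w)\<^sup>2 * K b b'" by (simp add: power2_eq_square)
    qed
    finally show ?thesis by (simp add: M_def sum_distrib_left sum_distrib_right mult.commute)
  qed
  \<comment> \<open>Makes the length bound \<open>sqrt M * (L * \<rho>)\<close> at most
    \<open>e / 2\<close>; the summand 1 keeps the denominator positive when \<open>M\<close> is
    0.\<close>
  define \<rho> where "\<rho> = min r (e / (2 * (sqrt M * L + 1)))"
  have sML: "sqrt M * L \<ge> 0" using M0 L by simp
  have \<rho>: "\<rho> > 0" "\<rho> \<le> r" using r e sML by (auto simp: \<rho>_def)
  have "sqrt M * (L * \<rho>) \<le> (sqrt M * L) * (e / (2 * (sqrt M * L + 1)))"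
    unfolding mult.assoc[symmetric] \<rho>_def using sML by (intro mult_left_mono) auto
  also have "\<dots> \<le> e / 2" using sML e by (simp add: field_simps)
  finally have small: "sqrt M * (L * \<rho>) < e" using e by linarith
  define U where "U = cinv c ` ball p0 \<rho>"
  have "ball p0 \<rho> \<subseteq> cball p0 r" using \<rho> by auto
  then have bsub: "ball p0 \<rho> \<subseteq> cimg c" using r(2) unfolding Q_def by blast
  show ?thesis
  proof (rule that[of U])
    show "open U" unfolding U_def by (rule open_cinv_image[OF c(1) open_ball bsub])
    show "p \<in> U" unfolding U_def using c \<rho> by (intro image_eqI[of _ _ p0]) (auto simp: p0_def)
    fix y assume y: "y \<in> U" "t y = a"
    obtain y0 where y0: "y = cinv c y0" "y0 \<in> ball p0 \<rho>" using y(1) by (auto simp: U_def simp del: mem_ball)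
    have y0c: "y0 \<in> cimg c" using bsub y0 by blast
    have yc: "y \<in> cdom c" "cmap c y = y0" using y0 y0c c(1) by auto
    define h where "h = (\<lambda>s::real. y0 + s *\<^sub>R (p0 - y0))"
    define \<beta> where "\<beta> = (\<lambda>s. P (h s))"
    have hin: "h s \<in> ball p0 \<rho>" if "s \<in> {0..1}" for s
    proof -
      have "h s = (1 - s) *\<^sub>R y0 + s *\<^sub>R p0" by (simp add: h_def algebra_simps)
      moreover have "p0 \<in> ball p0 \<rho>" using \<rho> by simp
      ultimately show ?thesis using convex_ball[of p0 \<rho>] y0(2) that unfolding convex_alt by (metis atLeastAtMost_iff)
    qed
    have hd: "(h has_vector_derivative (p0 - y0)) (at s within I)" for s I
      unfolding h_def by (auto intro!: derivative_eq_intros)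
    have curve: "C1_curve_on A \<beta> u v" "s \<in> {u..v} \<Longrightarrow> d \<in> A \<Longrightarrow> \<beta> s \<in> cdom d \<Longrightarrow>
        velocity \<beta> {u..v} d s = frechet_derivative (\<lambda>z. cmap d (P z)) (at (h s)) (p0 - y0)"
      if "u < v" "{u..v} \<subseteq> {0..1}" for u v s d
    proof -
      have "h ` {u..v} \<subseteq> cimg c" using hin bsub that(2) by blast
      note * = C1map_curve[where h=h and h'="\<lambda>_. p0 - y0", OF P that(1) hd continuous_on_const this]
      show "C1_curve_on A \<beta> u v" unfolding \<beta>_def by (rule *(1))
      show "s \<in> {u..v} \<Longrightarrow> d \<in> A \<Longrightarrow> \<beta> s \<in> cdom d \<Longrightarrow>
        velocity \<beta> {u..v} d s = frechet_derivative (\<lambda>z. cmap d (P z)) (at (h s)) (p0 - y0)"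
        unfolding \<beta>_def by (rule *(2))
    qed
    have C: "C1_curve_on A \<beta> 0 1" by (rule curve(1)) auto
    have pc: "piecewise_C1_curve A {0..1} {} \<beta>"
      unfolding piecewise_C1_curve_def piece_def
    proof (intro conjI allI impI)
      show "is_interval {0..1::real}" by (rule is_interval_cc)
      show "\<exists>a\<in>{0..1::real}. \<exists>b\<in>{0..1}. a < b" by (intro bexI[of _ 0] bexI[of _ 1]) auto
      show "continuous_on {0..1} \<beta>" by (rule C1_curve_on_continuous[OF C])
    qed (use curve(1) in auto)
    have \<beta>01: "\<beta> 0 = y" "\<beta> 1 = p"
      using Pid[OF yc(1) y(2)] Pid[OF c(2) p] yc(2) by (auto simp: \<beta>_def h_def p0_def)
    have "\<beta> ` {0..1} \<subseteq> level_set t a" using tP by (auto simp: \<beta>_def level_set_def)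
    then have "riem_dist A g (level_set t a) y p \<le> ennreal (integral {0..1} (speed A g \<beta>))"
      unfolding riem_dist_def using pc \<beta>01 by (intro INF_lower) auto
    also have "integral {0..1} (speed A g \<beta>) = integral {0..1} (piece_speed \<beta> 0 1)"
      by (rule speed_integrable_piece(2)[OF C]) simp
    also have "\<dots> \<le> integral {0..1} (\<lambda>_::real. sqrt M * (L * \<rho>))"
    proof (rule integral_le)
      show "piece_speed \<beta> 0 1 integrable_on {0..1}"
        by (rule integrable_continuous_real[OF piece_speed_continuous[OF C]]) simp
      fix s :: real assume s: "s \<in> {0..1}"
      have hr: "h s \<in> cball p0 r" using hin[OF s] \<rho>(2) by auto
      then have \<beta>c: "\<beta> s \<in> cdom c" using r(2) by (auto simp: \<beta>_def Q_def)
      let ?w = "velocity \<beta> {0..1} c s"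
      have "norm ?w \<le> L * norm (p0 - y0)"
        using curve(2)[of 0 1 s c] s c(1) \<beta>c L(2)[OF hr] by simp
      also have "\<dots> \<le> L * \<rho>" using y0(2) L(1) by (intro mult_left_mono) (auto simp: dist_norm)
      finally have nw: "norm ?w \<le> L * \<rho>" .
      have "g c (\<beta> s) ?w ?w \<le> M * (norm ?w)\<^sup>2" unfolding \<beta>_def by (rule M[OF hr])
      also have "\<dots> \<le> M * (L * \<rho>)\<^sup>2" using nw M0 by (intro mult_left_mono power_mono) auto
      finally have "sqrt (g c (\<beta> s) ?w ?w) \<le> sqrt (M * (L * \<rho>)\<^sup>2)" by (rule real_sqrt_le_mono)
      also have "\<dots> = sqrt M * (L * \<rho>)" using L(1) \<rho>(1) by (simp add: real_sqrt_mult)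
      finally show "piece_speed \<beta> 0 1 s \<le> sqrt M * (L * \<rho>)"
        using piece_speed_eq[OF C _ c(1) s \<beta>c] by simp
    qed auto
    also have "\<dots> = sqrt M * (L * \<rho>)" by simp
    finally have "riem_dist A g (level_set t a) y p \<le> ennreal (sqrt M * (L * \<rho>))"
      by (meson ennreal_leI order_trans)
    also have "\<dots> < ennreal e" using small e by (simp add: ennreal_lessI)
    finally show "riem_dist A g (level_set t a) y p < ennreal e" .
  qed
qed

end

section \<open>Completeness of the level sets\<close>

context sm_cauchy_manifold
begin

lemma riem_dist_lessE:
  assumes "riem_dist A g S p q < ennreal e"
  obtains B \<sigma> where "piecewise_C1_curve A {0..1} B \<sigma>" "\<sigma> ` {0..1} \<subseteq> S" "\<sigma> 0 = p" "\<sigma> 1 = q"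
    "integral {0..1} (speed A g \<sigma>) < e"
proof -
  obtain \<sigma> where \<sigma>: "\<exists>B. piecewise_C1_curve A {0..1} B \<sigma>" "\<sigma> ` {0..1} \<subseteq> S" "\<sigma> 0 = p" "\<sigma> 1 = q"
    "ennreal (integral {0..1} (speed A g \<sigma>)) < ennreal e"
    using assms unfolding riem_dist_def INF_less_iff by blast
  have "integral {0..1} (speed A g \<sigma>) < e"
  proof (rule ccontr)
    assume "\<not> ?thesis"
    then have "ennreal e \<le> ennreal (integral {0..1} (speed A g \<sigma>))" by (intro ennreal_leI) simp
    then show False using \<sigma>(5) by simp
  qed
  then show ?thesis using that \<sigma>(1-4) by blast
qed

lemma piece_speed_level:
  assumes \<sigma>: "C1_curve_on A \<sigma> u v" and uv: "u < v" and lev: "\<And>s. s \<in> {u..v} \<Longrightarrow> t (\<sigma> s) = a"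
    and s: "s \<in> {u..v}" and c: "c \<in> A" "\<sigma> s \<in> cdom c"
  shows "piece_speed \<sigma> u v s \<ge> 0" "(piece_speed \<sigma> u v s)\<^sup>2 = g c (\<sigma> s) (velocity \<sigma> {u..v} c s) (velocity \<sigma> {u..v} c s)"
proof -
  have "g c (\<sigma> s) (N c (\<sigma> s)) (velocity \<sigma> {u..v} c s) = 0"
    using N_eq[OF c] level_curve_dt[OF \<sigma> uv c(1) s c(2) lev] by simp
  from lorentz_form_orthogonal_nonneg[OF metric_form[OF c] N_timelike[OF c] this]
  show "piece_speed \<sigma> u v s \<ge> 0" "(piece_speed \<sigma> u v s)\<^sup>2 = g c (\<sigma> s) (velocity \<sigma> {u..v} c s) (velocity \<sigma> {u..v} c s)"
    using piece_speed_eq[OF \<sigma> uv c(1) s c(2)] by auto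
qed

text \<open>Away from break points and ends the velocity is tangent to the level set, where
  \<open>g\<close> is nonnegative. At the finitely many other points the two-sided velocity may be
  an arbitrary vector and \<open>speed\<close> even negative.\<close>

lemma integral_abs_speed:
  assumes pc: "piecewise_C1_curve A {0..1} B \<sigma>" and lev: "\<And>s. s \<in> {0..1} \<Longrightarrow> t (\<sigma> s) = a"
  shows "integral {0..1} (\<lambda>s. \<bar>speed A g \<sigma> s\<bar>) = integral {0..1} (speed A g \<sigma>)"
proof (rule integral_spike[of "(B \<inter> {0..1}) \<union> {0, 1}"])
  have fin: "finite ((B \<inter> {0..1}) \<union> {0, 1})" using pc by (auto simp: piecewise_C1_curve_def)
  then show "negligible ((B \<inter> {0..1}) \<union> {0, 1})" by (rule negligible_finite)
  fix s assume s: "s \<in> {0..1} - ((B \<inter> {0..1}) \<union> {0, 1})"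
  obtain d where d: "d > 0" "\<And>y. \<bar>y - s\<bar> < d \<Longrightarrow> y \<noteq> s \<Longrightarrow> y \<notin> (B \<inter> {0..1}) \<union> {0, 1}"
    using finite_gap[OF fin, of s] by blast
  define u v where "u = max 0 (s - d/2)" and "v = min 1 (s + d/2)"
  have uv: "0 \<le> u" "u < s" "s < v" "v \<le> 1" using s d(1) by (auto simp: u_def v_def)
  have "y \<notin> B" if "u < y" "y < v" for y
  proof -
    have "\<bar>y - s\<bar> < d" using that d(1) by (auto simp: u_def v_def abs_less_iff)
    then show ?thesis using d(2)[of y] s that uv by (cases "y = s") auto
  qed
  then have p: "piece {0..1} B u v" using uv by (auto simp: piece_def)
  then have C: "C1_curve_on A \<sigma> u v" using pc by (auto simp: piecewise_C1_curve_def)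
  obtain c where c: "c \<in> A" "\<sigma> s \<in> cdom c" by (rule chart_at)
  have "piece_speed \<sigma> u v s \<ge> 0"
    by (rule piece_speed_level(1)[OF C _ _ _ c, of a]) (use uv lev in auto)
  then show "speed A g \<sigma> s = \<bar>speed A g \<sigma> s\<bar>" using speed_eq_piece_speed[of s u v \<sigma>] uv by simp
qed

text \<open>\<open>\<Phi>\<close> is the time already spent by earlier curves. The absolute value
  keeps the integrand positive at break points too, where \<open>speed\<close> carries no
  information.\<close>

definition lift_time :: "real \<Rightarrow> real \<Rightarrow> real \<Rightarrow> (real \<Rightarrow> 'a) \<Rightarrow> real \<Rightarrow> real" where
  "lift_time \<kappa> \<mu> \<Phi> \<sigma> s = \<Phi> + integral {0..s} (\<lambda>r. \<kappa> * \<bar>speed A g \<sigma> r\<bar> + \<mu>)"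

text \<open>The conclusion of \<open>flow_growth\<close> as a predicate, so that it can be assumed
  of a given \<open>\<kappa>\<close>: climbing at a rate of at least \<open>\<kappa>\<close> times
  the speed of a curve in \<open>{t = a}\<close> yields a causal lift as long as the lift time stays
  in \<open>{0..1}\<close>.\<close>

definition is_lift_factor :: "real \<Rightarrow> real \<Rightarrow> bool" where
  "is_lift_factor a \<kappa> \<longleftrightarrow> \<kappa> > 0 \<and> (\<forall>c d x \<tau> w. c \<in> A \<longrightarrow> d \<in> A \<longrightarrow> x \<in> cdom c \<longrightarrow> F \<tau> x \<in> cdom d \<longrightarrow>
     t x = a \<longrightarrow> \<tau> \<in> {0..1} \<longrightarrow> dt c x w = 0 \<longrightarrow>
     - lapse d (F \<tau> x) * g d (F \<tau> x) (dF c d \<tau> x w) (dF c d \<tau> x w) \<le> \<kappa>\<^sup>2 * g c x w w)"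

lemma lift_factor_exists: "\<exists>\<kappa>. is_lift_factor a \<kappa>"
  by (rule flow_growth[of a]) (unfold is_lift_factor_def, blast)

section \<open>The lift of a single curve in a level set\<close>

context
  fixes a \<kappa> \<mu> \<Phi> :: real and B :: "real set" and \<sigma> :: "real \<Rightarrow> 'a"
  assumes pc: "piecewise_C1_curve A {0..1} B \<sigma>" and lev: "\<And>s. s \<in> {0..1} \<Longrightarrow> t (\<sigma> s) = a"
    and \<kappa>: "is_lift_factor a \<kappa>" and \<mu>: "\<mu> > 0" and \<Phi>: "\<Phi> \<ge> 0"
    and le1: "\<Phi> + (\<kappa> * integral {0..1} (speed A g \<sigma>) + \<mu>) \<le> 1"
begin

lemma scaled_speed_integrable: "(\<lambda>r. \<kappa> * \<bar>speed A g \<sigma> r\<bar>) integrable_on {0..1}"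
  using integrable_cmul[OF speed_integrable[OF pc], of \<kappa>] by simp

lemma lift_integrand_integrable: "(\<lambda>r. \<kappa> * \<bar>speed A g \<sigma> r\<bar> + \<mu>) integrable_on {0..1}"
  using integrable_add[OF scaled_speed_integrable integrable_const_ivl] .

lemma lift_time_0: "lift_time \<kappa> \<mu> \<Phi> \<sigma> 0 = \<Phi>"
  by (simp add: lift_time_def)

lemma lift_time_1: "lift_time \<kappa> \<mu> \<Phi> \<sigma> 1 = \<Phi> + (\<kappa> * integral {0..1} (speed A g \<sigma>) + \<mu>)"
proof -
  have \<mu>i: "(\<lambda>r::real. \<mu>) integrable_on {0..1}" by (rule integrable_const_ivl)
  have "integral {0..1} (\<lambda>r. \<kappa> * \<bar>speed A g \<sigma> r\<bar> + \<mu>)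
    = integral {0..1} (\<lambda>r. \<kappa> * \<bar>speed A g \<sigma> r\<bar>) + integral {0..1} (\<lambda>r::real. \<mu>)"
    by (rule Henstock_Kurzweil_Integration.integral_add[OF scaled_speed_integrable \<mu>i])
  then show ?thesis using integral_abs_speed[OF pc lev] by (simp add: lift_time_def)
qed

lemma lift_time_diff:
  assumes "0 \<le> u" "u \<le> s" "s \<le> 1"
  shows "lift_time \<kappa> \<mu> \<Phi> \<sigma> s = lift_time \<kappa> \<mu> \<Phi> \<sigma> u + integral {u..s} (\<lambda>r. \<kappa> * \<bar>speed A g \<sigma> r\<bar> + \<mu>)"
proof -
  have "(\<lambda>r. \<kappa> * \<bar>speed A g \<sigma> r\<bar> + \<mu>) integrable_on {0..s}"
    by (rule integrable_subinterval_real[OF lift_integrand_integrable]) (use assms in auto)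
  from Henstock_Kurzweil_Integration.integral_combine[OF assms(1,2) this]
  show ?thesis by (simp add: lift_time_def)
qed

text \<open>The integrand is nonnegative, so the lift time increases from \<open>\<Phi>\<close> to
  its value at 1, which \<open>le1\<close> bounds by 1. Hence the lift stays in the slab where
  \<open>\<kappa>\<close> is a valid factor.\<close>

lemma lift_time_range:
  assumes "s \<in> {0..1}" shows "lift_time \<kappa> \<mu> \<Phi> \<sigma> s \<in> {0..1}"
proof -
  have mono: "lift_time \<kappa> \<mu> \<Phi> \<sigma> u \<le> lift_time \<kappa> \<mu> \<Phi> \<sigma> s" if "0 \<le> u" "u \<le> s" "s \<le> 1" for u s
  proof -
    have "0 \<le> integral {u..s} (\<lambda>r. \<kappa> * \<bar>speed A g \<sigma> r\<bar> + \<mu>)"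
      by (rule Henstock_Kurzweil_Integration.integral_nonneg[OF integrable_subinterval_real[OF lift_integrand_integrable]])
        (use that \<mu> \<kappa> in \<open>auto simp: is_lift_factor_def intro!: add_nonneg_nonneg\<close>)
    then show ?thesis using lift_time_diff[OF that] by simp
  qed
  have "lift_time \<kappa> \<mu> \<Phi> \<sigma> 1 \<le> 1" using lift_time_1 le1 by simp
  then show ?thesis using mono[of 0 s] mono[of s 1] assms lift_time_0 \<Phi> by auto
qed

lemma lift_continuous: "continuous_on {0..1} (\<lambda>s. F (lift_time \<kappa> \<mu> \<Phi> \<sigma> s) (\<sigma> s))"
proof -
  have "continuous_on {0..1} (lift_time \<kappa> \<mu> \<Phi> \<sigma>)"
    unfolding lift_time_def by (intro continuous_intros indefinite_integral_continuous_1 lift_integrand_integrable)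
  moreover have "continuous_on {0..1} \<sigma>" using pc by (simp add: piecewise_C1_curve_def)
  ultimately show ?thesis using continuous_on_compose2[OF F_continuous continuous_on_Pair] by fastforce
qed

text \<open>The rate of climbing exceeds \<open>\<kappa>\<close> times the speed of
  \<open>\<sigma>\<close>; with the growth estimate this is exactly what \<open>causal_lift\<close>
  asks of the two parts of the velocity.\<close>

lemma lift_piece:
  assumes p: "piece {0..1} B u v"
  shows "C1_curve_on A (\<lambda>s. F (lift_time \<kappa> \<mu> \<Phi> \<sigma> s) (\<sigma> s)) u v"
    and "\<And>s d. s \<in> {u..v} \<Longrightarrow> d \<in> A \<Longrightarrow> F (lift_time \<kappa> \<mu> \<Phi> \<sigma> s) (\<sigma> s) \<in> cdom d \<Longrightarrow>
      causal (g d (F (lift_time \<kappa> \<mu> \<Phi> \<sigma> s) (\<sigma> s))) (velocity (\<lambda>s. F (lift_time \<kappa> \<mu> \<Phi> \<sigma> s) (\<sigma> s)) {u..v} d s)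
      \<and> future_directed g T d (F (lift_time \<kappa> \<mu> \<Phi> \<sigma> s) (\<sigma> s)) (velocity (\<lambda>s. F (lift_time \<kappa> \<mu> \<Phi> \<sigma> s) (\<sigma> s)) {u..v} d s)"
proof -
  let ?\<phi> = "lift_time \<kappa> \<mu> \<Phi> \<sigma>"
  have uv: "u < v" "{u..v} \<subseteq> {0..1}" using p by (auto simp: piece_def)
  then have uv01: "0 \<le> u" "v \<le> 1" by auto
  have C: "C1_curve_on A \<sigma> u v" using pc p by (auto simp: piecewise_C1_curve_def)
  have \<kappa>0: "\<kappa> > 0" using \<kappa> by (simp add: is_lift_factor_def)
  \<comment> \<open>With \<open>piece_speed\<close> the rate is continuous up to the ends of the
    piece, so the lift time is C^1 there; compared with \<open>speed\<close> the integrand changes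
    at two points at most.\<close>
  define \<phi>' where "\<phi>' = (\<lambda>s. \<kappa> * \<bar>piece_speed \<sigma> u v s\<bar> + \<mu>)"
  have c\<phi>': "continuous_on {u..v} \<phi>'"
    unfolding \<phi>'_def by (intro continuous_intros piece_speed_continuous[OF C uv(1)])
  have eq: "?\<phi> s = ?\<phi> u + integral {u..s} \<phi>'" if s: "s \<in> {u..v}" for s
  proof -
    have "integral {u..s} (\<lambda>r. \<kappa> * \<bar>speed A g \<sigma> r\<bar> + \<mu>) = integral {u..s} \<phi>'"
      by (rule integral_spike[of "{u, v}"])
        (use s speed_eq_piece_speed[of _ u v \<sigma>] in \<open>auto simp: \<phi>'_def\<close>)
    then show ?thesis using lift_time_diff[of u s] s uv01 by simp
  qed
  have d\<phi>: "(?\<phi> has_vector_derivative \<phi>' s) (at s within {u..v})" if s: "s \<in> {u..v}" for s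
  proof -
    have "((\<lambda>s. ?\<phi> u + integral {u..s} \<phi>') has_vector_derivative 0 + \<phi>' s) (at s within {u..v})"
      by (intro has_vector_derivative_add has_vector_derivative_const integral_has_vector_derivative c\<phi>' s)
    then have "((\<lambda>s. ?\<phi> u + integral {u..s} \<phi>') has_vector_derivative \<phi>' s) (at s within {u..v})" by simp
    then show ?thesis by (rule has_vector_derivative_transform[OF s eq, rotated])
  qed
  show "C1_curve_on A (\<lambda>s. F (?\<phi> s) (\<sigma> s)) u v" by (rule lift_C1(1)[OF C uv(1) d\<phi> c\<phi>'])
  fix s d assume s: "s \<in> {u..v}" and d: "d \<in> A" "F (?\<phi> s) (\<sigma> s) \<in> cdom d"
  obtain c where c: "c \<in> A" "\<sigma> s \<in> cdom c" by (rule chart_at)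
  let ?w = "velocity \<sigma> {u..v} c s" and ?p = "F (?\<phi> s) (\<sigma> s)"
  have lev': "t (\<sigma> r) = a" if "r \<in> {u..v}" for r using lev uv(2) that by blast
  have w0: "dt c (\<sigma> s) ?w = 0" by (rule level_curve_dt[OF C uv(1) c(1) s c(2) lev'])
  have vel: "velocity (\<lambda>s. F (?\<phi> s) (\<sigma> s)) {u..v} d s = \<phi>' s *\<^sub>R X d ?p + dF c d (?\<phi> s) (\<sigma> s) ?w"
    by (rule lift_C1(2)[OF C uv(1) d\<phi> c\<phi>' s c(1) d(1) c(2) d(2)])
  have ps: "piece_speed \<sigma> u v s \<ge> 0" "(piece_speed \<sigma> u v s)\<^sup>2 = g c (\<sigma> s) ?w ?w"
    using piece_speed_level[OF C uv(1) lev' s c] by auto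
  have W0: "dt d ?p (dF c d (?\<phi> s) (\<sigma> s) ?w) = 0"
    using dt_dF[OF c(1) d(1) c(2) d(2)] w0 by simp
  have pos: "\<phi>' s > 0" using \<kappa>0 \<mu> by (simp add: \<phi>'_def add_nonneg_pos)
  have "s \<in> {0..1}" using s uv(2) by blast
  then have "- lapse d ?p * g d ?p (dF c d (?\<phi> s) (\<sigma> s) ?w) (dF c d (?\<phi> s) (\<sigma> s) ?w) \<le> \<kappa>\<^sup>2 * g c (\<sigma> s) ?w ?w"
    using \<kappa> c d w0 lev'[OF s] lift_time_range[of s] unfolding is_lift_factor_def by blast
  also have "\<dots> = (\<kappa> * piece_speed \<sigma> u v s)\<^sup>2" using ps(2) by (simp add: power_mult_distrib)
  also have "\<dots> \<le> (\<phi>' s)\<^sup>2"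
    using ps(1) \<kappa>0 \<mu> by (intro power_mono) (auto simp: \<phi>'_def)
  finally show "causal (g d ?p) (velocity (\<lambda>s. F (?\<phi> s) (\<sigma> s)) {u..v} d s)
      \<and> future_directed g T d ?p (velocity (\<lambda>s. F (?\<phi> s) (\<sigma> s)) {u..v} d s)"
    unfolding vel using causal_lift[OF d W0 pos] by blast
qed

end

text \<open>The distances are matched to a time budget: \<open>\<kappa>\<close> times the length of
  the curve from \<open>Y k\<close> to \<open>Y (Suc k)\<close> is below \<open>(1/2)^(k+2)\<close>,
  and \<open>\<mu> k\<close> spends the same amount again, so this lift takes time at most
  \<open>(1/2)^(k+1)\<close>. All lifts together take at most time 1 and their infinite
  concatenation never leaves the slab.\<close>

lemma fast_sequence_converges:
  assumes \<kappa>: "is_lift_factor a \<kappa>" and Y: "\<And>k. t (Y k) = a"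
    and fast: "\<And>k. riem_dist A g (level_set t a) (Y k) (Y (Suc k)) < ennreal ((1/2)^(k+2) / \<kappa>)"
  obtains q where "t q = a" "Y \<longlonglongrightarrow> q"
proof -
  have \<kappa>0: "\<kappa> > 0" using \<kappa> by (simp add: is_lift_factor_def)
  have "\<exists>B \<sigma>. piecewise_C1_curve A {0..1} B \<sigma> \<and> \<sigma> ` {0..1} \<subseteq> level_set t a \<and> \<sigma> 0 = Y k \<and> \<sigma> 1 = Y (Suc k) \<and>
    integral {0..1} (speed A g \<sigma>) < (1/2)^(k+2) / \<kappa>" for k
    using riem_dist_lessE[OF fast[of k]] by metis
  then obtain B \<sigma> where pc: "\<And>k. piecewise_C1_curve A {0..1} (B k) (\<sigma> k)"
    and lv: "\<And>k. \<sigma> k ` {0..1} \<subseteq> level_set t a" and ends: "\<And>k. \<sigma> k 0 = Y k" "\<And>k. \<sigma> k 1 = Y (Suc k)"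
    and len: "\<And>k. integral {0..1} (speed A g (\<sigma> k)) < (1/2)^(k+2) / \<kappa>"
    by metis
  have lev: "t (\<sigma> k s) = a" if "s \<in> {0..1}" for k s
  proof -
    have "\<sigma> k s \<in> level_set t a" using lv[of k] that by blast
    then show ?thesis by (simp add: level_set_def)
  qed
  define \<mu> :: "nat \<Rightarrow> real" where "\<mu> k = (1/2)^(k+2)" for k
  define ll where "ll k = \<kappa> * integral {0..1} (speed A g (\<sigma> k)) + \<mu> k" for k
  define \<Phi> where "\<Phi> k = (\<Sum>j<k. ll j)" for k
  have \<mu>: "\<mu> k > 0" for k by (simp add: \<mu>_def)
  have ll: "0 \<le> ll k" "ll k \<le> (1/2)^(k+1)" for k
  proof -
    have "integral {0..1} (\<lambda>s. \<bar>speed A g (\<sigma> k) s\<bar>) \<ge> 0"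
      by (rule Henstock_Kurzweil_Integration.integral_nonneg[OF speed_integrable[OF pc[of k]]]) simp
    then have "integral {0..1} (speed A g (\<sigma> k)) \<ge> 0" using integral_abs_speed[OF pc lev] by simp
    then show "0 \<le> ll k" using \<kappa>0 \<mu>[of k] by (simp add: ll_def)
    have "\<kappa> * integral {0..1} (speed A g (\<sigma> k)) \<le> \<kappa> * ((1/2)^(k+2) / \<kappa>)"
      using len[of k] \<kappa>0 by (intro mult_left_mono) auto
    then show "ll k \<le> (1/2)^(k+1)" using \<kappa>0 by (simp add: ll_def \<mu>_def)
  qed
  have "\<Phi> k \<le> 1 - (1/2)^k" for k
  proof (induction k)
    case (Suc k)
    then show ?case using ll(2)[of k] by (simp add: \<Phi>_def)
  qed (simp add: \<Phi>_def)
  moreover have "1 - (1/2::real)^k \<le> 1" for k by simp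
  ultimately have \<Phi>1: "\<Phi> k \<le> 1" for k using order_trans by blast
  have \<Phi>0: "\<Phi> k \<ge> 0" for k unfolding \<Phi>_def by (intro sum_nonneg ll)
  have \<Phi>Suc: "\<Phi> (Suc k) = \<Phi> k + ll k" for k by (simp add: \<Phi>_def)
  define \<phi> where "\<phi> k = lift_time \<kappa> (\<mu> k) (\<Phi> k) (\<sigma> k)" for k
  have "\<Phi> k + (\<kappa> * integral {0..1} (speed A g (\<sigma> k)) + \<mu> k) \<le> 1" for k
    using \<Phi>1[of "Suc k"] by (simp add: \<Phi>Suc ll_def)
  note ctx = pc lev \<kappa> \<mu> \<Phi>0 this
  have \<phi>0: "\<phi> k 0 = \<Phi> k" and \<phi>1: "\<phi> k 1 = \<Phi> (Suc k)" for k
    using lift_time_0[OF ctx] lift_time_1[OF ctx] by (simp_all add: \<phi>_def \<Phi>Suc ll_def)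
  have \<phi>r: "\<phi> k s \<in> {0..1}" if "s \<in> {0..1}" for k s
    unfolding \<phi>_def by (rule lift_time_range[OF ctx that])
  define lf where "lf k s = F (\<phi> k s) (\<sigma> k s)" for k s
  have lf_cont: "continuous_on {0..1} (lf k)" for k
    unfolding lf_def \<phi>_def by (rule lift_continuous[OF ctx])
  have lf_C1: "C1_curve_on A (lf k) u v" if "piece {0..1} (B k) u v" for k u v
    using lift_piece(1)[OF ctx that] unfolding lf_def \<phi>_def .
  have lf_causal: "causal (g d (lf k s)) (velocity (lf k) {u..v} d s) \<and> future_directed g T d (lf k s) (velocity (lf k) {u..v} d s)"
    if "piece {0..1} (B k) u v" "s \<in> {u..v}" "d \<in> A" "lf k s \<in> cdom d" for k u v s d
    using lift_piece(2)[OF ctx that(1,2,3)] that(4) unfolding lf_def[abs_def] \<phi>_def by blast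
  \<comment> \<open>For positive parameters \<open>s\<close> is not \<open>t\<close>: the interval
    from \<open>k\<close> to \<open>k + 1\<close> carries the whole lift number \<open>k\<close>.
    Successive lifts meet at \<open>F (\<Phi> (Suc k)) (Y (Suc k))\<close>. Negative parameters
    follow the flow line of \<open>Y 0\<close> into the past.\<close>
  define \<gamma> where "\<gamma> s = (if s < 0 then F s (Y 0) else lf (nat \<lfloor>s\<rfloor>) (s - real (nat \<lfloor>s\<rfloor>)))" for s
  have \<gamma>k: "\<gamma> s = lf k (s - real k)" if s: "s \<in> {real k..real k + 1}" for k s
  \<comment> \<open>At the right end the floor already selects the next lift, which starts at the
    same point.\<close>
  proof (cases "s = real k + 1")
    case True
    have "nat \<lfloor>real k + 1\<rfloor> = Suc k" by linarith
    then show ?thesis unfolding True \<gamma>_def by (simp add: lf_def \<phi>0 \<phi>1 ends)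
  next
    case False
    then have "\<lfloor>s\<rfloor> = int k" using s by (intro floor_unique) auto
    then show ?thesis using s by (simp add: \<gamma>_def)
  qed
  have \<gamma>neg: "\<gamma> s = F s (Y 0)" if "s \<le> 0" for s
  proof (cases "s = 0")
    case True
    then show ?thesis using \<gamma>k[of 0 0] by (simp add: lf_def \<phi>0 ends \<Phi>_def)
  qed (use that in \<open>simp add: \<gamma>_def\<close>)
  \<comment> \<open>All natural numbers count as break points, so that no piece runs across 0 or
    across two lifts.\<close>
  define B' where "B' = range real \<union> (\<Union>k. (\<lambda>b. b + real k) ` (B k \<inter> {0..1}))"
  have finB: "finite (B' \<inter> {u..v})" for u v
  proof (rule finite_subset)
    let ?n = "nat \<lceil>v\<rceil>"
    show "finite (real ` {..?n} \<union> (\<Union>k\<in>{..?n}. (\<lambda>b. b + real k) ` (B k \<inter> {0..1})))"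
      using pc by (auto simp: piecewise_C1_curve_def)
    have "k \<le> ?n" if "real k \<le> v" for k using that by linarith
    then show "B' \<inter> {u..v} \<subseteq> real ` {..?n} \<union> (\<Union>k\<in>{..?n}. (\<lambda>b. b + real k) ` (B k \<inter> {0..1}))"
      unfolding B'_def by fastforce
  qed
  have pieces: "v \<le> 0 \<or> (\<exists>k. real k \<le> u \<and> v \<le> real k + 1 \<and> piece {0..1} (B k) (u - real k) (v - real k))"
    if p: "piece UNIV B' u v" for u v
  proof (cases "v \<le> 0")
    case False
    have uv: "u < v" and nB: "\<And>y. u < y \<Longrightarrow> y < v \<Longrightarrow> y \<notin> B'" using p by (auto simp: piece_def)
    have nat': "real k \<in> B'" for k by (auto simp: B'_def)
    have u0: "u \<ge> 0" using nB[of 0] nat'[of 0] False by (cases "u < 0") auto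
    define k where "k = nat \<lfloor>u\<rfloor>"
    have k: "real k \<le> u" "u < real k + 1" using u0 unfolding k_def by linarith+
    have v1: "v \<le> real k + 1" using nB[of "real k + 1"] nat'[of "Suc k"] k(2) by (auto simp: add.commute not_less[symmetric])
    have "b \<notin> B k" if "u - real k < b" "b < v - real k" for b
    proof
      assume "b \<in> B k"
      then have "b + real k \<in> B'" unfolding B'_def using that k v1 by (intro UnI2 UN_I[of k]) auto
      then show False using nB[of "b + real k"] that by simp
    qed
    then have "piece {0..1} (B k) (u - real k) (v - real k)" using uv k v1 by (auto simp: piece_def)
    then show ?thesis using k v1 by blast
  qed simp
  have cont: "continuous_on UNIV \<gamma>"
  proof (rule continuous_on_local)
    fix x :: real
    \<comment> \<open>Closed unit intervals are attached one at a time; every real number lies in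
      the interior of some half-line \<open>{..real n}\<close>.\<close>
    have cn: "continuous_on {..real n} \<gamma>" for n
    proof (induction n)
      case 0
      have "continuous_on {..0} (\<lambda>s. F s (Y 0))"
        using continuous_on_subset[OF integral_curveD(3)[OF F_curve]] by blast
      then have "continuous_on {..0} \<gamma>" by (rule continuous_on_eq) (simp add: \<gamma>neg)
      then show ?case by simp
    next
      case (Suc n)
      have "continuous_on {real n..real n + 1} (\<lambda>s. lf n (s - real n))"
        by (rule continuous_on_compose2[OF lf_cont]) (auto intro!: continuous_intros)
      then have "continuous_on {real n..real n + 1} \<gamma>" by (rule continuous_on_eq) (simp add: \<gamma>k)
      from continuous_on_closed_Un[OF closed_atMost closed_atLeastAtMost Suc this]
      show ?case by (rule continuous_on_subset) auto
    qed
    obtain n where "x < real n" using reals_Archimedean2 by blast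
    moreover have "continuous_on {..<real n} \<gamma>" by (rule continuous_on_subset[OF cn[of n]]) auto
    ultimately show "\<exists>U. open U \<and> x \<in> U \<and> continuous_on (UNIV \<inter> U) \<gamma>"
      by (intro exI[of _ "{..<real n}"]) auto
  qed
  have main: "C1_curve_on A \<gamma> u v \<and> (\<forall>s\<in>{u..v}. \<forall>d\<in>A. \<gamma> s \<in> cdom d \<longrightarrow>
      causal (g d (\<gamma> s)) (velocity \<gamma> {u..v} d s) \<and> future_directed g T d (\<gamma> s) (velocity \<gamma> {u..v} d s))"
    if p: "piece UNIV B' u v" for u v
  proof -
    have uv: "u < v" using p by (simp add: piece_def)
    from pieces[OF p] show ?thesis
    proof (elim disjE exE conjE)
      assume v0: "v \<le> 0"
      \<comment> \<open>The past flow line is the lift of the constant curve with lift time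
        \<open>s\<close> itself, so the velocity formula of \<open>lift_C1\<close> and the case
        \<open>W = 0\<close> of \<open>causal_lift\<close> apply.\<close>
      have Cc: "C1_curve_on A (\<lambda>_. Y 0) u v" by (rule C1_curve_on_const[OF uv])
      have id: "((\<lambda>s. s) has_vector_derivative 1) (at s within {u..v})" for s by (auto intro!: derivative_eq_intros)
      note lift = lift_C1[where \<phi>="\<lambda>s. s" and \<phi>'="\<lambda>_. 1", OF Cc uv id continuous_on_const]
      have eq: "\<forall>s\<in>{u..v}. \<gamma> s = F (s - 0) (Y 0)" using \<gamma>neg v0 by simp
      have C': "C1_curve_on A (\<lambda>s. F s (Y 0)) (u - 0) (v - 0)" using lift(1) by simp
      note sh = C1_curve_on_shift[OF C' uv eq]
      show ?thesis
      proof (intro conjI ballI impI)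
        show "C1_curve_on A \<gamma> u v" by (rule sh(1))
        fix s d assume s: "s \<in> {u..v}" and d: "d \<in> A" "\<gamma> s \<in> cdom d"
        have \<gamma>s: "\<gamma> s = F s (Y 0)" using bspec[OF eq s] by simp
        obtain c where c: "c \<in> A" "Y 0 \<in> cdom c" by (rule chart_at)
        have "velocity (\<lambda>_. Y 0) {u..v} c s = 0" by (rule velocity_eq[OF uv s]) simp
        then have "velocity \<gamma> {u..v} d s = 1 *\<^sub>R X d (F s (Y 0)) + dF c d s (Y 0) 0"
          using sh(2)[OF s d] lift(2)[OF s c(1) d(1) c(2)] d(2) \<gamma>s by simp
        then have v: "velocity \<gamma> {u..v} d s = 1 *\<^sub>R X d (\<gamma> s) + 0"
          using linear_0[OF has_derivative_linear[OF dF_has_derivative[OF c(1) d(1) c(2)]]] d(2) \<gamma>s by simp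
        have "dt d (\<gamma> s) 0 = 0" "- lapse d (\<gamma> s) * g d (\<gamma> s) 0 0 \<le> 1\<^sup>2"
          using linear_0[OF dt_linear[OF d]] metric_bilinear[OF d] by (simp_all add: bilinear_simps)
        from causal_lift[OF d this(1) zero_less_one this(2)]
        show "causal (g d (\<gamma> s)) (velocity \<gamma> {u..v} d s)" "future_directed g T d (\<gamma> s) (velocity \<gamma> {u..v} d s)"
          unfolding v by auto
      qed
    next
      fix k assume k: "real k \<le> u" "v \<le> real k + 1" "piece {0..1} (B k) (u - real k) (v - real k)"
      have eq: "\<forall>s\<in>{u..v}. \<gamma> s = lf k (s - real k)" using \<gamma>k k by auto
      note sh = C1_curve_on_shift[OF lf_C1[OF k(3)] uv eq]
      show ?thesis
      proof (intro conjI ballI impI)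
        show "C1_curve_on A \<gamma> u v" by (rule sh(1))
        fix s d assume s: "s \<in> {u..v}" and d: "d \<in> A" "\<gamma> s \<in> cdom d"
        have s': "s - real k \<in> {u - real k..v - real k}" using s by auto
        show "causal (g d (\<gamma> s)) (velocity \<gamma> {u..v} d s)" "future_directed g T d (\<gamma> s) (velocity \<gamma> {u..v} d s)"
          using lf_causal[OF k(3) s' d(1)] d(2) unfolding sh(2)[OF s d] bspec[OF eq s] by auto
      qed
    qed
  qed
  have "piecewise_C1_curve A UNIV B' \<gamma>"
    unfolding piecewise_C1_curve_def
    using cont finB main lt_ex[of "0::real"] by auto
  then have causal: "causal_curve A g T UNIV \<gamma>" unfolding causal_curve_def using main by blast
  have t\<gamma>: "t (\<gamma> s) = a + s" if "s \<le> 0" for s using \<gamma>neg[OF that] Y by (simp add: t_F)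
  have "t (\<gamma> s) \<le> a + 1" for s
  proof (cases "s \<le> 0")
    case False
    define k where "k = nat \<lfloor>s\<rfloor>"
    have k: "s \<in> {real k..real k + 1}" using False unfolding k_def by auto
    then have s': "s - real k \<in> {0..1}" by auto
    have "t (\<gamma> s) = a + \<phi> k (s - real k)" using \<gamma>k[OF k] lev[OF s'] by (simp add: lf_def t_F)
    then show ?thesis using \<phi>r[OF s', of k] by simp
  qed (use t\<gamma> in simp)
  \<comment> \<open>A value above \<open>a + 1\<close> is missed, so the Cauchy condition forces
    \<open>\<gamma>\<close> to be extendible at one of its two ends.\<close>
  then have "(t \<circ> \<gamma>) ` UNIV \<noteq> UNIV"
    by (metis (no_types, lifting) UNIV_I comp_apply imageE less_add_one linorder_not_less)
  then have "\<not> inextendible UNIV \<gamma>" using t_cauchy[OF causal] by blast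
  moreover have "\<not> left_endpoint UNIV \<gamma> p" for p
  proof
    assume l: "left_endpoint UNIV \<gamma> p"
    have "open (t -` {t p - 1<..})" by (rule open_vimage[OF open_greaterThan t_continuous])
    then obtain s0 where s0: "\<And>s. s \<le> s0 \<Longrightarrow> t (\<gamma> s) > t p - 1"
      using l unfolding left_endpoint_def by force
    \<comment> \<open>Nonpositive, so that \<open>t (\<gamma> s) = a + s\<close>, and at most
      \<open>t p - 1 - a\<close>, so that this value falls below the neighbourhood of
      \<open>p\<close>.\<close>
    define s where "s = min s0 (min 0 (t p - 1 - a))"
    have "t (\<gamma> s) = a + s" by (rule t\<gamma>) (simp add: s_def)
    then show False using s0[of s] by (simp add: s_def)
  qed
  ultimately obtain p where p: "right_endpoint UNIV \<gamma> p" by (auto simp: inextendible_def)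
  have lim\<gamma>: "(\<lambda>k. \<gamma> (real k)) \<longlonglongrightarrow> p"
  proof (rule topological_tendstoI)
    fix U assume "open U" "p \<in> U"
    then obtain s0 where s0: "\<And>s. s0 \<le> s \<Longrightarrow> \<gamma> s \<in> U" using p unfolding right_endpoint_def by blast
    show "\<forall>\<^sub>F k in sequentially. \<gamma> (real k) \<in> U"
      by (rule eventually_mono[OF eventually_ge_at_top[of "nat \<lceil>s0\<rceil>"]]) (rule s0, linarith)
  qed
  \<comment> \<open>The accumulated times increase and are bounded by 1, so they converge. Flowing
    back by them from the integer parameters of \<open>\<gamma>\<close> recovers \<open>Y k\<close>,
    and continuity of \<open>F\<close> in both arguments carries the limit over.\<close>
  have "incseq \<Phi>" by (rule incseq_SucI) (simp add: \<Phi>Suc ll)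
  then obtain L where L: "\<Phi> \<longlonglongrightarrow> L" using incseq_convergent \<Phi>1 by metis
  have "(\<lambda>k. F (fst (- \<Phi> k, \<gamma> (real k))) (snd (- \<Phi> k, \<gamma> (real k)))) \<longlonglongrightarrow> F (fst (- L, p)) (snd (- L, p))"
    by (rule continuous_on_tendsto_compose[OF F_continuous]) (auto intro!: tendsto_intros L lim\<gamma>)
  moreover have "F (- \<Phi> k) (\<gamma> (real k)) = Y k" for k
    using \<gamma>k[of "real k" k] F_add[of "- \<Phi> k" "\<Phi> k" "Y k"] F_0 by (simp add: lf_def \<phi>0 ends)
  ultimately have lim: "Y \<longlonglongrightarrow> F (- L) p" by simp
  have "(\<lambda>k. t (Y k)) \<longlonglongrightarrow> t (F (- L) p)"
    by (rule continuous_on_tendsto_compose[OF t_continuous lim]) auto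
  then have "t (F (- L) p) = a" using Y LIMSEQ_const_iff[of a "t (F (- L) p)"] by auto
  then show ?thesis using that lim by blast
qed

section \<open>From convergence in the manifold to completeness of the level sets\<close>

lemma riem_dist_tendsto_0:
  assumes Z: "Z \<longlonglongrightarrow> q" "t q = a" and lev: "\<And>n. t (Z n) = a"
  shows "(\<lambda>n. riem_dist A g (level_set t a) (Z n) q) \<longlonglongrightarrow> 0"
proof (rule order_tendstoI)
  fix e :: ennreal assume "0 < e"
  then obtain e' where e': "0 < e'" "e' < e" using dense by blast
  then obtain r where r: "e' = ennreal r" "r > 0" by (cases e') auto
  obtain U where U: "open U" "q \<in> U" "\<And>y. y \<in> U \<Longrightarrow> t y = a \<Longrightarrow> riem_dist A g (level_set t a) y q < ennreal r"
    using short_curves[OF Z(2) r(2)] by metis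
  have "\<forall>\<^sub>F n in sequentially. Z n \<in> U" using topological_tendstoD[OF Z(1) U(1,2)] .
  then show "\<forall>\<^sub>F n in sequentially. riem_dist A g (level_set t a) (Z n) q < e"
    by eventually_elim (use U(3) lev e'(2) r(1) in \<open>auto intro: less_trans\<close>)
qed auto

text \<open>The Cauchy property bounds the distance of any two members with large indices. As
  \<open>M\<close> increases and dominates \<open>n0\<close>, every choice of indices
  \<open>i k \<ge> M k\<close> gives a fast sequence, its members number \<open>k\<close> and
  \<open>Suc k\<close> both lying beyond \<open>n0 k\<close>. This freedom in \<open>i\<close>
  allows a comparison of different choices.\<close>

lemma level_set_complete: "induced_complete A g (level_set t a)"
  unfolding induced_complete_def
proof (intro allI impI, elim conjE)
  fix Z :: "nat \<Rightarrow> 'a"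
  let ?d = "riem_dist A g (level_set t a)"
  assume "\<forall>n. Z n \<in> level_set t a"
    and Cau: "\<forall>e>0. \<exists>N. \<forall>m\<ge>N. \<forall>n\<ge>N. ?d (Z m) (Z n) < ennreal e"
  then have Z: "t (Z n) = a" for n by (simp add: level_set_def)
  obtain \<kappa> where \<kappa>: "is_lift_factor a \<kappa>" using lift_factor_exists by blast
  have \<delta>: "(1/2)^(k+2) / \<kappa> > 0" for k :: nat using \<kappa> by (simp add: is_lift_factor_def)
  have "\<exists>N. \<forall>m\<ge>N. \<forall>n\<ge>N. ?d (Z m) (Z n) < ennreal ((1/2)^(k+2) / \<kappa>)" for k :: nat
    using Cau \<delta> by blast
  then obtain n0 where n0: "\<And>k m n. m \<ge> n0 k \<Longrightarrow> n \<ge> n0 k \<Longrightarrow> ?d (Z m) (Z n) < ennreal ((1/2)^(k+2) / \<kappa>)"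
    by metis
  define M where "M k = (\<Sum>j\<le>k. n0 j)" for k
  have Mn: "n0 k \<le> M k" "M k \<le> M (Suc k)" for k unfolding M_def by (auto intro: member_le_sum)
  have conv: "\<exists>q. t q = a \<and> (\<lambda>k. Z (i k)) \<longlonglongrightarrow> q" if i: "\<And>k. M k \<le> i k" for i :: "nat \<Rightarrow> nat"
  proof (rule fast_sequence_converges[OF \<kappa>, of "\<lambda>k. Z (i k)"])
    show "?d (Z (i k)) (Z (i (Suc k))) < ennreal ((1/2)^(k+2) / \<kappa>)" for k
      by (rule n0) (use i[of k] i[of "Suc k"] Mn[of k] in linarith)+
  qed (use Z in auto)
  obtain q where q: "t q = a" "(\<lambda>k. Z (M k)) \<longlonglongrightarrow> q" using conv[of M] by blast
  have "Z \<longlonglongrightarrow> q"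
  proof (rule ccontr)
    text \<open>Interleaving the convergent subsequence with a bad one gives a fast sequence, whose limit must be \<open>q\<close>.\<close>
    assume "\<not> Z \<longlonglongrightarrow> q"
    then obtain U where U: "open U" "q \<in> U" "\<not> (\<forall>\<^sub>F n in sequentially. Z n \<in> U)"
      unfolding tendsto_def by blast
    then have "\<exists>n\<ge>M k. Z n \<notin> U" for k unfolding eventually_sequentially by blast
    then obtain b where b: "\<And>k. b k \<ge> M k" "\<And>k. Z (b k) \<notin> U" by metis
    define i where "i k = (if even k then M k else b k)" for k
    have "M k \<le> i k" for k using b(1) by (simp add: i_def)
    then obtain q' where q': "(\<lambda>k. Z (i k)) \<longlonglongrightarrow> q'" using conv[of i] by blast
    have "strict_mono (\<lambda>k::nat. 2 * k)" "strict_mono (\<lambda>k::nat. 2 * k + 1)" by (auto simp: strict_mono_def)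
    note sub = LIMSEQ_subseq_LIMSEQ[OF q' this(1)] LIMSEQ_subseq_LIMSEQ[OF q' this(2)]
      LIMSEQ_subseq_LIMSEQ[OF q(2) this(1)]
    have "q' = q" using LIMSEQ_unique[OF sub(1)] sub(3) by (simp add: comp_def i_def)
    then have "(\<lambda>k. Z (b (2 * k + 1))) \<longlonglongrightarrow> q" using sub(2) by (simp add: comp_def i_def)
    then have "\<forall>\<^sub>F k in sequentially. Z (b (2 * k + 1)) \<in> U" using U(1,2) by (rule topological_tendstoD)
    then show False using b(2) by simp
  qed
  then have "(\<lambda>n. ?d (Z n) q) \<longlonglongrightarrow> 0" using q(1) Z by (rule riem_dist_tendsto_0)
  then show "\<exists>p\<in>level_set t a. (\<lambda>n. ?d (Z n) p) \<longlonglongrightarrow> 0" using q(1) by (auto simp: level_set_def)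
qed

end

theorem theorem2:
  fixes A :: "('a::{t2_space,second_countable_topology}, 'b::euclidean_space) chart set"
    and g :: "('a, 'b) metric" and T :: "('a, 'b) vfield"
    and t :: "'a \<Rightarrow> real"
  assumes "time_oriented_lorentz_manifold A g T"
    and "sm_cauchy_temporal A g T t"
  shows "\<forall>a. induced_complete A g (level_set t a)"
proof -
  interpret sm_cauchy_manifold A g T t
    by unfold_locales fact+
  show ?thesis using level_set_complete by blast
qed

end
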